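(* Let $m$ be a positive integer, let $K\subseteq\mathbb{R}$ be compact with finitely many isolated points, and let $\gamma:K\to\mathbb{H}$. Suppose there exist a modulus of continuity $\omega$ and a constant $M>0$ such that for every $X\subseteq K$ with $\#X=m+2$ there is a curve $\Gamma_X\in C^{m,\omega}(\mathbb{R},\mathbb{R}^3)$ with $\Gamma_X=\gamma$ on $X$, such that $\sup_X\|\Gamma_X\|<\infty$ (supremum over all such $X$) and $$\left|\frac{A(\Gamma_X;a,b)}{V(\Gamma_X;a,b)}\right|\le M\,\omega(b-a)\quad\text{for all } a,b\in K \text{ with } a<b.$$ Then there is a horizontal curve $\Gamma\in C^{m,\sqrt{\omega}}(\mathbb{R},\mathbb{R}^3)$ with $\Gamma|_K=\gamma$.
   Context: The Heisenberg group $\mathbb{H}$ is $\mathbb{R}^3$ with group law $(x,y,z)*(x',y',z') = (x+x',\,y+y',\,z+z'+2(yx'-xy'))$. An absolutely continuous curve $\Gamma=(f,g,h):\mathbb{R}\to\mathbb{R}^3$ is horizontal if $h'=2(f'g-fg')$ a.e. A modulus of continuity is a continuous, increasing, concave function $\omega:[0,\infty)\to[0,\infty)$ with $\omega(0)=0$. $C^{m,\omega}(\mathbb{R})$ is the space of $m$-times continuously differentiable $\phi:\mathbb{R}\to\mathbb{R}$ with finite seminorm $\|\phi\|=\sup_{a\neq b}|\phi^{(m)}(b)-\phi^{(m)}(a)|/\omega(|b-a|)$; $C^{m,\omega}(\mathbb{R},\mathbb{R}^3)$ consists of curves with all three components in $C^{m,\omega}(\mathbb{R})$, and $\|\Gamma\|$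 denotes the sum of the seminorms of its components. For $\Gamma=(f,g,h)$ of class $C^m$ and $a\in\mathbb{R}$ let $T_af(x)=\sum_{k=0}^m\frac{f^{(k)}(a)}{k!}(x-a)^k$ (similarly $T_ag$), and for $a,b\in\mathbb{R}$: $A(\Gamma;a,b)= h(b)-h(a)-2\int_a^b\big((T_af)'T_ag-(T_ag)'T_af\big) + 2f(a)(g(b)-T_ag(b)) - 2g(a)(f(b)-T_af(b))$, $V(\Gamma;a,b)=(b-a)^{2m}+(b-a)^m\int_a^b(|(T_af)'|+|(T_ag)'|)$. *)

theory Defs
  imports "HOL-Analysis.Analysis"
begin

type_synonym curve = "real \<Rightarrow> real \<times> real \<times> real"

definition cx :: "curve \<Rightarrow> real \<Rightarrow> real" where "cx \<Gamma> t = fst (\<Gamma> t)"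
definition cy :: "curve \<Rightarrow> real \<Rightarrow> real" where "cy \<Gamma> t = fst (snd (\<Gamma> t))"
definition cz :: "curve \<Rightarrow> real \<Rightarrow> real" where "cz \<Gamma> t = snd (snd (\<Gamma> t))"

definition modulus_of_continuity :: "(real \<Rightarrow> real) \<Rightarrow> bool" where
  "modulus_of_continuity \<omega> \<longleftrightarrow>
     continuous_on {0..} \<omega> \<and> strict_mono_on {0..} \<omega> \<and> concave_on {0..} \<omega> \<and>
     \<omega> 0 = 0 \<and> (\<forall>t\<ge>0. \<omega> t \<ge> 0)"

definition Cm :: "nat \<Rightarrow> (real \<Rightarrow> real) \<Rightarrow> bool" where
  "Cm m \<phi> \<longleftrightarrow> (\<forall>k<m. \<forall>x. ((deriv ^^ k) \<phi>) differentiable (at x))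
                 \<and> continuous_on UNIV ((deriv ^^ m) \<phi>)"

definition Cmw :: "nat \<Rightarrow> (real \<Rightarrow> real) \<Rightarrow> (real \<Rightarrow> real) \<Rightarrow> bool" where
  "Cmw m \<omega> \<phi> \<longleftrightarrow> Cm m \<phi> \<and>
     bdd_above {\<bar>(deriv ^^ m) \<phi> b - (deriv ^^ m) \<phi> a\<bar> / \<omega> \<bar>b - a\<bar> | a b. a \<noteq> b}"

definition seminorm :: "nat \<Rightarrow> (real \<Rightarrow> real) \<Rightarrow> (real \<Rightarrow> real) \<Rightarrow> real" where
  "seminorm m \<omega> \<phi> =
     Sup {\<bar>(deriv ^^ m) \<phi> b - (deriv ^^ m) \<phi> a\<bar> / \<omega> \<bar>b - a\<bar> | a b. a \<noteq> b}"

definition Cmw_curve :: "nat \<Rightarrow> (real \<Rightarrow> real) \<Rightarrow> curve \<Rightarrow> bool" where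
  "Cmw_curve m \<omega> \<Gamma> \<longleftrightarrow> Cmw m \<omega> (cx \<Gamma>) \<and> Cmw m \<omega> (cy \<Gamma>) \<and> Cmw m \<omega> (cz \<Gamma>)"

definition curve_seminorm :: "nat \<Rightarrow> (real \<Rightarrow> real) \<Rightarrow> curve \<Rightarrow> real" where
  "curve_seminorm m \<omega> \<Gamma> =
     seminorm m \<omega> (cx \<Gamma>) + seminorm m \<omega> (cy \<Gamma>) + seminorm m \<omega> (cz \<Gamma>)"

definition taylor :: "nat \<Rightarrow> (real \<Rightarrow> real) \<Rightarrow> real \<Rightarrow> real \<Rightarrow> real" where
  "taylor m f a x = (\<Sum>k\<le>m. (deriv ^^ k) f a / fact k * (x - a) ^ k)"

definition A_fun :: "nat \<Rightarrow> curve \<Rightarrow> real \<Rightarrow> real \<Rightarrow> real" where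
  "A_fun m \<Gamma> a b =
     (let f = cx \<Gamma>; g = cy \<Gamma>; h = cz \<Gamma>;
          Tf = taylor m f a; Tg = taylor m g a
      in h b - h a
         - 2 * integral {a..b} (\<lambda>x. deriv Tf x * Tg x - deriv Tg x * Tf x)
         + 2 * f a * (g b - Tg b) - 2 * g a * (f b - Tf b))"

definition V_fun :: "nat \<Rightarrow> curve \<Rightarrow> real \<Rightarrow> real \<Rightarrow> real" where
  "V_fun m \<Gamma> a b =
     (let Tf = taylor m (cx \<Gamma>) a; Tg = taylor m (cy \<Gamma>) a
      in (b - a) ^ (2 * m)
         + (b - a) ^ m * integral {a..b} (\<lambda>x. \<bar>deriv Tf x\<bar> + \<bar>deriv Tg x\<bar>))"

definition abs_cont :: "(real \<Rightarrow> real) \<Rightarrow> bool" where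
  "abs_cont f \<longleftrightarrow> (\<forall>c d. \<forall>\<epsilon>>0. \<exists>\<delta>>0. \<forall>n::nat. \<forall>u v.
      (\<forall>i<n. c \<le> u i \<and> u i \<le> v i \<and> v i \<le> d) \<and>
      (\<forall>i<n. \<forall>j<n. i \<noteq> j \<longrightarrow> v i \<le> u j \<or> v j \<le> u i) \<and>
      (\<Sum>i<n. v i - u i) < \<delta> \<longrightarrow> (\<Sum>i<n. \<bar>f (v i) - f (u i)\<bar>) < \<epsilon>)"

definition horizontal :: "curve \<Rightarrow> bool" where
  "horizontal \<Gamma> \<longleftrightarrow> abs_cont (cx \<Gamma>) \<and> abs_cont (cy \<Gamma>) \<and> abs_cont (cz \<Gamma>) \<and>
     (AE t in lebesgue. \<exists>df dg dh.
        (cx \<Gamma> has_real_derivative df) (at t) \<and>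
        (cy \<Gamma> has_real_derivative dg) (at t) \<and>
        (cz \<Gamma> has_real_derivative dh) (at t) \<and>
        dh = 2 * (df * cy \<Gamma> t - cx \<Gamma> t * dg))"

end

theory Submission
  imports Defs "HOL-Computational_Algebra.Polynomial" "HOL-Analysis.Interval_Integral"
begin

text \<open>
  At a limit point a of K the jets of the x- and y-components are the limits of the derivatives at a
  of the interpolants of (m + 2)-point sets shrinking to a; two such interpolants can be joined by
  exchanging one point at a time, so Rolle's theorem gives the Cauchy property, Whitney's condition
  and the stability of A/V.  At the finitely many isolated points any jets will do.  It then remains
  to fill each gap (a, b) by polynomials with prescribed jets at both ends that sweep out the signed
  area required by the z-component.  The area deficit of the Hermite interpolant is at most a
  constant times omega(b - a) V(a, b).  If V is dominated by its first term, the deficit is removed by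
  two bumps of size sqrt(omega(b - a)) (b - a)^m, whose area is quadratic in their size; otherwise a
  smaller perturbation along the velocity changes the area linearly.  The z-component of the
  resulting horizontal lift differs from the given one by a function on K which is constant across
  gaps and has increments o(b - a), hence is constant.
\<close>

section \<open>Moduli of continuity\<close>

text \<open>With t = (x - a)/(b - a), w = omega(b - a) and Delta = (b - a)^m, the bound on A/V
  becomes a bound by a multiple of w (Delta^2 + Delta * speed) for polynomials of degree at most m
  on [0,1]; norms on that space are equivalent, so no constant depends on the gap. The correction
  terms make A invariant under left translations: a perturbation vanishing at a changes A to first
  order only through the derivatives of the pair, which V measures. Perturbations of size w Delta
  hence preserve the bound, which serves twice: in passing from interpolants to limit jets, and in
  moving the Taylor polynomial at a to match the jet at b. Sets have m + 2 points because after one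
  exchange m + 1 points stay common, the number of zeros by which Rolle's theorem reaches order m.
  Near an isolated point there are no such sets; the constant is enlarged once for each of these
  points, hence finiteness. Two points -R and R outside K are added with vanishing derivatives, so
  that the extension is constant at both ends and all its derivatives are bounded; products are then
  again Hoelder.\<close>

lemma modulus_pos:
  assumes "modulus_of_continuity \<omega>" "t > 0"
  shows "\<omega> t > 0"
  using assms unfolding modulus_of_continuity_def strict_mono_on_def
  by (metis atLeast_iff less_eq_real_def)

lemma modulus_nonneg:
  assumes "modulus_of_continuity \<omega>" "t \<ge> 0"
  shows "\<omega> t \<ge> 0"
  using assms unfolding modulus_of_continuity_def by blast

lemma modulus_mono:
  assumes "modulus_of_continuity \<omega>" "0 \<le> s" "s \<le> t"
  shows "\<omega> s \<le> \<omega> t"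
  using assms unfolding modulus_of_continuity_def strict_mono_on_def
  by (metis atLeast_iff less_eq_real_def order_trans)

text \<open>Concavity and \<open>\<omega> 0 = 0\<close> make \<open>\<omega> t / t\<close>
  nonincreasing. This is how a bound for a whole gap passes to a part of it.\<close>

lemma modulus_star:
  assumes "modulus_of_continuity \<omega>" "0 < s" "s \<le> t"
  shows "\<omega> t * s \<le> \<omega> s * t"
proof -
  have c: "concave_on {0..} \<omega>" "\<omega> 0 = 0"
    using assms(1) by (auto simp: modulus_of_continuity_def)
  have t: "t > 0" using assms by linarith
  have "\<omega> ((1 - s/t) *\<^sub>R 0 + (s/t) *\<^sub>R t) \<ge> (1 - s/t) * \<omega> 0 + (s/t) * \<omega> t"
    by (rule concave_onD[OF c(1)]) (use assms t in auto)
  then show ?thesis using t c(2) by (simp add: field_simps)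
qed

lemma modulus_double:
  assumes "modulus_of_continuity \<omega>" "0 \<le> t"
  shows "\<omega> (2 * t) \<le> 2 * \<omega> t"
proof (cases "t = 0")
  case True
  then show ?thesis using assms by (simp add: modulus_of_continuity_def)
next
  case False
  then have t: "t > 0" using assms by simp
  then have "\<omega> (2 * t) * t \<le> \<omega> t * (2 * t)"
    using modulus_star[OF assms(1) t, of "2*t"] by simp
  then show ?thesis using t by (simp add: mult.commute mult.left_commute)
qed

lemma modulus_tendsto_0:
  assumes "modulus_of_continuity \<omega>"
  shows "(\<omega> \<longlongrightarrow> 0) (at_right 0)"
proof -
  have "continuous_on {0..} \<omega>" "\<omega> 0 = 0" using assms by (auto simp: modulus_of_continuity_def)
  then have "(\<omega> \<longlongrightarrow> \<omega> 0) (at 0 within {0..})"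
    unfolding continuous_on_def by blast
  then show ?thesis using \<open>\<omega> 0 = 0\<close>
    by (metis at_within_Ici_at_right)
qed

lemma modulus_small:
  assumes "modulus_of_continuity \<omega>" "e > 0"
  obtains d where "d > 0" "\<And>t. 0 \<le> t \<Longrightarrow> t < d \<Longrightarrow> \<omega> t < e"
proof -
  have "eventually (\<lambda>t. \<omega> t < e) (at_right 0)"
    using modulus_tendsto_0[OF assms(1)] assms(2) by (rule order_tendstoD)
  then obtain d where "d > 0" "\<And>t. 0 < t \<Longrightarrow> t < d \<Longrightarrow> \<omega> t < e"
    by (auto simp: eventually_at_right_field)
  moreover have "\<omega> 0 < e" using assms by (simp add: modulus_of_continuity_def)
  ultimately show ?thesis using that by (metis less_eq_real_def)
qed


text \<open>An increasing concave function of a concave function is concave; \<open>sq\<close>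
  obtains concavity of the square root from the variance identity.\<close>

lemma modulus_sqrt:
  assumes "modulus_of_continuity \<omega>"
  shows "modulus_of_continuity (\<lambda>t. sqrt (\<omega> t))"
proof -
  have c: "concave_on {0..} \<omega>" "\<omega> 0 = 0" "continuous_on {0..} \<omega>" "strict_mono_on {0..} \<omega>"
    and nn: "\<And>t. t \<ge> 0 \<Longrightarrow> \<omega> t \<ge> 0"
    using assms by (auto simp: modulus_of_continuity_def)
  have sq: "(1 - u) * sqrt x + u * sqrt y \<le> sqrt ((1 - u) * x + u * y)"
    if "0 \<le> u" "u \<le> 1" "0 \<le> x" "0 \<le> y" for u x y :: real
  proof (rule real_le_rsqrt)
    have "((1 - u) * sqrt x + u * sqrt y)\<^sup>2
        = (1 - u) * (sqrt x)\<^sup>2 + u * (sqrt y)\<^sup>2 - (1 - u) * u * (sqrt x - sqrt y)\<^sup>2"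
      by (simp add: power2_eq_square algebra_simps)
    also have "\<dots> \<le> (1 - u) * (sqrt x)\<^sup>2 + u * (sqrt y)\<^sup>2"
      using that by simp
    finally show "((1 - u) * sqrt x + u * sqrt y)\<^sup>2 \<le> (1 - u) * x + u * y"
      using that by simp
  qed
  have "concave_on {0..} (\<lambda>t. sqrt (\<omega> t))"
    unfolding concave_on_iff
  proof (intro conjI ballI allI impI)
    show "convex {0::real..}" by simp
    fix x y u v :: real
    assume *: "x \<in> {0..}" "y \<in> {0..}" "0 \<le> u" "0 \<le> v" "u + v = 1"
    have u: "1 - v = u" using *(5) by linarith
    have "u * sqrt (\<omega> x) + v * sqrt (\<omega> y) \<le> sqrt (u * \<omega> x + v * \<omega> y)"
      using sq[of v "\<omega> x" "\<omega> y"] * nn[of x] nn[of y] u by simp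
    also have "\<dots> \<le> sqrt (\<omega> (u *\<^sub>R x + v *\<^sub>R y))"
      using c(1) * unfolding concave_on_iff by auto
    finally show "u * sqrt (\<omega> x) + v * sqrt (\<omega> y) \<le> sqrt (\<omega> (u *\<^sub>R x + v *\<^sub>R y))" .
  qed
  then show ?thesis using c nn
    by (auto simp: modulus_of_continuity_def strict_mono_on_def intro!: continuous_intros)
qed

text \<open>On a bounded range the modulus is dominated by its own square root, so conditions with
  respect to omega can be weakened to the modulus of the conclusion.\<close>

lemma modulus_le_sqrt:
  assumes "modulus_of_continuity \<omega>" "0 \<le> t" "t \<le> R"
  shows "\<omega> t \<le> sqrt (\<omega> R) * sqrt (\<omega> t)"
proof -
  have "\<omega> t = sqrt (\<omega> t) * sqrt (\<omega> t)" using modulus_nonneg[OF assms(1,2)] by simp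
  also have "\<dots> \<le> sqrt (\<omega> R) * sqrt (\<omega> t)"
    using modulus_mono[OF assms] modulus_nonneg[OF assms(1,2)] by (intro mult_right_mono) auto
  finally show ?thesis .
qed

section \<open>Derivative chains and Rolle's theorem\<close>

text \<open>Integrate down from order \<open>n\<close>. Each step adds the initial value at
  \<open>c\<close>, one more unit \<open>\<eta> * s ^ (n - k)\<close>, which explains the factor
  \<open>n - k + 1\<close>.\<close>

lemma derivative_chain_bound:
  fixes u :: "nat \<Rightarrow> real \<Rightarrow> real"
  assumes der: "\<And>k y. k < n \<Longrightarrow> y \<in> closed_segment c x \<Longrightarrow>
      (u k has_real_derivative u (Suc k) y) (at y)"
    and top: "\<And>y. y \<in> closed_segment c x \<Longrightarrow> \<bar>u n y\<bar> \<le> \<eta>"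
    and base: "\<And>k. k < n \<Longrightarrow> \<bar>u k c\<bar> \<le> \<eta> * s ^ (n - k)"
    and s: "\<bar>x - c\<bar> \<le> s"
    and k: "k \<le> n" and y: "y \<in> closed_segment c x"
  shows "\<bar>u k y\<bar> \<le> real (n - k + 1) * \<eta> * s ^ (n - k)"
  using k y
proof (induction k arbitrary: y rule: inc_induct)
  case base
  then show ?case using top by simp
next
  case (step k)
  have \<eta>: "\<eta> \<ge> 0" using top[of c] by (smt (verit) ends_in_segment(1))
  have s0: "s \<ge> 0" using s by linarith
  define B where "B = real (n - k) * \<eta> * s ^ (n - Suc k)"
  have "B \<ge> 0" using \<eta> s0 by (simp add: B_def)
  have nk: "n - Suc k + 1 = n - k" using step.hyps by simp
  have "norm (u k y - u k c) \<le> B * norm (y - c)"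
  proof (rule field_differentiable_bound[of "closed_segment c x"])
    show "(u k has_real_derivative u (Suc k) z) (at z within closed_segment c x)"
      if "z \<in> closed_segment c x" for z
      using der[OF step.hyps(2) that] by (rule DERIV_subset) simp
    show "norm (u (Suc k) z) \<le> B" if "z \<in> closed_segment c x" for z
      using step.IH[OF that] nk by (simp add: B_def)
  qed (use step.prems in auto)
  also have "\<dots> \<le> B * s"
  proof (intro mult_left_mono)
    have "\<bar>y - c\<bar> \<le> \<bar>x - c\<bar>"
      using step.prems by (auto simp: closed_segment_eq_real_ivl split: if_splits)
    then show "norm (y - c) \<le> s" using s by simp
  qed fact
  also have "\<dots> = real (n - k) * \<eta> * s ^ (n - k)"
  proof -
    have "n - k = Suc (n - Suc k)" using step.hyps by simp
    then show ?thesis by (simp add: B_def)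
  qed
  finally have "\<bar>u k y\<bar> \<le> real (n - k) * \<eta> * s ^ (n - k) + \<bar>u k c\<bar>" by simp
  also have "\<dots> \<le> real (n - k) * \<eta> * s ^ (n - k) + \<eta> * s ^ (n - k)"
    using base[OF step.hyps(2)] by simp
  finally show ?case by (simp add: algebra_simps)
qed

lemma Cm_has_derivative:
  assumes "Cm m \<phi>" "k < m"
  shows "((deriv ^^ k) \<phi> has_real_derivative (deriv ^^ Suc k) \<phi> x) (at x)"
  using assms DERIV_deriv_iff_real_differentiable unfolding Cm_def by auto

text \<open>Keeping the new zeros strictly below \<open>Max Z\<close> makes the induction count: the
  zeros from the smaller set lie below its maximum \<open>a\<close>, and the additional one lies
  between \<open>a\<close> and \<open>Max Z\<close>.\<close>

lemma rolle_finite_set: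
  fixes u u' :: "real \<Rightarrow> real"
  assumes der: "\<And>x. (u has_real_derivative u' x) (at x)"
    and "finite Z" "card Z = Suc n" "Z \<subseteq> {lo..hi}" "\<And>z. z \<in> Z \<Longrightarrow> u z = 0"
  shows "\<exists>Z'. finite Z' \<and> card Z' = n \<and> Z' \<subseteq> {lo..<Max Z} \<and> (\<forall>z\<in>Z'. u' z = 0)"
  using assms(2-)
proof (induction n arbitrary: Z)
  case 0
  then show ?case by (intro exI[of _ "{}"]) auto
next
  case (Suc n)
  define b where "b = Max Z"
  define Y where "Y = Z - {b}"
  have ne: "Z \<noteq> {}" using Suc.prems by auto
  have b: "b \<in> Z" using Suc.prems ne by (simp add: b_def)
  have cY: "card Y = Suc n" "finite Y" using Suc.prems b by (auto simp: Y_def)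
  then have "Y \<noteq> {}" by auto
  define a where "a = Max Y"
  have a: "a \<in> Y" using cY \<open>Y \<noteq> {}\<close> by (simp add: a_def)
  have "a \<le> b" using a Suc.prems by (auto simp: b_def Y_def)
  then have ab: "a < b" using a by (auto simp: Y_def)
  obtain Z' where Z': "finite Z'" "card Z' = n" "Z' \<subseteq> {lo..<a}" "\<forall>z\<in>Z'. u' z = 0"
    using Suc.IH[of Y] cY Suc.prems by (auto simp: Y_def a_def)
  have "\<exists>z>a. z < b \<and> u' z = 0"
  proof -
    have "\<exists>z. a < z \<and> z < b \<and> u b - u a = (b - a) * u' z"
      using ab der by (intro MVT2) auto
    moreover have "u a = 0" "u b = 0" using a b Suc.prems by (auto simp: Y_def)
    ultimately show ?thesis using ab by auto
  qed
  then obtain z where z: "a < z" "z < b" "u' z = 0" by blast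
  have "lo \<le> a" using a Suc.prems by (auto simp: Y_def)
  show ?case
    using Z' z \<open>lo \<le> a\<close> by (intro exI[of _ "insert z Z'"]) (auto simp: b_def[symmetric] card_insert_if)
qed

lemma rolle_iterated:
  fixes u :: "nat \<Rightarrow> real \<Rightarrow> real"
  assumes der: "\<And>k x. k < n \<Longrightarrow> (u k has_real_derivative u (Suc k) x) (at x)"
    and Z: "finite Z" "card Z = Suc n" "Z \<subseteq> {lo..hi}" "\<And>z. z \<in> Z \<Longrightarrow> u 0 z = 0"
    and "k \<le> n"
  shows "\<exists>z\<in>{lo..hi}. u k z = 0"
proof -
  have "\<exists>Y. finite Y \<and> card Y = Suc (n - k) \<and> Y \<subseteq> {lo..hi} \<and> (\<forall>z\<in>Y. u k z = 0)"
    using \<open>k \<le> n\<close>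
  proof (induction k)
    case 0
    then show ?case using Z by auto
  next
    case (Suc k)
    then obtain Y where Y: "finite Y" "card Y = Suc (n - k)" "Y \<subseteq> {lo..hi}" "\<forall>z\<in>Y. u k z = 0"
      by auto
    have "\<exists>Z'. finite Z' \<and> card Z' = n - k \<and> Z' \<subseteq> {lo..<Max Y} \<and> (\<forall>z\<in>Z'. u (Suc k) z = 0)"
      by (rule rolle_finite_set[of "u k"]) (use der Suc.prems Y in auto)
    then obtain Z' where Z': "finite Z'" "card Z' = n - k" "Z' \<subseteq> {lo..<Max Y}" "\<forall>z\<in>Z'. u (Suc k) z = 0"
      by blast
    have "Max Y \<in> Y" using Y by (intro Max_in) auto
    then have "Max Y \<le> hi" using Y by auto
    then show ?case using Z' Suc.prems by (intro exI[of _ Z']) force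
  qed
  then obtain Y where "finite Y" "card Y = Suc (n - k)" "Y \<subseteq> {lo..hi}" "\<forall>z\<in>Y. u k z = 0" by blast
  moreover from this have "Y \<noteq> {}" by auto
  ultimately show ?thesis by blast
qed

section \<open>Integrals of polynomials over the unit interval\<close>

definition pint :: "real poly \<Rightarrow> real" where "pint p = integral {0..1} (poly p)"

lemma poly_integrable [simp]: "poly p integrable_on {a..b::real}"
  by (intro integrable_continuous_interval continuous_intros)

lemma pint_0 [simp]: "pint 0 = 0"
proof -
  have "poly (0::real poly) = (\<lambda>_. 0)" by auto
  then show ?thesis by (simp add: pint_def)
qed

lemma pint_add: "pint (p + q) = pint p + pint q"
  unfolding pint_def poly_add[abs_def] by (rule integral_add) auto

lemma pint_diff: "pint (p - q) = pint p - pint q"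
  unfolding pint_def poly_diff[abs_def] by (rule integral_diff) auto

lemma pint_minus: "pint (- p) = - pint p"
  using pint_diff[of 0 p] by simp

lemma pint_smult: "pint (smult c p) = c * pint p"
  unfolding pint_def poly_smult[abs_def] by simp

lemma pint_pderiv: "pint (pderiv p) = poly p 1 - poly p 0"
proof -
  have "(poly (pderiv p) has_integral poly p 1 - poly p 0) {0..1}"
    by (rule fundamental_theorem_of_calculus)
       (auto simp: has_real_derivative_iff_has_vector_derivative[symmetric] intro: poly_DERIV DERIV_subset)
  then show ?thesis by (simp add: pint_def integral_unique)
qed

lemma pint_le:
  assumes "\<And>t. t \<in> {0..1} \<Longrightarrow> poly p t \<le> poly q t"
  shows "pint p \<le> pint q"
  unfolding pint_def by (rule integral_le) (use assms in auto)

lemma pint_nonneg: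
  assumes "\<And>t. t \<in> {0..1} \<Longrightarrow> poly p t \<ge> 0"
  shows "pint p \<ge> 0"
  using pint_le[of 0 p] assms by simp

definition pabs :: "real poly \<Rightarrow> real" where "pabs p = integral {0..1} (\<lambda>t. \<bar>poly p t\<bar>)"

lemma abs_poly_integrable [simp]: "(\<lambda>t. \<bar>poly p t\<bar>) integrable_on {a..b::real}"
  by (intro integrable_continuous_interval continuous_intros)

lemma pabs_nonneg: "pabs p \<ge> 0"
  unfolding pabs_def by (rule integral_nonneg) auto

lemma abs_pint_mult_le:
  assumes "\<And>t. t \<in> {0..1} \<Longrightarrow> \<bar>poly p t\<bar> \<le> B"
  shows "\<bar>pint (p * q)\<bar> \<le> B * pabs q"
proof -
  have "norm (integral {0..1} (poly (p * q))) \<le> integral {0..1} (\<lambda>t. B * \<bar>poly q t\<bar>)"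
  proof (rule integral_norm_bound_integral)
    show "(\<lambda>t. B * \<bar>poly q t\<bar>) integrable_on {0..1}"
      by (intro integrable_continuous_interval continuous_intros)
    show "norm (poly (p * q) t) \<le> B * \<bar>poly q t\<bar>" if "t \<in> {0..1}" for t
      using assms[OF that] by (auto simp: abs_mult intro!: mult_right_mono)
  qed simp
  then show ?thesis by (simp add: pint_def pabs_def)
qed

lemma abs_pint_le_pabs: "\<bar>pint q\<bar> \<le> pabs q"
  using abs_pint_mult_le[of 1 1 q] by simp

lemma pabs_le:
  assumes "\<And>t. t \<in> {0..1} \<Longrightarrow> \<bar>poly p t\<bar> \<le> B"
  shows "pabs p \<le> B"
proof -
  have "pabs p \<le> integral {0..1::real} (\<lambda>t. B)"
    unfolding pabs_def by (rule integral_le) (use assms in auto)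
  then show ?thesis by simp
qed

lemma pabs_add_le: "pabs (p + q) \<le> pabs p + pabs q"
proof -
  have "pabs (p + q) \<le> integral {0..1} (\<lambda>t. \<bar>poly p t\<bar> + \<bar>poly q t\<bar>)"
    unfolding pabs_def
    by (rule integral_le) (use abs_poly_integrable[of "p + q"] in \<open>auto intro!: integrable_add\<close>)
  also have "\<dots> = pabs p + pabs q" unfolding pabs_def by (rule integral_add) auto
  finally show ?thesis .
qed

lemma pabs_minus: "pabs (- p) = pabs p" by (simp add: pabs_def)

section \<open>Polynomials of bounded degree on the unit interval\<close>

text \<open>Induction on the degree: after splitting off the value at a point s where p is small in mean
  square, the quotient by x - s is again small in mean square away from s.\<close>

lemma coeff_square_le_integral:
  fixes u v :: real
  assumes "u < v"
  shows "\<exists>C>0. \<forall>p::real poly. degree p \<le> n \<longrightarrow>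
           (\<forall>i. (coeff p i)\<^sup>2 \<le> C * integral {u..v} (poly (p\<^sup>2)))"
  using assms
proof (induction n arbitrary: u v)
  case 0
  show ?case
  proof (intro exI[of _ "1 / (v - u)"] conjI allI impI)
    fix p :: "real poly" and i
    assume "degree p \<le> 0"
    then obtain c where p: "p = [:c:]" by (metis degree_eq_zeroE le_zero_eq)
    have "poly (p\<^sup>2) = (\<lambda>_. c\<^sup>2)" by (auto simp: p)
    then have "integral {u..v} (poly (p\<^sup>2)) = c\<^sup>2 * (v - u)" using 0 by (simp add: mult.commute)
    then show "(coeff p i)\<^sup>2 \<le> 1 / (v - u) * integral {u..v} (poly (p\<^sup>2))"
      using 0 by (cases i) (auto simp: p)
  qed (use 0 in auto)
next
  case (Suc n)
  \<comment> \<open>Thirds keep the two regions apart: \<open>s\<close> is taken in the left third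
    and the quotient is estimated on the right third, where \<open>x - s\<close> is at least
    \<open>L\<close>.\<close>
  define L where "L = (v - u) / 3"
  have L: "L > 0" using Suc.prems by (simp add: L_def)
  have uv: "u + L \<le> v" "u \<le> v - L" using Suc.prems by (auto simp: L_def field_simps)
  obtain C where C: "C > 0"
    "\<And>p i. degree p \<le> n \<Longrightarrow> (coeff p i)\<^sup>2 \<le> C * integral {v - L..v} (poly (p\<^sup>2))"
    using Suc.IH[of "v - L" v] L by (auto simp del: poly_power)
  define S where "S = (\<bar>u\<bar> + \<bar>v\<bar>)\<^sup>2"
  define C' where "C' = 3 * (1 / L + (S + 1) * (4 * C / L\<^sup>2))"
  have S: "S \<ge> 0" by (simp add: S_def)
  have "C' > 0" unfolding C'_def using L C S by (intro mult_pos_pos add_pos_nonneg) auto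
  show ?case
  proof (intro exI[of _ C'] conjI allI impI)
    fix p :: "real poly" and i
    assume deg: "degree p \<le> Suc n"
    let ?I = "integral {u..v} (poly (p\<^sup>2))"
    have sub: "integral {a..b} (poly (p\<^sup>2)) \<le> ?I" if "u \<le> a" "b \<le> v" for a b
      by (rule integral_subset_le) (use that in auto)
    have "\<exists>s\<in>{u..u + L}. \<forall>x\<in>{u..u + L}. poly (p\<^sup>2) s \<le> poly (p\<^sup>2) x"
      by (rule continuous_attains_inf) (use L in \<open>auto intro!: continuous_intros\<close>)
    then obtain s where s: "s \<in> {u..u + L}" "\<And>x. x \<in> {u..u + L} \<Longrightarrow> poly (p\<^sup>2) s \<le> poly (p\<^sup>2) x"
      by blast
    define P where "P = poly p s"
    have "integral {u..u + L} (\<lambda>_. P\<^sup>2) \<le> integral {u..u + L} (poly (p\<^sup>2))"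
      by (rule integral_le) (use s(2) in \<open>auto simp: P_def\<close>)
    also have "\<dots> \<le> ?I" by (rule sub) (use uv in auto)
    finally have PI: "P\<^sup>2 \<le> ?I / L" using L by (simp add: field_simps)
    define q where "q = synthetic_div p s"
    have p: "p = [:- s, 1:] * q + [:P:]" using synthetic_div_correct'[of s p] by (simp add: q_def P_def)
    have px: "poly p x = (x - s) * poly q x + P" for x by (subst p) (simp add: algebra_simps)
    have dq: "degree q \<le> n" using deg by (simp add: q_def degree_synthetic_div)
    have q2: "poly (q\<^sup>2) x \<le> 2 / L\<^sup>2 * (poly (p\<^sup>2) x + P\<^sup>2)" if x: "x \<in> {v - L..v}" for x
    proof -
      have "L \<le> x - s" using x s(1) by (auto simp: L_def field_simps)
      then have "L\<^sup>2 \<le> (x - s)\<^sup>2" using L by (intro power_mono) auto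
      then have "L\<^sup>2 * (poly q x)\<^sup>2 \<le> (x - s)\<^sup>2 * (poly q x)\<^sup>2" by (rule mult_right_mono) auto
      also have "\<dots> = (poly p x - P)\<^sup>2"
        by (simp add: px power_mult_distrib)
      also have "\<dots> \<le> 2 * ((poly p x)\<^sup>2 + P\<^sup>2)"
        using sum_squares_bound[of "poly p x" "-P"] by (simp add: power2_diff)
      finally show ?thesis using L by (simp add: field_simps)
    qed
    have "integral {v - L..v} (poly (q\<^sup>2)) \<le> integral {v - L..v} (\<lambda>x. 2 / L\<^sup>2 * (poly (p\<^sup>2) x + P\<^sup>2))"
    proof (rule integral_le)
      show "(\<lambda>x. 2 / L\<^sup>2 * (poly (p\<^sup>2) x + P\<^sup>2)) integrable_on {v - L..v}"
        by (intro integrable_continuous_interval continuous_intros)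
    qed (fact poly_integrable, fact q2)
    also have "\<dots> = 2 / L\<^sup>2 * (integral {v - L..v} (poly (p\<^sup>2)) + L * P\<^sup>2)"
    proof -
      have "integral {v - L..v} (\<lambda>x. poly (p\<^sup>2) x + P\<^sup>2) = integral {v - L..v} (poly (p\<^sup>2)) + integral {v - L..v} (\<lambda>x. P\<^sup>2)"
        by (rule integral_add) (auto simp del: poly_power)
      moreover have "integral {v - L..v} (\<lambda>x. P\<^sup>2) = L * P\<^sup>2" using L by simp
      ultimately show ?thesis by (simp only: integral_mult_right)
    qed
    also have "\<dots> \<le> 2 / L\<^sup>2 * (?I + ?I)"
    proof (intro mult_left_mono add_mono)
      show "integral {v - L..v} (poly (p\<^sup>2)) \<le> ?I"
        by (rule sub) (use uv in auto)
      show "L * P\<^sup>2 \<le> ?I" using PI L by (simp add: field_simps)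
    qed auto
    finally have IQ: "integral {v - L..v} (poly (q\<^sup>2)) \<le> 4 * ?I / L\<^sup>2" by simp
    have cq: "(coeff q j)\<^sup>2 \<le> 4 * C / L\<^sup>2 * ?I" for j
    proof -
      have "(coeff q j)\<^sup>2 \<le> C * integral {v - L..v} (poly (q\<^sup>2))" by (rule C(2)[OF dq])
      also have "\<dots> \<le> C * (4 * ?I / L\<^sup>2)" using IQ C(1) by (intro mult_left_mono) auto
      finally show ?thesis by (simp add: field_simps)
    qed
    have sS: "s\<^sup>2 \<le> S" unfolding S_def using s(1) L Suc.prems
      by (subst abs_le_square_iff[symmetric]) (auto simp: L_def field_simps)
    \<comment> \<open>\<open>a\<close> is the coefficient of index \<open>i\<close> in x q(x) + P,
      so that only the term - s q(x) remains to be added.\<close>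
    define a where "a = (case i of 0 \<Rightarrow> P | Suc j \<Rightarrow> coeff q j)"
    have ci: "coeff p i = a - s * coeff q i"
      by (subst p) (auto simp: a_def coeff_pCons split: nat.splits)
    have I0: "?I \<ge> 0" by (rule integral_nonneg) auto
    have a2: "a\<^sup>2 \<le> ?I / L + 4 * C / L\<^sup>2 * ?I"
    proof (cases i)
      case 0
      have "0 \<le> 4 * C / L\<^sup>2 * ?I" using C I0 by simp
      then show ?thesis using PI 0 by (simp add: a_def)
    next
      case (Suc j)
      have "0 \<le> ?I / L" using L I0 by simp
      then show ?thesis using cq[of j] Suc unfolding a_def by simp
    qed
    have "(coeff p i)\<^sup>2 \<le> 2 * (a\<^sup>2 + s\<^sup>2 * (coeff q i)\<^sup>2)"
      unfolding ci using sum_squares_bound[of a "- s * coeff q i"] by (simp add: power2_diff power_mult_distrib)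
    also have "s\<^sup>2 * (coeff q i)\<^sup>2 \<le> S * (4 * C / L\<^sup>2 * ?I)"
      using sS cq[of i] S by (intro mult_mono) auto
    also have "2 * (a\<^sup>2 + S * (4 * C / L\<^sup>2 * ?I)) \<le> 3 * (?I / L + 4 * C / L\<^sup>2 * ?I + S * (4 * C / L\<^sup>2 * ?I))"
    proof -
      have "0 \<le> ?I / L + 4 * C / L\<^sup>2 * ?I + S * (4 * C / L\<^sup>2 * ?I)" using S C L I0 by simp
      then show ?thesis using a2 by argo
    qed
    also have "\<dots> = C' * ?I" by (simp add: C'_def algebra_simps add_divide_distrib)
    finally show "(coeff p i)\<^sup>2 \<le> C' * ?I" by simp
  qed fact
qed

lemma poly_eq_sum_le:
  assumes "degree p \<le> n"
  shows "poly (p :: real poly) t = (\<Sum>i\<le>n. coeff p i * t ^ i)"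
  unfolding poly_altdef by (rule sum.mono_neutral_left) (use assms in \<open>auto simp: coeff_eq_0\<close>)

lemma abs_poly_le_coeffs:
  fixes p :: "real poly"
  assumes "degree p \<le> n" "\<And>i. \<bar>coeff p i\<bar> \<le> A" "\<bar>t\<bar> \<le> 1"
  shows "\<bar>poly p t\<bar> \<le> real (n + 1) * A"
proof -
  have "A \<ge> 0" using assms(2)[of 0] by linarith
  have "\<bar>poly p t\<bar> = \<bar>\<Sum>i\<le>n. coeff p i * t ^ i\<bar>" by (simp add: poly_eq_sum_le[OF assms(1)])
  also have "\<dots> \<le> (\<Sum>i\<le>n. \<bar>coeff p i * t ^ i\<bar>)" by (rule sum_abs)
  also have "\<dots> \<le> (\<Sum>i\<le>n. A)"
  proof (rule sum_mono)
    fix i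
    have "\<bar>coeff p i\<bar> * \<bar>t ^ i\<bar> \<le> A * 1"
      using assms \<open>A \<ge> 0\<close> by (intro mult_mono) (auto simp: power_le_one power_abs)
    then show "\<bar>coeff p i * t ^ i\<bar> \<le> A" by (simp add: abs_mult)
  qed
  finally show ?thesis by simp
qed

lemma abs_coeff_higher_pderiv_le:
  fixes p :: "real poly"
  assumes "degree p \<le> n" "\<And>i. \<bar>coeff p i\<bar> \<le> A"
  shows "\<bar>coeff ((pderiv ^^ k) p) i\<bar> \<le> real n ^ k * A"
proof (induction k arbitrary: i)
  case 0
  then show ?case using assms by simp
next
  case (Suc k)
  have A: "A \<ge> 0" using assms(2)[of 0] by linarith
  have deg: "degree ((pderiv ^^ k) p) \<le> n"
    using assms(1) by (simp add: degree_higher_pderiv)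
  show ?case
  proof (cases "Suc i \<le> n")
    case True
    have "\<bar>coeff ((pderiv ^^ Suc k) p) i\<bar> = real (Suc i) * \<bar>coeff ((pderiv ^^ k) p) (Suc i)\<bar>"
      by (simp add: coeff_pderiv abs_mult)
    also have "\<dots> \<le> real n * (real n ^ k * A)"
      using True Suc.IH[of "Suc i"] by (intro mult_mono) auto
    finally show ?thesis by simp
  next
    case False
    then have "coeff ((pderiv ^^ k) p) (Suc i) = 0" using deg by (intro coeff_eq_0) simp
    then show ?thesis using A by (simp add: coeff_pderiv)
  qed
qed

lemma coeff_le_sup:
  "\<exists>C>0. \<forall>p::real poly. \<forall>B. degree p \<le> n \<longrightarrow> (\<forall>t\<in>{0..1}. \<bar>poly p t\<bar> \<le> B) \<longrightarrow>
           (\<forall>i. \<bar>coeff p i\<bar> \<le> C * B)"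
proof -
  obtain C where C: "C > 0"
    "\<And>p i. degree p \<le> n \<Longrightarrow> (coeff p i)\<^sup>2 \<le> C * integral {0..1::real} (poly (p\<^sup>2))"
    using coeff_square_le_integral[of "0::real" 1 n] by auto
  show ?thesis
  proof (intro exI[of _ "sqrt C"] conjI allI impI)
    fix p :: "real poly" and B i
    assume d: "degree p \<le> n" and B: "\<forall>t\<in>{0..1}. \<bar>poly p t\<bar> \<le> B"
    have B0: "B \<ge> 0" using B by force
    have "pint (p\<^sup>2) \<le> pint [:B\<^sup>2:]"
      by (rule pint_le) (use B B0 in \<open>auto simp: abs_le_square_iff[symmetric]\<close>)
    also have "\<dots> = B\<^sup>2"
    proof -
      have "poly [:B\<^sup>2:] = (\<lambda>_. B\<^sup>2)" by auto
      then show ?thesis by (simp add: pint_def)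
    qed
    finally have "integral {0..1::real} (poly (p\<^sup>2)) \<le> B\<^sup>2" by (simp add: pint_def)
    then have "C * integral {0..1::real} (poly (p\<^sup>2)) \<le> C * B\<^sup>2" using C(1) by (intro mult_left_mono) auto
    with C(2)[OF d, of i] have "(coeff p i)\<^sup>2 \<le> C * B\<^sup>2" by (rule order_trans)
    then have "(coeff p i)\<^sup>2 \<le> (sqrt C * B)\<^sup>2"
      using C(1) by (simp add: power_mult_distrib)
    then show "\<bar>coeff p i\<bar> \<le> sqrt C * B"
      using C(1) B0 by (simp add: abs_le_square_iff[symmetric])
  qed (use C in auto)
qed

text \<open>A Markov inequality with a crude constant: the sup norm on [0,1] controls the
  coefficients, differentiation multiplies each by at most \<open>n\<close>, and the coefficients
  control the sup norm again.\<close>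

lemma markov:
  "\<exists>C>0. \<forall>p::real poly. \<forall>B. degree p \<le> n \<longrightarrow> (\<forall>t\<in>{0..1}. \<bar>poly p t\<bar> \<le> B) \<longrightarrow>
           (\<forall>t\<in>{0..1}. \<bar>poly ((pderiv ^^ k) p) t\<bar> \<le> C * B)"
proof -
  obtain C where C: "C > 0"
    "\<And>p B i. degree p \<le> n \<Longrightarrow> (\<And>t. t \<in> {0..1} \<Longrightarrow> \<bar>poly p t\<bar> \<le> B) \<Longrightarrow> \<bar>coeff p i\<bar> \<le> C * (B::real)"
    using coeff_le_sup[of n] by metis
  \<comment> \<open>The power of \<open>n + 1\<close>, rather than of \<open>n\<close>, keeps the
    constant positive when \<open>n = 0\<close>.\<close>
  show ?thesis
  proof (intro exI[of _ "real (n + 1) * (real (n+1) ^ k * C)"] conjI allI impI ballI)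
    fix p :: "real poly" and B t
    assume d: "degree p \<le> n" and B: "\<forall>t\<in>{0..1}. \<bar>poly p t\<bar> \<le> B" and t: "t \<in> {0..1::real}"
    have B0: "B \<ge> 0" using B by force
    have "\<bar>coeff ((pderiv ^^ k) p) i\<bar> \<le> real n ^ k * (C * B)" for i
      using abs_coeff_higher_pderiv_le[OF d C(2)[OF d]] B by blast
    then have "\<bar>poly ((pderiv ^^ k) p) t\<bar> \<le> real (n+1) * (real n ^ k * (C * B))"
      using d t by (intro abs_poly_le_coeffs) (auto simp: degree_higher_pderiv)
    also have "\<dots> \<le> real (n+1) * (real (n+1) ^ k * (C * B))"
      using C(1) B0 by (intro mult_left_mono mult_right_mono power_mono) auto
    finally show "\<bar>poly ((pderiv ^^ k) p) t\<bar> \<le> real (n + 1) * (real (n+1) ^ k * C) * B"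
      by (simp add: mult_ac)
  qed (use C in auto)
qed

lemma higher_pderiv_diff: "(pderiv ^^ k) (p - q) = (pderiv ^^ k) p - (pderiv ^^ k) (q :: real poly)"
  by (induction k) (auto simp: pderiv_diff)

lemma higher_pderiv_pcompose_linear:
  "(pderiv ^^ k) (pcompose p [:u, v:]) = smult (v ^ k) (pcompose ((pderiv ^^ k) (p :: real poly)) [:u, v:])"
proof (induction k)
  case (Suc k)
  have "(pderiv ^^ Suc k) (pcompose p [:u, v:]) = smult (v ^ k) (pderiv (pcompose ((pderiv ^^ k) p) [:u, v:]))"
    by (simp add: Suc pderiv_smult)
  also have "\<dots> = smult (v ^ Suc k) (pcompose ((pderiv ^^ Suc k) p) [:u, v:])"
    by (simp add: pderiv_pcompose pderiv_pCons mult.commute)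
  finally show ?case .
qed auto

lemma higher_pderiv_eq_0:
  assumes "degree (p :: real poly) < k"
  shows "(pderiv ^^ k) p = 0"
  using assms
proof (induction k arbitrary: p)
  case (Suc k)
  show ?case
  proof (cases "degree p = 0")
    case True
    then have "pderiv p = 0" by (simp add: pderiv_eq_0_iff)
    moreover have "(pderiv ^^ k) (0::real poly) = 0" by (induction k) auto
    ultimately show ?thesis by (simp add: funpow_Suc_right del: funpow.simps)
  next
    case False
    then have "degree (pderiv p) < k" using Suc.prems by (simp add: degree_pderiv)
    then show ?thesis using Suc.IH by (simp add: funpow_Suc_right del: funpow.simps)
  qed
qed simp

text \<open>Through this lemma, divisibility of \<open>P - Q\<close> by
  \<open>[:- a, 1:] ^ Suc m\<close> serves as the statement that P and Q have the same derivatives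
  at \<open>a\<close> up to order m.\<close>

lemma poly_higher_pderiv_dvd_0:
  assumes "[:- a, 1:] ^ n dvd (p :: real poly)" "k < n"
  shows "poly ((pderiv ^^ k) p) a = 0"
  using assms
proof (induction k arbitrary: p n)
  case 0
  then have "[:- a, 1:] dvd p" by (metis dvd_power dvd_trans)
  then show ?case by (simp add: poly_eq_0_iff_dvd)
next
  case (Suc k)
  obtain n' where n: "n = Suc n'" using Suc.prems by (cases n) auto
  obtain q where p: "p = [:- a, 1:] ^ Suc n' * q" using Suc.prems n by (auto elim: dvdE)
  have "[:- a, 1:] ^ n' dvd pderiv p"
    unfolding p pderiv_mult pderiv_power_Suc
    by (intro dvd_add dvd_mult2 dvd_smult dvd_mult le_imp_power_dvd) auto
  then have "poly ((pderiv ^^ k) (pderiv p)) a = 0"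
    using Suc.IH[of n'] Suc.prems n by simp
  then show ?case by (simp add: funpow_Suc_right del: funpow.simps)
qed

section \<open>Signed area of polynomial pairs\<close>

definition area :: "real poly \<Rightarrow> real poly \<Rightarrow> real" where
  "area p q = pint (pderiv p * q - p * pderiv q)"

text \<open>The quantity A after rescaling [a,b] to [0,1], with \<open>y1\<close> and
  \<open>y2\<close> in the place of f(b) and g(b); likewise \<open>speed\<close> is the integral in
  V. If p and q end at \<open>y1\<close> and \<open>y2\<close>, only \<open>z - 2 * area p q\<close>
  is left.\<close>

definition defect :: "real poly \<Rightarrow> real poly \<Rightarrow> real \<Rightarrow> real \<Rightarrow> real \<Rightarrow> real" where
  "defect p q z y1 y2 =
     z - 2 * area p q + 2 * poly p 0 * (y2 - poly q 1) - 2 * poly q 0 * (y1 - poly p 1)"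

definition speed :: "real poly \<Rightarrow> real poly \<Rightarrow> real" where
  "speed p q = pabs (pderiv p) + pabs (pderiv q)"

lemma speed_nonneg: "speed p q \<ge> 0"
  by (simp add: speed_def pabs_nonneg)

text \<open>Integration by parts moves the derivative off the perturbation \<open>u\<close>,
  \<open>v\<close>, so that the linear part consists of boundary values and of integrals against
  \<open>pderiv p\<close> and \<open>pderiv q\<close>.\<close>

lemma area_add:
  "area (p + u) (q + v) - area p q =
     poly u 1 * poly q 1 - poly u 0 * poly q 0 - poly p 1 * poly v 1 + poly p 0 * poly v 0
     - 2 * pint (u * pderiv q) + 2 * pint (v * pderiv p) + area u v"
proof -
  have two: "smult 2 r = 2 * r" for r :: "real poly" by (simp add: numeral_poly)
  have "pderiv (p + u) * (q + v) - (p + u) * pderiv (q + v) =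
      (pderiv p * q - p * pderiv q) + (pderiv (u * q) - smult 2 (u * pderiv q))
      + (smult 2 (v * pderiv p) - pderiv (p * v)) + (pderiv u * v - u * pderiv v)"
    by (simp add: two pderiv_add pderiv_mult algebra_simps)
  then have "area (p + u) (q + v) =
      area p q + (pint (pderiv (u * q)) - 2 * pint (u * pderiv q))
      + (2 * pint (v * pderiv p) - pint (pderiv (p * v))) + area u v"
    by (simp only: area_def pint_add pint_diff pint_smult)
  then show ?thesis by (simp add: pint_pderiv)
qed

text \<open>The correction terms of \<open>defect\<close> complete the boundary values
  \<open>poly q 1\<close> and \<open>poly p 1\<close> to increments of q and p over [0,1], which are
  integrals of derivatives. Hence the linear part is controlled by \<open>speed p q\<close> alone,
  however large p and q are.\<close>

lemma defect_stable:
  assumes u: "poly u 0 = 0" "\<And>t. t \<in> {0..1} \<Longrightarrow> \<bar>poly u t\<bar> \<le> e"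
      "\<And>t. t \<in> {0..1} \<Longrightarrow> \<bar>poly (pderiv u) t\<bar> \<le> e"
    and v: "poly v 0 = 0" "\<And>t. t \<in> {0..1} \<Longrightarrow> \<bar>poly v t\<bar> \<le> e"
      "\<And>t. t \<in> {0..1} \<Longrightarrow> \<bar>poly (pderiv v) t\<bar> \<le> e"
  shows "\<bar>defect (p + u) (q + v) z y1 y2 - defect p q z y1 y2\<bar> \<le> 6 * e * speed p q + 4 * e\<^sup>2"
proof -
  have e: "e \<ge> 0" using u(2)[of 0] by auto
  have "defect (p + u) (q + v) z y1 y2 - defect p q z y1 y2 =
      - 2 * (area (p + u) (q + v) - area p q) - 2 * poly p 0 * poly v 1 + 2 * poly q 0 * poly u 1"
    by (simp add: defect_def u(1) v(1) algebra_simps)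
  also have "\<dots> = - 2 * (poly u 1 * (poly q 1 - poly q 0)) + 2 * (poly v 1 * (poly p 1 - poly p 0))
      + 4 * pint (u * pderiv q) - 4 * pint (v * pderiv p) - 2 * area u v"
    by (simp only: area_add u(1) v(1)) (simp add: algebra_simps)
  also have "\<bar>\<dots>\<bar> \<le> 2 * (e * pabs (pderiv q)) + 2 * (e * pabs (pderiv p))
      + 4 * (e * pabs (pderiv q)) + 4 * (e * pabs (pderiv p)) + 4 * e\<^sup>2"
  proof -
    have "\<bar>poly u 1 * (poly q 1 - poly q 0)\<bar> \<le> e * pabs (pderiv q)"
      unfolding abs_mult pint_pderiv[symmetric] using u(2)[of 1] e
      by (intro mult_mono abs_pint_le_pabs) auto
    moreover have "\<bar>poly v 1 * (poly p 1 - poly p 0)\<bar> \<le> e * pabs (pderiv p)"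
      unfolding abs_mult pint_pderiv[symmetric] using v(2)[of 1] e
      by (intro mult_mono abs_pint_le_pabs) auto
    moreover have "\<bar>pint (u * pderiv q)\<bar> \<le> e * pabs (pderiv q)" "\<bar>pint (v * pderiv p)\<bar> \<le> e * pabs (pderiv p)"
      using u v by (auto intro!: abs_pint_mult_le)
    moreover have "\<bar>area u v\<bar> \<le> 2 * e\<^sup>2"
    proof -
      have "\<bar>pint (u * pderiv v)\<bar> \<le> e * pabs (pderiv v)" "\<bar>pint (pderiv u * v)\<bar> \<le> e * pabs v"
        using u v by (auto intro!: abs_pint_mult_le)
      moreover have "e * pabs (pderiv v) \<le> e * e" "e * pabs v \<le> e * e"
        using u v e by (auto intro!: mult_left_mono pabs_le)
      ultimately show ?thesis unfolding area_def pint_diff power2_eq_square by linarith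
    qed
    ultimately show ?thesis by linarith
  qed
  also have "\<dots> = 6 * e * speed p q + 4 * e\<^sup>2" by (simp add: speed_def algebra_simps)
  finally show ?thesis .
qed

lemma speed_le_add:
  assumes "\<And>t. t \<in> {0..1} \<Longrightarrow> \<bar>poly (pderiv u) t\<bar> \<le> e" "\<And>t. t \<in> {0..1} \<Longrightarrow> \<bar>poly (pderiv v) t\<bar> \<le> e"
  shows "speed (p + u) (q + v) \<le> speed p q + 2 * e"
    and "speed p q \<le> speed (p + u) (q + v) + 2 * e"
proof -
  have *: "pabs (pderiv u) \<le> e" "pabs (pderiv v) \<le> e" using assms by (auto intro: pabs_le)
  show "speed (p + u) (q + v) \<le> speed p q + 2 * e"
    using pabs_add_le[of "pderiv p" "pderiv u"] pabs_add_le[of "pderiv q" "pderiv v"] *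
    by (simp add: speed_def pderiv_add)
  show "speed p q \<le> speed (p + u) (q + v) + 2 * e"
    using pabs_add_le[of "pderiv p + pderiv u" "- pderiv u"] pabs_add_le[of "pderiv q + pderiv v" "- pderiv v"] *
    by (simp add: speed_def pderiv_add pabs_minus)
qed

text \<open>For perturbations of size \<open>e = k * w * \<Delta>\<close> the linear error
  \<open>e * speed p q\<close> already has the required form, and the quadratic error
  \<open>e\<^sup>2\<close> gains its second factor w from \<open>w \<le> W\<close>. Replacing the
  old speed by the new one costs a further multiple of \<open>e\<close>, absorbed in the same
  way.\<close>

lemma defect_transfer:
  assumes u: "poly u 0 = 0" "\<And>t. t \<in> {0..1} \<Longrightarrow> \<bar>poly u t\<bar> \<le> k * w * \<Delta>"
      "\<And>t. t \<in> {0..1} \<Longrightarrow> \<bar>poly (pderiv u) t\<bar> \<le> k * w * \<Delta>"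
    and v: "poly v 0 = 0" "\<And>t. t \<in> {0..1} \<Longrightarrow> \<bar>poly v t\<bar> \<le> k * w * \<Delta>"
      "\<And>t. t \<in> {0..1} \<Longrightarrow> \<bar>poly (pderiv v) t\<bar> \<le> k * w * \<Delta>"
    and def: "\<bar>defect p q z y1 y2\<bar> \<le> c * w * (\<Delta>\<^sup>2 + \<Delta> * speed p q)"
    and pos: "0 \<le> w" "w \<le> W" "0 \<le> \<Delta>" "0 \<le> k" "0 \<le> c"
  shows "\<bar>defect (p + u) (q + v) z y1 y2\<bar> \<le>
     (c + (c + 6 * k) * (1 + 2 * k * W) + 4 * k\<^sup>2 * W) * w * (\<Delta>\<^sup>2 + \<Delta> * speed (p + u) (q + v))"
proof -
  define e where "e = k * w * \<Delta>"
  define S where "S = speed p q"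
  define S' where "S' = speed (p + u) (q + v)"
  have S': "S' \<ge> 0" by (simp add: S'_def speed_nonneg)
  have "\<bar>defect (p + u) (q + v) z y1 y2\<bar> \<le> c * w * (\<Delta>\<^sup>2 + \<Delta> * S) + 6 * e * S + 4 * e\<^sup>2"
    using def defect_stable[OF u v, of p q z y1 y2] unfolding S_def e_def by linarith
  also have "\<dots> = c * w * \<Delta>\<^sup>2 + (c + 6 * k) * w * \<Delta> * S + 4 * e\<^sup>2"
    unfolding e_def by (simp add: algebra_simps)
  also have "\<dots> \<le> c * w * \<Delta>\<^sup>2 + (c + 6 * k) * w * \<Delta> * (S' + 2 * (k * W * \<Delta>))
      + 4 * (k\<^sup>2 * W * w * \<Delta>\<^sup>2)"
  proof (intro add_mono mult_left_mono order_refl)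
    have "S \<le> S' + 2 * e"
      unfolding S_def S'_def e_def by (rule speed_le_add) (use u v in auto)
    also have "e \<le> k * W * \<Delta>" unfolding e_def using pos by (intro mult_right_mono mult_left_mono) auto
    finally show "S \<le> S' + 2 * (k * W * \<Delta>)" by simp
    have "e\<^sup>2 = k\<^sup>2 * w * w * \<Delta>\<^sup>2" unfolding e_def by (simp add: power2_eq_square)
    also have "\<dots> \<le> k\<^sup>2 * W * w * \<Delta>\<^sup>2" using pos by (intro mult_right_mono mult_left_mono) auto
    finally show "e\<^sup>2 \<le> k\<^sup>2 * W * w * \<Delta>\<^sup>2" .
  qed (use pos in auto)
  also have "\<dots> \<le> (c + (c + 6 * k) * (1 + 2 * k * W) + 4 * k\<^sup>2 * W) * w * (\<Delta>\<^sup>2 + \<Delta> * S')"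
  proof -
    have "(c + (c + 6 * k) * (1 + 2 * k * W) + 4 * k\<^sup>2 * W) * w * (\<Delta>\<^sup>2 + \<Delta> * S')
        - (c * w * \<Delta>\<^sup>2 + (c + 6 * k) * w * \<Delta> * (S' + 2 * (k * W * \<Delta>)) + 4 * (k\<^sup>2 * W * w * \<Delta>\<^sup>2))
       = (c + 6 * k) * w * \<Delta>\<^sup>2 + (c + (c + 6 * k) * (2 * k * W) + 4 * k\<^sup>2 * W) * w * (\<Delta> * S')"
      by (simp add: algebra_simps power2_eq_square)
    also have "\<dots> \<ge> 0" using pos S' by (intro add_nonneg_nonneg mult_nonneg_nonneg) auto
    finally show ?thesis by simp
  qed
  finally show ?thesis by (simp add: S'_def)
qed

section \<open>Weighted norms, a quadratic equation and step polynomials for one gap\<close>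

lemma abs_poly_bounded: "\<exists>B>0. \<forall>t\<in>{0..1::real}. \<bar>poly p t\<bar> \<le> B"
proof -
  have "compact ((\<lambda>t. poly p t) ` {0..1::real})"
    by (intro compact_continuous_image continuous_intros) auto
  then have "bounded ((\<lambda>t. poly p t) ` {0..1::real})" by (rule compact_imp_bounded)
  then obtain B where "B > 0" "\<forall>x\<in>(\<lambda>t. poly p t) ` {0..1::real}. norm x \<le> B"
    unfolding bounded_pos by blast
  then show ?thesis by auto
qed

text \<open>A weight that vanishes at the ends still gives a norm on polynomials of bounded degree,
  because the mean square over the middle half controls the coefficients. The weights will be a bump
  and its square.\<close>

lemma weighted_sup_bound:
  fixes g :: "real poly"
  assumes g: "\<And>t. t \<in> {0..1} \<Longrightarrow> poly g t \<ge> 0" "g0 > 0" "\<And>t. t \<in> {1/4..3/4} \<Longrightarrow> poly g t \<ge> g0"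
  shows "\<exists>c>0. \<forall>r. degree r \<le> n \<longrightarrow> pint (g * r\<^sup>2) \<ge> 0 \<and>
           (\<forall>t\<in>{0..1}. \<bar>poly r t\<bar> \<le> c * sqrt (pint (g * r\<^sup>2)))"
proof -
  obtain C where C: "C > 0"
    "\<And>p i. degree p \<le> n \<Longrightarrow> (coeff p i)\<^sup>2 \<le> C * integral {1/4..3/4::real} (poly (p\<^sup>2))"
    using coeff_square_le_integral[of "1/4" "3/4" n] by (auto simp del: poly_power)
  show ?thesis
  proof (intro exI[of _ "real (n + 1) * sqrt (C / g0)"] conjI allI impI ballI)
    fix r :: "real poly" and t :: real
    assume d: "degree r \<le> n"
    let ?J = "pint (g * r\<^sup>2)"
    show J: "?J \<ge> 0" by (rule pint_nonneg) (use g in auto)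
    have "integral {1/4..3/4} (\<lambda>x. g0 * poly (r\<^sup>2) x) \<le> integral {1/4..3/4} (poly (g * r\<^sup>2))"
      by (rule integral_le) (use g in \<open>auto intro!: integrable_continuous_interval continuous_intros mult_right_mono\<close>)
    also have "\<dots> \<le> ?J"
      unfolding pint_def by (rule integral_subset_le) (use g in auto)
    finally have I: "integral {1/4..3/4} (poly (r\<^sup>2)) \<le> ?J / g0" using g(2) by (simp add: field_simps del: poly_power)
    have "\<bar>coeff r i\<bar> \<le> sqrt (C / g0) * sqrt ?J" for i
    proof -
      have "(coeff r i)\<^sup>2 \<le> C * integral {1/4..3/4::real} (poly (r\<^sup>2))" by (rule C(2)[OF d])
      also have "\<dots> \<le> C * (?J / g0)" using C(1) I by (intro mult_left_mono) auto
      finally have "sqrt ((coeff r i)\<^sup>2) \<le> sqrt (C * (?J / g0))" by (rule real_sqrt_le_mono)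
      then show ?thesis by (simp add: real_sqrt_mult real_sqrt_divide)
    qed
    moreover assume "t \<in> {0..1}"
    ultimately show "\<bar>poly r t\<bar> \<le> real (n + 1) * sqrt (C / g0) * sqrt ?J"
      using abs_poly_le_coeffs[OF d, of "sqrt (C / g0) * sqrt ?J" t] by (simp add: mult.assoc)
  qed (use C g in auto)
qed

text \<open>Let s have the sign of L. Then the linear term only helps, and the intermediate value
  theorem applies with no bound on L.\<close>

lemma quadratic_reaches:
  fixes A L E a :: real
  assumes "A \<ge> 0" "a \<ge> 0" "0 \<le> E" "E \<le> A * a\<^sup>2"
  shows "\<exists>s. \<bar>s\<bar> \<le> a \<and> A * s\<^sup>2 + L * s = E"
proof (cases "L \<ge> 0")
  case True
  have "\<exists>s. 0 \<le> s \<and> s \<le> a \<and> A * s\<^sup>2 + L * s = E"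
    by (rule IVT') (use assms True in \<open>auto intro!: continuous_intros intro: add_increasing2\<close>)
  then show ?thesis by force
next
  case False
  have "\<exists>s. 0 \<le> s \<and> s \<le> a \<and> A * s\<^sup>2 + (- L) * s = E"
  proof (rule IVT')
    have "0 \<le> (- L) * a" using False assms by (intro mult_nonneg_nonneg) auto
    then show "E \<le> A * a\<^sup>2 + (- L) * a" using assms by linarith
  qed (use assms in \<open>auto intro!: continuous_intros\<close>)
  then obtain s where "0 \<le> s" "s \<le> a" "A * s\<^sup>2 + (- L) * s = E" by blast
  then show ?thesis by (intro exI[of _ "-s"]) auto
qed

text \<open>The polynomials x and 1 - x have sum 1, so their powers satisfy a Bezout identity r x^n
  + s (1 - x)^n = 1, and r x^n is the step. For the identity itself, multiply the cases (n, k + 1)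
  and (n + 1, k) by \<open>a\<close> and \<open>b\<close> and add.\<close>

lemma exists_step_poly:
  "\<exists>r :: real poly. [:0, 1:] ^ n dvd r \<and> [:- 1, 1:] ^ n dvd r - 1"
proof -
  have *: "\<exists>r s. r * a ^ n + s * b ^ k = 1" if "a + b = 1" for a b :: "real poly" and n k
  proof (induction n arbitrary: k)
    case 0
    then show ?case by (intro exI[of _ 1] exI[of _ 0]) simp
  next
    case (Suc n)
    have "\<exists>r s. r * a ^ Suc n + s * b ^ k = 1"
    proof (induction k)
      case 0
      then show ?case by (intro exI[of _ 0] exI[of _ 1]) simp
    next
      case (Suc k)
      obtain r s where 1: "r * a ^ Suc n + s * b ^ k = 1" using Suc.IH by blast
      obtain r' s' where 2: "r' * a ^ n + s' * b ^ Suc k = 1" using \<open>\<And>k. \<exists>r s. r * a ^ n + s * b ^ k = 1\<close> by blast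
      have "1 = (a + b) * 1" using that by simp
      also have "\<dots> = a * (r' * a ^ n + s' * b ^ Suc k) + b * (r * a ^ Suc n + s * b ^ k)"
        unfolding 1 2 by (simp add: algebra_simps)
      also have "\<dots> = (r' + b * r) * a ^ Suc n + (a * s' + s) * b ^ Suc k"
        by (simp add: algebra_simps)
      finally show ?case by metis
    qed
    then show ?case .
  qed
  have "\<exists>r s. r * [:0, 1:] ^ n + s * [:1, - 1:] ^ n = (1::real poly)"
    by (rule *) (simp add: one_pCons)
  then obtain r s where rs: "r * [:0, 1:] ^ n + s * [:1, - 1:] ^ n = (1::real poly)" by blast
  have "[:1, - 1:] = smult (-1) [:- 1, 1::real:]" by simp
  then have "[:1, - 1:] ^ n = smult ((-1) ^ n) ([:- 1, 1::real:] ^ n)" by (simp only: smult_power)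
  then have "r * [:0, 1:] ^ n - 1 = smult (- ((-1) ^ n)) (s * [:- 1, 1:] ^ n)"
    using rs by (simp add: algebra_simps)
  then have "[:- 1, 1:] ^ n dvd r * [:0, 1:] ^ n - 1" by (simp add: dvd_smult)
  then show ?thesis by (intro exI[of _ "r * [:0, 1:] ^ n"]) simp
qed

text \<open>The quadratic correction uses the pair of bumps b, t b with amplitude sqrt w * \<Delta>; this is where
  the square root enters.  If the curve has speed more than \<Delta>, adding a multiple of b p' to q (or of
  b q' to p) corrects the area linearly and needs only amplitude w * \<Delta>.\<close>

lemma unit_gap:
  fixes m :: nat and W C1 :: real
  assumes W: "W > 0" and C1: "C1 > 0"
  shows "\<exists>N C. C > 0 \<and> (\<forall>p q D1 D2 w \<Delta> z.
    degree p \<le> m \<and> degree q \<le> m \<and> degree D1 \<le> m \<and> degree D2 \<le> m \<and>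
    0 < w \<and> w \<le> W \<and> \<Delta> > 0 \<and>
    (\<forall>t\<in>{0..1}. \<bar>poly D1 t\<bar> \<le> C1 * w * \<Delta> \<and> \<bar>poly D2 t\<bar> \<le> C1 * w * \<Delta>) \<and>
    \<bar>defect p q z (poly (p + D1) 1) (poly (q + D2) 1)\<bar> \<le> C1 * w * (\<Delta>\<^sup>2 + \<Delta> * speed p q) \<longrightarrow>
    (\<exists>P Q. degree P \<le> N \<and> degree Q \<le> N \<and>
       [:0, 1:] ^ Suc m dvd P - p \<and> [:- 1, 1:] ^ Suc m dvd P - (p + D1) \<and>
       [:0, 1:] ^ Suc m dvd Q - q \<and> [:- 1, 1:] ^ Suc m dvd Q - (q + D2) \<and>
       (\<forall>t\<in>{0..1}. \<bar>poly (P - p) t\<bar> \<le> C * sqrt w * \<Delta> \<and> \<bar>poly (Q - q) t\<bar> \<le> C * sqrt w * \<Delta>) \<and>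
       z = 2 * area P Q))"
proof -
  \<comment> \<open>Multiplying \<open>D1\<close> and \<open>D2\<close> by \<open>c\<close> keeps
    the jets at 1 that they correct and removes their effect on the jets at 0.\<close>
  obtain c :: "real poly" where c: "[:0, 1:] ^ Suc m dvd c" "[:- 1, 1:] ^ Suc m dvd c - 1"
    using exists_step_poly by blast
  have c0: "poly c 0 = 0" using poly_higher_pderiv_dvd_0[of 0 "Suc m" c 0] c by simp
  have c1: "poly c 1 = 1" using poly_higher_pderiv_dvd_0[of 1 "Suc m" "c - 1" 0] c by simp
  obtain X1 where X1: "X1 > 0" "\<And>t. t \<in> {0..1} \<Longrightarrow> \<bar>poly c t\<bar> \<le> X1"
    using abs_poly_bounded by metis
  obtain X2 where X2: "X2 > 0" "\<And>t. t \<in> {0..1} \<Longrightarrow> \<bar>poly (pderiv c) t\<bar> \<le> X2"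
    using abs_poly_bounded by metis
  obtain CM where CM: "CM > 0" "\<And>p B t. degree p \<le> m \<Longrightarrow> (\<And>t. t \<in> {0..1} \<Longrightarrow> \<bar>poly p t\<bar> \<le> B) \<Longrightarrow>
      t \<in> {0..1} \<Longrightarrow> \<bar>poly (pderiv p) t\<bar> \<le> CM * (B::real)"
    using markov[of m 1] by (auto; metis)
  \<comment> \<open>The exponent is large enough to leave the jets at both ends unchanged, and even,
    so that \<open>b\<close> is nonnegative.\<close>
  define b :: "real poly" where "b = ([:0, 1:] * [:- 1, 1:]) ^ (2 * Suc m)"
  define b2 :: "real poly" where "b2 = [:0, 1:] * b"
  have bt: "poly b t = (t * (1 - t)) ^ (2 * Suc m)" for t
  proof -
    have "poly b t = (t * (t - 1)) ^ (2 * Suc m)"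
      by (simp add: b_def algebra_simps del: power_Suc mult_Suc_right)
    also have "\<dots> = (t * (1 - t)) ^ (2 * Suc m)"
      unfolding power_mult by (simp add: power2_eq_square algebra_simps del: power_Suc)
    finally show ?thesis .
  qed
  have b01: "0 \<le> poly b t \<and> poly b t \<le> 1" if "t \<in> {0..1}" for t
    using that unfolding bt by (auto simp: mult_le_one intro!: power_le_one simp del: power_Suc mult_Suc_right)
  have bmid: "(3/16) ^ (2 * Suc m) \<le> poly b t" if t: "t \<in> {1/4..3/4}" for t
  proof -
    have "0 \<le> (t - 1/4) * (3/4 - t)" using t by (intro mult_nonneg_nonneg) auto
    then have "3/16 \<le> t * (1 - t)" by (simp add: field_simps)
    then show ?thesis unfolding bt by (intro power_mono) auto
  qed
  have bdvd: "[:0, 1:] ^ Suc m dvd b" "[:- 1, 1:] ^ Suc m dvd b"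
  proof -
    have "[:0, 1:] ^ Suc m dvd ([:0, 1::real:]) ^ (2 * Suc m)" "[:- 1, 1:] ^ Suc m dvd ([:- 1, 1::real:]) ^ (2 * Suc m)"
      by (rule le_imp_power_dvd; simp)+
    then show "[:0, 1:] ^ Suc m dvd b" "[:- 1, 1:] ^ Suc m dvd b"
      unfolding b_def power_mult_distrib by (auto intro: dvd_mult dvd_mult2 simp del: power_Suc)
  qed
  have b0: "poly b 0 = 0" "poly b 1 = 0" by (auto simp: bt)
  define B0 where "B0 = pint (b\<^sup>2)"
  have B0: "B0 > 0"
  proof -
    obtain k where k: "\<And>t. t \<in> {0..1} \<Longrightarrow> \<bar>poly 1 t\<bar> \<le> k * sqrt (pint (b\<^sup>2 * 1\<^sup>2))"
      "k > 0" "pint (b\<^sup>2 * 1\<^sup>2) \<ge> 0"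
    proof -
      have "\<exists>c>0. \<forall>r. degree r \<le> 0 \<longrightarrow> pint (b\<^sup>2 * r\<^sup>2) \<ge> 0 \<and>
           (\<forall>t\<in>{0..1}. \<bar>poly r t\<bar> \<le> c * sqrt (pint (b\<^sup>2 * r\<^sup>2)))"
      proof (rule weighted_sup_bound)
        show "((3/16) ^ (2 * Suc m))\<^sup>2 \<le> poly (b\<^sup>2) t" if "t \<in> {1/4..3/4}" for t
          using bmid[OF that] by (simp add: power_mono)
      qed auto
      then show ?thesis using that by (metis degree_1 le_refl)
    qed
    have "pint (b\<^sup>2 * 1\<^sup>2) \<noteq> 0" using k(1)[of 0] by (intro notI) simp
    then show ?thesis using k(3) by (simp add: B0_def)
  qed
  \<comment> \<open>The bumps b and t b enclose a nonzero area, whereas two multiples of the same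
    bump would enclose none.\<close>
  have ab: "area b b2 = - B0"
  proof -
    have "pderiv b * b2 - b * pderiv b2 = - (b\<^sup>2)"
      by (simp add: b2_def pderiv_mult pderiv_pCons power2_eq_square algebra_simps)
    then show ?thesis by (simp add: area_def B0_def pint_minus)
  qed
  have b2_01: "0 \<le> poly b2 t \<and> poly b2 t \<le> 1" if "t \<in> {0..1}" for t
    using b01[OF that] that by (auto simp: b2_def mult_le_one)
  define n where "n = degree c + m"
  obtain c3 where c3: "c3 > 0" "\<And>r. degree r \<le> n \<Longrightarrow> pint (b * r\<^sup>2) \<ge> 0"
     "\<And>r t. degree r \<le> n \<Longrightarrow> t \<in> {0..1} \<Longrightarrow> \<bar>poly r t\<bar> \<le> c3 * sqrt (pint (b * r\<^sup>2))"
  proof -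
    have "\<exists>c>0. \<forall>r. degree r \<le> n \<longrightarrow> pint (b * r\<^sup>2) \<ge> 0 \<and>
         (\<forall>t\<in>{0..1}. \<bar>poly r t\<bar> \<le> c * sqrt (pint (b * r\<^sup>2)))"
      by (rule weighted_sup_bound[OF _ _ bmid]) (use b01 in auto)
    then show ?thesis using that by metis
  qed
  \<comment> \<open>The size of \<open>c * D1\<close> and of its derivative relative to
    \<open>w * \<Delta>\<close>: the summands come from the product itself and the two terms of the
    product rule, with \<open>CM\<close> bounding the derivative of \<open>D1\<close>.\<close>
  define k0 where "k0 = (X1 + X2 + X1 * CM) * C1"
  have k0: "k0 > 0" unfolding k0_def using X1 X2 CM C1 by (intro mult_pos_pos add_pos_pos) auto
  \<comment> \<open>The constant of \<open>defect_transfer\<close> for a perturbation of relative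
    size \<open>k0\<close>.\<close>
  define k1 where "k1 = C1 + (C1 + 6 * k0) * (1 + 2 * k0 * W) + 4 * k0\<^sup>2 * W"
  have k1: "k1 > 0" unfolding k1_def using C1 k0 W by (intro add_pos_nonneg add_pos_pos mult_pos_pos) auto
  \<comment> \<open>Chosen so that bumps of amplitude \<open>\<kappa> * sqrt w * \<Delta>\<close>
    supply \<open>2 * k1 * w * \<Delta>\<^sup>2\<close>, the largest deficit possible when the speed
    is at most \<open>\<Delta>\<close>.\<close>
  define \<kappa> where "\<kappa> = sqrt (k1 / B0)"
  have \<kappa>: "\<kappa> > 0" using k1 B0 by (simp add: \<kappa>_def)
  \<comment> \<open>The three summands pay for the endpoint correction, the quadratic correction and
    the linear correction; \<open>sqrt W\<close> converts a factor w into
    \<open>sqrt w\<close>.\<close>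
  define C where "C = k0 * sqrt W + \<kappa> + k1 * c3\<^sup>2 * sqrt W"
  have C: "C > 0" unfolding C_def using k0 \<kappa> k1 c3 W by (intro add_pos_pos mult_pos_pos) auto
  define N where "N = n + degree b + 1"
  have db: "degree b2 \<le> degree b + 1"
    unfolding b2_def by (rule le_trans[OF degree_mult_le]) simp
  show ?thesis
  proof (intro exI[of _ N] exI[of _ C] conjI allI impI, fact C, elim conjE)
    fix p q D1 D2 w \<Delta> z
    assume dp: "degree p \<le> m" "degree q \<le> m" "degree D1 \<le> m" "degree D2 \<le> m"
      and w: "0 < w" "w \<le> W" and \<Delta>: "\<Delta> > 0"
      and D: "\<forall>t\<in>{0..1}. \<bar>poly D1 t\<bar> \<le> C1 * w * \<Delta> \<and> \<bar>poly D2 t\<bar> \<le> C1 * w * \<Delta>"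
      and def: "\<bar>defect p q z (poly (p + D1) 1) (poly (q + D2) 1)\<bar> \<le> C1 * w * (\<Delta>\<^sup>2 + \<Delta> * speed p q)"
    define e where "e = k0 * w * \<Delta>"
    define u where "u = c * D1"
    define v where "v = c * D2"
    have e: "e > 0" using k0 w \<Delta> by (simp add: e_def)
    have small: "\<bar>poly (c * F) t\<bar> \<le> e" "\<bar>poly (pderiv (c * F)) t\<bar> \<le> e"
      if F: "degree F \<le> m" "\<And>t. t \<in> {0..1} \<Longrightarrow> \<bar>poly F t\<bar> \<le> C1 * w * \<Delta>" and t: "t \<in> {0..1}" for F t
    proof -
      let ?B = "C1 * w * \<Delta>"
      have B: "?B \<ge> 0" using C1 w \<Delta> by simp
      have 1: "\<bar>poly c t\<bar> * \<bar>poly F t\<bar> \<le> X1 * ?B"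
        using X1 F(2)[OF t] t by (intro mult_mono) auto
      have 2: "\<bar>poly (pderiv c) t\<bar> * \<bar>poly F t\<bar> \<le> X2 * ?B"
        using X2 F(2)[OF t] t by (intro mult_mono) auto
      have 3: "\<bar>poly c t\<bar> * \<bar>poly (pderiv F) t\<bar> \<le> X1 * (CM * ?B)"
        using X1 CM(2)[OF F t] t by (intro mult_mono) auto
      have e': "e = X1 * ?B + X2 * ?B + X1 * (CM * ?B)" by (simp add: e_def k0_def algebra_simps)
      have pos: "0 \<le> X1 * ?B" "0 \<le> X2 * ?B" "0 \<le> X1 * (CM * ?B)" using X1 X2 CM B by auto
      show "\<bar>poly (c * F) t\<bar> \<le> e" unfolding e' using 1 pos by (simp add: abs_mult)
      have "\<bar>poly (pderiv (c * F)) t\<bar> \<le> \<bar>poly (pderiv c) t\<bar> * \<bar>poly F t\<bar> + \<bar>poly c t\<bar> * \<bar>poly (pderiv F) t\<bar>"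
        by (simp add: pderiv_mult flip: abs_mult) (simp add: mult.commute abs_triangle_ineq add.commute)
      then show "\<bar>poly (pderiv (c * F)) t\<bar> \<le> e" unfolding e' using 2 3 pos by linarith
    qed
    have su: "\<bar>poly u t\<bar> \<le> e" "\<bar>poly (pderiv u) t\<bar> \<le> e" if "t \<in> {0..1}" for t
      using small[OF dp(3) _ that] D by (auto simp: u_def)
    have sv: "\<bar>poly v t\<bar> \<le> e" "\<bar>poly (pderiv v) t\<bar> \<le> e" if "t \<in> {0..1}" for t
      using small[OF dp(4) _ that] D by (auto simp: v_def)
    have uv0: "poly u 0 = 0" "poly v 0 = 0" by (auto simp: u_def v_def c0)
    define p0 where "p0 = p + u"
    define q0 where "q0 = q + v"
    define S0 where "S0 = speed p0 q0"
    \<comment> \<open>The pair \<open>p0\<close>, \<open>q0\<close> has the prescribed values at 1,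
      so its \<open>defect\<close> is exactly the area still missing.\<close>
    define E where "E = z - 2 * area p0 q0"
    have "E = defect (p + u) (q + v) z (poly (p + D1) 1) (poly (q + D2) 1)"
      by (simp add: defect_def E_def p0_def q0_def u_def v_def c1)
    moreover have "\<bar>defect (p + u) (q + v) z (poly (p + D1) 1) (poly (q + D2) 1)\<bar>
        \<le> k1 * w * (\<Delta>\<^sup>2 + \<Delta> * speed (p + u) (q + v))"
      unfolding k1_def by (rule defect_transfer[OF uv0(1) _ _ uv0(2) _ _ def])
        (use su sv C1 k0 w \<Delta> in \<open>auto simp: e_def\<close>)
    ultimately have E: "\<bar>E\<bar> \<le> k1 * w * (\<Delta>\<^sup>2 + \<Delta> * S0)" by (simp add: S0_def p0_def q0_def)
    have wsq: "w \<le> sqrt W * sqrt w"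
    proof -
      have "w = sqrt w * sqrt w" using w by simp
      also have "\<dots> \<le> sqrt W * sqrt w" using w by (intro mult_right_mono) auto
      finally show ?thesis .
    qed
    have "\<exists>f g. degree (b * f) \<le> N \<and> degree (b * g) \<le> N \<and>
        (\<forall>t\<in>{0..1}. \<bar>poly (b * f) t\<bar> \<le> (\<kappa> + k1 * c3\<^sup>2 * sqrt W) * sqrt w * \<Delta> \<and>
                     \<bar>poly (b * g) t\<bar> \<le> (\<kappa> + k1 * c3\<^sup>2 * sqrt W) * sqrt w * \<Delta>) \<and>
        E = 2 * (area (p0 + b * f) (q0 + b * g) - area p0 q0)"
    proof (cases "S0 \<le> \<Delta>")
      case True
      define a where "a = \<kappa> * sqrt w * \<Delta>"
      have a: "a \<ge> 0" using \<kappa> w \<Delta> by (simp add: a_def)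
      have "\<Delta> * S0 \<le> \<Delta>\<^sup>2" using True \<Delta> by (simp add: power2_eq_square)
      then have "k1 * w * (\<Delta>\<^sup>2 + \<Delta> * S0) \<le> k1 * w * (2 * \<Delta>\<^sup>2)"
        using k1 w by (intro mult_left_mono) auto
      also have "\<dots> = 2 * B0 * a\<^sup>2"
        using k1 B0 w by (simp add: a_def \<kappa>_def power_mult_distrib)
      finally have Ea: "\<bar>E\<bar> \<le> 2 * B0 * a\<^sup>2" using E by linarith
      \<comment> \<open>With amplitudes \<open>\<sigma> * s\<close> and \<open>s\<close>, this sign
        gives the quadratic term \<open>- 2 * B0 * \<sigma> * s\<^sup>2\<close> the sign of
        \<open>E\<close>.\<close>
      define \<sigma> :: real where "\<sigma> = (if E \<ge> 0 then -1 else 1)"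
      define L1 where "L1 = - 4 * pint (b * pderiv q0)"
      define L2 where "L2 = 4 * pint (b2 * pderiv p0)"
      have ar: "2 * (area (p0 + b * [:r:]) (q0 + b * [:0, s:]) - area p0 q0) = - 2 * B0 * r * s + L1 * r + L2 * s" for r s
      proof -
        have 1: "b * [:r:] = smult r b" "b * [:0, s:] = smult s b2" by (auto simp: b2_def)
        have "area (smult r b) (smult s b2) = r * s * area b b2"
          by (simp add: area_def pderiv_smult pint_diff pint_smult algebra_simps)
        then show ?thesis
          unfolding 1 area_add by (simp add: b0 b2_def[symmetric] L1_def L2_def pint_smult ab)
            (simp add: b2_def b0 algebra_simps)
      qed
      \<comment> \<open>The linear effects \<open>L1\<close> and \<open>L2\<close> of the bumps may
        have any size; the free sign of \<open>s\<close> takes care of them.\<close>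
      have "\<exists>s. \<bar>s\<bar> \<le> a \<and> 2 * B0 * s\<^sup>2 + (- \<sigma>) * (\<sigma> * L1 + L2) * s = \<bar>E\<bar>"
        by (rule quadratic_reaches) (use B0 a Ea in auto)
      then obtain s where s: "\<bar>s\<bar> \<le> a" "2 * B0 * s\<^sup>2 + (- \<sigma>) * (\<sigma> * L1 + L2) * s = \<bar>E\<bar>" by blast
      have \<sigma>2: "\<sigma> * \<sigma> = 1" "\<bar>E\<bar> = - \<sigma> * E" "\<bar>\<sigma>\<bar> = 1" by (auto simp: \<sigma>_def)
      have "E = - \<sigma> * \<bar>E\<bar>" using \<sigma>2 by (simp add: \<sigma>_def)
      also have "\<dots> = - \<sigma> * (2 * B0 * s\<^sup>2) + (\<sigma> * \<sigma>) * (\<sigma> * L1 + L2) * s"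
        unfolding s(2)[symmetric] by (simp add: algebra_simps)
      also have "\<dots> = - 2 * B0 * (\<sigma> * s) * s + L1 * (\<sigma> * s) + L2 * s"
        unfolding \<sigma>2 by (simp add: power2_eq_square algebra_simps)
      finally have Es: "E = - 2 * B0 * (\<sigma> * s) * s + L1 * (\<sigma> * s) + L2 * s" .
      have aC: "a \<le> (\<kappa> + k1 * c3\<^sup>2 * sqrt W) * sqrt w * \<Delta>"
        unfolding a_def using k1 W w \<Delta> by (intro mult_right_mono) auto
      show ?thesis
      proof (rule exI[of _ "[:\<sigma> * s:]"], rule exI[of _ "[:0, s:]"], intro conjI ballI)
        show "degree (b * [:\<sigma> * s:]) \<le> N" "degree (b * [:0, s:]) \<le> N"
          by (rule le_trans[OF degree_mult_le]; simp add: N_def)+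
        show "E = 2 * (area (p0 + b * [:\<sigma> * s:]) (q0 + b * [:0, s:]) - area p0 q0)"
          unfolding ar by (fact Es)
        fix t :: real assume t: "t \<in> {0..1}"
        have "\<bar>poly b t\<bar> * \<bar>\<sigma> * s\<bar> \<le> 1 * a" using b01[OF t] s \<sigma>2 by (intro mult_mono) (auto simp: abs_mult)
        then show "\<bar>poly (b * [:\<sigma> * s:]) t\<bar> \<le> (\<kappa> + k1 * c3\<^sup>2 * sqrt W) * sqrt w * \<Delta>"
          using aC by (simp add: abs_mult mult_ac)
        have "\<bar>poly b2 t\<bar> * \<bar>s\<bar> \<le> 1 * a" using b2_01[OF t] s by (intro mult_mono) auto
        then show "\<bar>poly (b * [:0, s:]) t\<bar> \<le> (\<kappa> + k1 * c3\<^sup>2 * sqrt W) * sqrt w * \<Delta>"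
          using aC by (simp add: abs_mult b2_def mult_ac)
      qed
    next
      case False
      then have S0: "S0 > \<Delta>" by simp
      have "\<Delta>\<^sup>2 \<le> \<Delta> * S0" using S0 \<Delta> by (simp add: power2_eq_square)
      then have "\<Delta>\<^sup>2 + \<Delta> * S0 \<le> 2 * (\<Delta> * S0)" by linarith
      then have "k1 * w * (\<Delta>\<^sup>2 + \<Delta> * S0) \<le> k1 * w * (2 * (\<Delta> * S0))"
        by (rule mult_left_mono) (use k1 w in auto)
      then have ES: "\<bar>E\<bar> \<le> 2 * k1 * w * \<Delta> * S0" using E by (simp only: mult_ac)
      \<comment> \<open>Perturbing along a derivative \<open>r\<close> changes the area by a
        multiple of \<open>pint (b * r\<^sup>2)\<close>. The square root of this integral is at
        least a constant times the speed, so the coefficient is small exactly when the curve is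
        fast, and the amplitude is of order \<open>w * \<Delta>\<close>.\<close>
      have key: "degree (b * smult (E / (4 * pint (b * r\<^sup>2))) r) \<le> N \<and> pint (b * r\<^sup>2) > 0 \<and>
         (\<forall>t\<in>{0..1}. \<bar>poly (b * smult (E / (4 * pint (b * r\<^sup>2))) r) t\<bar> \<le> (\<kappa> + k1 * c3\<^sup>2 * sqrt W) * sqrt w * \<Delta>)"
        if r: "degree r \<le> n" "S0 \<le> 2 * pabs r" for r
      proof -
        define J where "J = pint (b * r\<^sup>2)"
        have rJ: "\<bar>poly r t\<bar> \<le> c3 * sqrt J" if "t \<in> {0..1}" for t using c3(3)[OF r(1) that] by (simp add: J_def)
        then have pJ: "pabs r \<le> c3 * sqrt J" by (rule pabs_le)
        have "J \<ge> 0" using c3(2) r by (simp add: J_def)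
        moreover have "J \<noteq> 0" using pJ S0 r \<Delta> by (intro notI) simp
        ultimately have J: "J > 0" by simp
        have "\<bar>E\<bar> \<le> 2 * k1 * w * \<Delta> * (2 * (c3 * sqrt J))"
        proof (rule order_trans[OF ES])
          show "2 * k1 * w * \<Delta> * S0 \<le> 2 * k1 * w * \<Delta> * (2 * (c3 * sqrt J))"
            using r pJ k1 w \<Delta> by (intro mult_left_mono) auto
        qed
        then have "\<bar>E\<bar> / (4 * J) \<le> 2 * k1 * w * \<Delta> * (2 * (c3 * sqrt J)) / (4 * J)"
          using J by (intro divide_right_mono) auto
        also have "\<dots> = k1 * c3 * w * \<Delta> / sqrt J" using J by (simp add: field_simps)
        finally have EJ: "\<bar>E / (4 * J)\<bar> \<le> k1 * c3 * w * \<Delta> / sqrt J" using J by simp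
        have "\<bar>poly (b * smult (E / (4 * J)) r) t\<bar> \<le> (\<kappa> + k1 * c3\<^sup>2 * sqrt W) * sqrt w * \<Delta>"
          if t: "t \<in> {0..1}" for t
        proof -
          have "\<bar>poly b t\<bar> * (\<bar>E / (4 * J)\<bar> * \<bar>poly r t\<bar>) \<le> 1 * ((k1 * c3 * w * \<Delta> / sqrt J) * (c3 * sqrt J))"
            using b01[OF t] rJ[OF t] EJ J k1 c3 w \<Delta> by (intro mult_mono) auto
          also have "\<dots> = k1 * c3\<^sup>2 * \<Delta> * w" using J by (simp add: power2_eq_square)
          also have "\<dots> \<le> k1 * c3\<^sup>2 * \<Delta> * (sqrt W * sqrt w)"
            using wsq k1 c3 \<Delta> by (intro mult_left_mono) auto
          also have "\<dots> \<le> (\<kappa> + k1 * c3\<^sup>2 * sqrt W) * sqrt w * \<Delta>"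
            using \<kappa> w \<Delta> by (simp add: algebra_simps)
          finally show ?thesis by (simp only: poly_mult poly_smult abs_mult)
        qed
        moreover have "degree (b * smult (E / (4 * J)) r) \<le> N"
          by (rule le_trans[OF degree_mult_le]) (use r in \<open>simp add: N_def\<close>)
        ultimately show ?thesis using J unfolding J_def by blast
      qed
      have du: "degree u \<le> n" "degree v \<le> n" unfolding u_def v_def n_def
        using dp by (auto intro!: le_trans[OF degree_mult_le])
      have dn: "degree (pderiv p0) \<le> n" "degree (pderiv q0) \<le> n"
      proof -
        have "degree p0 \<le> n" "degree q0 \<le> n"
          unfolding p0_def q0_def using dp du by (auto intro!: degree_add_le simp: n_def)
        then show "degree (pderiv p0) \<le> n" "degree (pderiv q0) \<le> n" by (auto simp: degree_pderiv)
      qed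
      have pos: "0 \<le> (\<kappa> + k1 * c3\<^sup>2 * sqrt W) * sqrt w * \<Delta>" using \<kappa> k1 W w \<Delta> by simp
      \<comment> \<open>One of the two components carries at least half of the speed.\<close>
      consider "S0 \<le> 2 * pabs (pderiv p0)" | "S0 \<le> 2 * pabs (pderiv q0)"
        unfolding S0_def speed_def by linarith
      then show ?thesis
      proof cases
        case 1
        let ?r = "pderiv p0"
        define l where "l = E / (4 * pint (b * ?r\<^sup>2))"
        note K = key[OF dn(1) 1, folded l_def]
        have "area (p0 + b * 0) (q0 + b * smult l ?r) - area p0 q0 = 2 * l * pint (b * ?r\<^sup>2)"
          unfolding area_add by (simp add: b0 area_def pint_smult power2_eq_square mult.assoc)
        then have "E = 2 * (area (p0 + b * 0) (q0 + b * smult l ?r) - area p0 q0)"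
          using K by (simp add: l_def)
        then show ?thesis using K pos by (intro exI[of _ 0] exI[of _ "smult l ?r"]) auto
      next
        case 2
        let ?r = "pderiv q0"
        define l where "l = E / (4 * pint (b * ?r\<^sup>2))"
        note K = key[OF dn(2) 2, folded l_def]
        \<comment> \<open>A perturbation of the first component enters the area with the opposite
          sign, hence \<open>- l\<close>.\<close>
        have "area (p0 + b * smult (- l) ?r) (q0 + b * 0) - area p0 q0 = 2 * l * pint (b * ?r\<^sup>2)"
          unfolding area_add by (simp add: b0 area_def pint_smult pint_minus power2_eq_square mult.assoc)
        then have "E = 2 * (area (p0 + b * smult (- l) ?r) (q0 + b * 0) - area p0 q0)"
          using K by (simp add: l_def)
        then show ?thesis using K pos by (intro exI[of _ "smult (- l) ?r"] exI[of _ 0]) auto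
      qed
    qed
    then obtain f g where fg: "degree (b * f) \<le> N" "degree (b * g) \<le> N"
        "\<And>t. t \<in> {0..1} \<Longrightarrow> \<bar>poly (b * f) t\<bar> \<le> (\<kappa> + k1 * c3\<^sup>2 * sqrt W) * sqrt w * \<Delta>"
        "\<And>t. t \<in> {0..1} \<Longrightarrow> \<bar>poly (b * g) t\<bar> \<le> (\<kappa> + k1 * c3\<^sup>2 * sqrt W) * sqrt w * \<Delta>"
        "E = 2 * (area (p0 + b * f) (q0 + b * g) - area p0 q0)" by blast
    have dN: "degree p \<le> N" "degree q \<le> N" "degree u \<le> N" "degree v \<le> N"
      using dp by (auto simp: u_def v_def N_def n_def intro!: le_trans[OF degree_mult_le])
    have ek: "e \<le> k0 * sqrt W * sqrt w * \<Delta>"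
      unfolding e_def using wsq k0 \<Delta> by (simp add: mult.assoc mult_left_mono mult_right_mono)
    have Csum: "k0 * sqrt W * sqrt w * \<Delta> + (\<kappa> + k1 * c3\<^sup>2 * sqrt W) * sqrt w * \<Delta> = C * sqrt w * \<Delta>"
      by (simp add: C_def algebra_simps)
    show "\<exists>P Q. degree P \<le> N \<and> degree Q \<le> N \<and>
       [:0, 1:] ^ Suc m dvd P - p \<and> [:- 1, 1:] ^ Suc m dvd P - (p + D1) \<and>
       [:0, 1:] ^ Suc m dvd Q - q \<and> [:- 1, 1:] ^ Suc m dvd Q - (q + D2) \<and>
       (\<forall>t\<in>{0..1}. \<bar>poly (P - p) t\<bar> \<le> C * sqrt w * \<Delta> \<and> \<bar>poly (Q - q) t\<bar> \<le> C * sqrt w * \<Delta>) \<and>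
       z = 2 * area P Q"
    proof (rule exI[of _ "p0 + b * f"], rule exI[of _ "q0 + b * g"], intro conjI ballI)
      show "degree (p0 + b * f) \<le> N" "degree (q0 + b * g) \<le> N"
        unfolding p0_def q0_def using dN fg by (auto intro!: degree_add_le)
      have "p0 + b * f - p = c * D1 + b * f" "q0 + b * g - q = c * D2 + b * g"
        by (auto simp: p0_def q0_def u_def v_def)
      then show "[:0, 1:] ^ Suc m dvd p0 + b * f - p" "[:0, 1:] ^ Suc m dvd q0 + b * g - q"
        by (simp_all only: dvd_add dvd_mult2 c(1) bdvd(1))
      have "p0 + b * f - (p + D1) = (c - 1) * D1 + b * f" "q0 + b * g - (q + D2) = (c - 1) * D2 + b * g"
        by (auto simp: p0_def q0_def u_def v_def algebra_simps)
      then show "[:- 1, 1:] ^ Suc m dvd p0 + b * f - (p + D1)" "[:- 1, 1:] ^ Suc m dvd q0 + b * g - (q + D2)"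
        by (simp_all only: dvd_add dvd_mult2 c(2) bdvd(2))
      show "z = 2 * area (p0 + b * f) (q0 + b * g)" using fg(5) by (simp add: E_def)
      fix t :: real assume t: "t \<in> {0..1}"
      have "poly (p0 + b * f - p) t = poly u t + poly (b * f) t"
        "poly (q0 + b * g - q) t = poly v t + poly (b * g) t"
        by (auto simp: p0_def q0_def)
      then show "\<bar>poly (p0 + b * f - p) t\<bar> \<le> C * sqrt w * \<Delta>" "\<bar>poly (q0 + b * g - q) t\<bar> \<le> C * sqrt w * \<Delta>"
        using su(1)[OF t] sv(1)[OF t] fg(3,4)[OF t] ek Csum by linarith+
    qed
  qed
qed

section \<open>Jets and the quantities A and V in unit scale\<close>

text \<open>The derivative of order k of the Taylor polynomial belonging to a formal jet. Jets are
  indexed families F k a, since on the set of limit points they are found before any function that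
  has them as derivatives.\<close>

definition tjet :: "nat \<Rightarrow> (nat \<Rightarrow> real \<Rightarrow> real) \<Rightarrow> real \<Rightarrow> nat \<Rightarrow> real \<Rightarrow> real" where
  "tjet m F a k x = (\<Sum>j\<le>m - k. F (k + j) a / fact j * (x - a) ^ j)"

text \<open>The Taylor polynomial at \<open>a\<close> in the unit parameter t, where x = a + d t. In
  these coordinates all coefficients of a Whitney error have the common order omega(d) d^m.\<close>

definition jetpoly :: "nat \<Rightarrow> (nat \<Rightarrow> real \<Rightarrow> real) \<Rightarrow> real \<Rightarrow> real \<Rightarrow> real poly" where
  "jetpoly m F a d = (\<Sum>k\<le>m. monom (d ^ k * F k a / fact k) k)"

lemma coeff_jetpoly: "coeff (jetpoly m F a d) k = (if k \<le> m then d ^ k * F k a / fact k else 0)"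
  by (simp add: jetpoly_def coeff_sum)

lemma degree_jetpoly: "degree (jetpoly m F a d) \<le> m"
  by (rule degree_le) (simp add: coeff_jetpoly)

lemma poly_higher_pderiv_jetpoly:
  assumes "k \<le> m"
  shows "poly ((pderiv ^^ k) (jetpoly m F a d)) t = d ^ k * tjet m F a k (a + d * t)"
proof -
  have deg: "degree ((pderiv ^^ k) (jetpoly m F a d)) \<le> m - k"
    using degree_jetpoly[of m F a d] by (simp add: degree_higher_pderiv)
  have "coeff ((pderiv ^^ k) (jetpoly m F a d)) j = d ^ (k + j) * F (k + j) a / fact j"
    if "j \<le> m - k" for j
  proof -
    have "(fact (k + j) :: real) = fact j * pochhammer (of_nat (Suc j)) k"
      using pochhammer_product'[of "1::real" j k]
      by (simp add: pochhammer_fact add.commute)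
    moreover have "pochhammer (real (Suc j)) k > 0" by (rule pochhammer_pos) simp
    ultimately show ?thesis using that assms
      by (simp add: coeff_higher_pderiv coeff_jetpoly add.commute)
  qed
  then show ?thesis
    unfolding poly_eq_sum_le[OF deg] tjet_def sum_distrib_left
    by (intro sum.cong) (auto simp: power_add power_mult_distrib)
qed

lemma poly_chain_derivative:
  "(poly ((pderiv ^^ k) (p :: real poly)) has_real_derivative poly ((pderiv ^^ Suc k) p) x) (at x)"
  using poly_DERIV[of "(pderiv ^^ k) p" x] by simp

lemma tjet_eq_poly: "k \<le> m \<Longrightarrow> tjet m F a k x = poly ((pderiv ^^ k) (jetpoly m F a 1)) (x - a)"
  by (simp add: poly_higher_pderiv_jetpoly)

lemma tjet_has_derivative:
  assumes "k < m"
  shows "(tjet m F a k has_real_derivative tjet m F a (Suc k) x) (at x)"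
proof -
  have 1: "tjet m F a k = (\<lambda>x. poly ((pderiv ^^ k) (jetpoly m F a 1)) (x - a))"
    using assms by (intro ext tjet_eq_poly) auto
  have 2: "tjet m F a (Suc k) x = poly ((pderiv ^^ Suc k) (jetpoly m F a 1)) (x - a) * (1 - 0)"
    using assms by (subst tjet_eq_poly) auto
  show ?thesis unfolding 1 2
    by (rule DERIV_chain2[OF poly_chain_derivative]) (auto intro!: derivative_eq_intros)
qed

lemma tjet_top: "tjet m F a m x = F m a"
  by (simp add: tjet_def)

lemma tjet_base: "tjet m F a k a = F k a"
proof -
  have "tjet m F a k a = (\<Sum>j\<in>{0}. F (k + j) a / fact j * (a - a) ^ j)"
    unfolding tjet_def by (rule sum.mono_neutral_right) auto
  then show ?thesis by simp
qed

lemma taylor_eq_tjet: "taylor m f a = tjet m (\<lambda>k. (deriv ^^ k) f) a 0"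
  by (auto simp: taylor_def tjet_def)

lemma integral_unit_interval:
  fixes \<phi> :: "real \<Rightarrow> real"
  assumes "a < b" "continuous_on {0..1} \<phi>"
  shows "integral {a..b} (\<lambda>x. \<phi> ((x - a) / (b - a)) / (b - a)) = integral {0..1} \<phi>"
proof -
  let ?g = "\<lambda>x. (x - a) / (b - a)"
  have "((\<lambda>x. (1 / (b - a)) *\<^sub>R \<phi> (?g x)) has_integral integral {?g a..?g b} \<phi>) {a..b}"
    by (rule has_integral_substitution[where c = 0 and d = 1])
       (use assms in \<open>auto intro!: derivative_eq_intros simp: divide_simps\<close>)
  from integral_unique[OF this] show ?thesis using assms by simp
qed

lemma taylor_unit_scale:
  assumes "a < b"
  shows "taylor m f a x = poly (jetpoly m (\<lambda>k. (deriv ^^ k) f) a (b - a)) ((x - a) / (b - a))"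
    and "deriv (taylor m f a) x =
           poly (pderiv (jetpoly m (\<lambda>k. (deriv ^^ k) f) a (b - a))) ((x - a) / (b - a)) / (b - a)"
proof -
  let ?P = "jetpoly m (\<lambda>k. (deriv ^^ k) f) a (b - a)"
  have 1: "taylor m f a = (\<lambda>x. poly ?P ((x - a) / (b - a)))"
    using poly_higher_pderiv_jetpoly[of 0 m "\<lambda>k. (deriv ^^ k) f" a "b - a"] assms
    by (auto simp: taylor_eq_tjet)
  then show "taylor m f a x = poly ?P ((x - a) / (b - a))" by simp
  have "((\<lambda>x. poly ?P ((x - a) / (b - a))) has_real_derivative
      poly (pderiv ?P) ((x - a) / (b - a)) * (1 / (b - a))) (at x)"
    by (rule DERIV_chain2[OF poly_DERIV]) (use assms in \<open>auto intro!: derivative_eq_intros\<close>)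
  then show "deriv (taylor m f a) x = poly (pderiv ?P) ((x - a) / (b - a)) / (b - a)"
    unfolding 1 by (simp add: DERIV_imp_deriv)
qed

lemma poly_jetpoly_0: "poly (jetpoly m F a d) 0 = F 0 a"
  by (simp add: poly_0_coeff_0 coeff_jetpoly)

lemma A_fun_eq_defect:
  assumes "a < b"
  shows "A_fun m \<Gamma> a b =
    defect (jetpoly m (\<lambda>k. (deriv ^^ k) (cx \<Gamma>)) a (b - a)) (jetpoly m (\<lambda>k. (deriv ^^ k) (cy \<Gamma>)) a (b - a))
      (cz \<Gamma> b - cz \<Gamma> a) (cx \<Gamma> b) (cy \<Gamma> b)"
proof -
  let ?P = "jetpoly m (\<lambda>k. (deriv ^^ k) (cx \<Gamma>)) a (b - a)"
  let ?Q = "jetpoly m (\<lambda>k. (deriv ^^ k) (cy \<Gamma>)) a (b - a)"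
  let ?\<phi> = "poly (pderiv ?P * ?Q - ?P * pderiv ?Q)"
  have "integral {a..b} (\<lambda>x. deriv (taylor m (cx \<Gamma>) a) x * taylor m (cy \<Gamma>) a x
      - deriv (taylor m (cy \<Gamma>) a) x * taylor m (cx \<Gamma>) a x)
    = integral {a..b} (\<lambda>x. ?\<phi> ((x - a) / (b - a)) / (b - a))"
    unfolding taylor_unit_scale[OF assms] by (intro integral_cong) (simp add: diff_divide_distrib mult.commute)
  also have "\<dots> = area ?P ?Q" unfolding area_def pint_def
    by (rule integral_unit_interval[OF assms]) (intro continuous_intros)
  finally show ?thesis using assms
    by (simp add: A_fun_def Let_def defect_def taylor_unit_scale[OF assms] poly_jetpoly_0)
qed

lemma V_fun_eq_speed:
  assumes "a < b"
  shows "V_fun m \<Gamma> a b = (b - a) ^ (2 * m) + (b - a) ^ m *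
    speed (jetpoly m (\<lambda>k. (deriv ^^ k) (cx \<Gamma>)) a (b - a)) (jetpoly m (\<lambda>k. (deriv ^^ k) (cy \<Gamma>)) a (b - a))"
proof -
  let ?P = "jetpoly m (\<lambda>k. (deriv ^^ k) (cx \<Gamma>)) a (b - a)"
  let ?Q = "jetpoly m (\<lambda>k. (deriv ^^ k) (cy \<Gamma>)) a (b - a)"
  let ?\<phi> = "\<lambda>t. \<bar>poly (pderiv ?P) t\<bar> + \<bar>poly (pderiv ?Q) t\<bar>"
  have "integral {a..b} (\<lambda>x. \<bar>deriv (taylor m (cx \<Gamma>) a) x\<bar> + \<bar>deriv (taylor m (cy \<Gamma>) a) x\<bar>)
     = integral {a..b} (\<lambda>x. ?\<phi> ((x - a) / (b - a)) / (b - a))"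
    unfolding taylor_unit_scale[OF assms] using assms by (intro integral_cong) (simp add: add_divide_distrib)
  also have "\<dots> = integral {0..1} ?\<phi>"
    by (rule integral_unit_interval[OF assms]) (intro continuous_intros)
  also have "\<dots> = speed ?P ?Q" unfolding speed_def pabs_def by (rule integral_add) auto
  finally show ?thesis by (simp add: V_fun_def Let_def)
qed

section \<open>Jets at limit points\<close>

definition whitney :: "nat \<Rightarrow> (real \<Rightarrow> real) \<Rightarrow> real set \<Rightarrow> (nat \<Rightarrow> real \<Rightarrow> real) \<Rightarrow> real \<Rightarrow> bool" where
  "whitney m \<omega> E F C \<longleftrightarrow>
     (\<forall>a\<in>E. \<forall>b\<in>E. \<forall>k\<le>m. \<bar>F k b - tjet m F a k b\<bar> \<le> C * \<omega> \<bar>b - a\<bar> * \<bar>b - a\<bar> ^ (m - k))"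

text \<open>The bound on A/V multiplied out and in unit scale. The first summand of V is written as
  a square to fit the form of \<open>unit_gap\<close> with (b - a)^m for Delta.\<close>

definition area_cond :: "nat \<Rightarrow> (real \<Rightarrow> real) \<Rightarrow> real set \<Rightarrow> (nat \<Rightarrow> real \<Rightarrow> real) \<Rightarrow>
    (nat \<Rightarrow> real \<Rightarrow> real) \<Rightarrow> (real \<Rightarrow> real) \<Rightarrow> real \<Rightarrow> bool" where
  "area_cond m \<omega> E F G z C \<longleftrightarrow> (\<forall>a\<in>E. \<forall>b\<in>E. a < b \<longrightarrow>
     \<bar>defect (jetpoly m F a (b - a)) (jetpoly m G a (b - a)) (z b - z a) (F 0 b) (G 0 b)\<bar>
     \<le> C * \<omega> (b - a) * (((b - a) ^ m)\<^sup>2 + (b - a) ^ m *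
          speed (jetpoly m F a (b - a)) (jetpoly m G a (b - a))))"

lemma exists_subset_near_limpt:
  fixes a :: real
  assumes "a islimpt K" "\<delta> > 0" "P \<subseteq> K \<inter> cball a \<delta>" "finite P" "card P \<le> n"
  shows "\<exists>X. X \<subseteq> K \<inter> cball a \<delta> \<and> finite X \<and> card X = n \<and> P \<subseteq> X"
proof -
  have "infinite (K \<inter> ball a \<delta>)" using assms by (simp add: islimpt_eq_infinite_ball)
  then have "infinite (K \<inter> ball a \<delta> - P)" using assms by simp
  then obtain B where B: "finite B" "card B = n - card P" "B \<subseteq> K \<inter> ball a \<delta> - P"
    using infinite_arbitrarily_large by blast
  have "card (B \<union> P) = n" using B assms by (subst card_Un_disjoint) auto
  then show ?thesis using B assms by (intro exI[of _ "B \<union> P"]) auto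
qed

text \<open>The top derivative has a zero and small oscillation, so it is small; each lower
  derivative has a zero of its own from which to integrate. The zeros may differ from order to
  order, unlike the single base point of \<open>derivative_chain_bound\<close>.\<close>

lemma deriv_diff_bound_of_zeros:
  fixes w :: "nat \<Rightarrow> real \<Rightarrow> real"
  assumes der: "\<And>k x. k < m \<Longrightarrow> (w k has_real_derivative w (Suc k) x) (at x)"
    and zeros: "\<And>k. k \<le> m \<Longrightarrow> \<exists>z\<in>{lo..hi}. w k z = 0"
    and top: "\<And>x y. x \<in> {lo..hi} \<Longrightarrow> y \<in> {lo..hi} \<Longrightarrow> \<bar>w m x - w m y\<bar> \<le> \<eta>"
    and "k \<le> m" "x \<in> {lo..hi}"
  shows "\<bar>w k x\<bar> \<le> \<eta> * (hi - lo) ^ (m - k)"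
  using assms(4,5)
proof (induction k arbitrary: x rule: inc_induct)
  case base
  obtain z where "z \<in> {lo..hi}" "w m z = 0" using zeros by blast
  then show ?case using top[of x z] base by simp
next
  case (step k)
  define B where "B = \<eta> * (hi - lo) ^ (m - Suc k)"
  obtain z where z: "z \<in> {lo..hi}" "w k z = 0" using zeros[of k] step.hyps by auto
  have "B \<ge> 0" using step.IH[OF z(1)] unfolding B_def by linarith
  have "norm (w k x - w k z) \<le> B * norm (x - z)"
  proof (rule field_differentiable_bound[of "{lo..hi}"])
    show "(w k has_real_derivative w (Suc k) y) (at y within {lo..hi})" for y
      using der[OF step.hyps(2)] by (rule DERIV_subset) simp
    show "norm (w (Suc k) y) \<le> B" if "y \<in> {lo..hi}" for y
      using step.IH[OF that] by (simp add: B_def)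
  qed (use step.prems z in auto)
  also have "\<dots> \<le> B * (hi - lo)"
    using \<open>B \<ge> 0\<close> step.prems z by (intro mult_left_mono) auto
  also have "\<dots> = \<eta> * (hi - lo) ^ (m - k)"
  proof -
    have "m - k = Suc (m - Suc k)" using step.hyps by simp
    then show ?thesis by (simp add: B_def)
  qed
  finally show ?case using z by simp
qed

text \<open>One scalar component of the given family of interpolants, to be used for the x- and the
  y-component.\<close>

locale interpolant_family =
  fixes m :: nat and \<omega> :: "real \<Rightarrow> real" and K :: "real set"
    and u :: "real set \<Rightarrow> real \<Rightarrow> real" and \<phi> :: "real \<Rightarrow> real" and C :: real
  assumes modulus: "modulus_of_continuity \<omega>"
    and C_pos: "C > 0"
    and smooth: "\<And>X. X \<subseteq> K \<Longrightarrow> finite X \<Longrightarrow> card X = m + 2 \<Longrightarrow> Cm m (u X)"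
    and holder: "\<And>X a b. X \<subseteq> K \<Longrightarrow> finite X \<Longrightarrow> card X = m + 2 \<Longrightarrow>
       \<bar>(deriv ^^ m) (u X) b - (deriv ^^ m) (u X) a\<bar> \<le> C * \<omega> \<bar>b - a\<bar>"
    and interp: "\<And>X x. X \<subseteq> K \<Longrightarrow> finite X \<Longrightarrow> card X = m + 2 \<Longrightarrow> x \<in> X \<Longrightarrow> u X x = \<phi> x"
begin

definition adm :: "real \<Rightarrow> real \<Rightarrow> real set \<Rightarrow> bool" where
  "adm a \<delta> X \<longleftrightarrow> X \<subseteq> K \<inter> cball a \<delta> \<and> finite X \<and> card X = m + 2"

lemma admD: "adm a \<delta> X \<Longrightarrow> X \<subseteq> K \<and> finite X \<and> card X = m + 2"
  by (auto simp: adm_def)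

text \<open>The difference of the two interpolants vanishes at the m + 1 points of Z. In the
  constant, two Hoelder bounds and the doubling of the modulus give 4, and the length
  \<open>2 * \<delta>\<close> of the interval gives at most \<open>2 ^ m\<close>.\<close>

lemma exchange_one:
  assumes X: "adm a \<delta> X" and Y: "adm a \<delta> Y" and Z: "Z \<subseteq> X \<inter> Y" "card Z = Suc m"
    and \<delta>: "\<delta> > 0" and k: "k \<le> m"
  shows "\<bar>(deriv ^^ k) (u X) a - (deriv ^^ k) (u Y) a\<bar> \<le> 4 * C * 2 ^ m * \<omega> \<delta> * \<delta> ^ (m - k)"
proof -
  note X' = admD[OF X] and Y' = admD[OF Y]
  define w where "w = (\<lambda>k x. (deriv ^^ k) (u X) x - (deriv ^^ k) (u Y) x)"
  have der: "(w k has_real_derivative w (Suc k) x) (at x)" if "k < m" for k x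
    unfolding w_def using X' Y' that smooth by (intro DERIV_diff Cm_has_derivative) auto
  have fZ: "finite Z" using Z X' by (meson finite_subset le_inf_iff)
  have ZI: "Z \<subseteq> {a - \<delta>..a + \<delta>}"
  proof
    fix z assume "z \<in> Z"
    then have "z \<in> cball a \<delta>" using Z X by (auto simp: adm_def)
    then show "z \<in> {a - \<delta>..a + \<delta>}" by (simp add: cball_eq_atLeastAtMost)
  qed
  have "\<bar>w k a\<bar> \<le> 2 * C * \<omega> (2 * \<delta>) * ((a + \<delta>) - (a - \<delta>)) ^ (m - k)"
  proof (rule deriv_diff_bound_of_zeros[where w = w])
    show "\<exists>z\<in>{a - \<delta>..a + \<delta>}. w k z = 0" if "k \<le> m" for k
    proof (rule rolle_iterated[where u = w, OF der fZ Z(2) ZI _ that])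
      show "w 0 z = 0" if "z \<in> Z" for z
      proof -
        have "u X z = \<phi> z" "u Y z = \<phi> z" using Z that X' Y' by (auto intro!: interp)
        then show ?thesis by (simp add: w_def)
      qed
    qed
    show "\<bar>w m x - w m y\<bar> \<le> 2 * C * \<omega> (2 * \<delta>)"
      if "x \<in> {a - \<delta>..a + \<delta>}" "y \<in> {a - \<delta>..a + \<delta>}" for x y
    proof -
      have "\<omega> \<bar>x - y\<bar> \<le> \<omega> (2 * \<delta>)" by (rule modulus_mono[OF modulus]) (use that in auto)
      then have "C * \<omega> \<bar>x - y\<bar> \<le> C * \<omega> (2 * \<delta>)" using C_pos by (intro mult_left_mono) auto
      moreover have "\<bar>(deriv ^^ m) (u X) x - (deriv ^^ m) (u X) y\<bar> \<le> C * \<omega> \<bar>x - y\<bar>"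
        "\<bar>(deriv ^^ m) (u Y) x - (deriv ^^ m) (u Y) y\<bar> \<le> C * \<omega> \<bar>x - y\<bar>"
        using holder X' Y' by auto
      ultimately show ?thesis unfolding w_def by linarith
    qed
  qed (use der k \<delta> in auto)
  also have "\<dots> = 2 * C * \<omega> (2 * \<delta>) * (2 ^ (m - k) * \<delta> ^ (m - k))" by (simp add: power_mult_distrib)
  also have "\<dots> \<le> 2 * C * (2 * \<omega> \<delta>) * (2 ^ m * \<delta> ^ (m - k))"
  proof (rule mult_mono)
    show "2 * C * \<omega> (2 * \<delta>) \<le> 2 * C * (2 * \<omega> \<delta>)"
      using modulus_double[OF modulus, of \<delta>] \<delta> C_pos by simp
    have "(2::real) ^ (m - k) \<le> 2 ^ m" by (rule power_increasing) auto
    then show "2 ^ (m - k) * \<delta> ^ (m - k) \<le> 2 ^ m * \<delta> ^ (m - k)"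
      using \<delta> by (intro mult_right_mono) auto
  qed (use C_pos modulus_nonneg[OF modulus] \<delta> in auto)
  finally show ?thesis by (simp add: w_def mult_ac)
qed

text \<open>At most m + 2 exchanges lead from one admissible set to another, each at the cost in
  \<open>exchange_one\<close>.\<close>

definition C' :: real where "C' = real (m + 2) * (4 * C * 2 ^ m)"

lemma C'_pos: "C' > 0" using C_pos by (simp add: C'_def)

text \<open>Passing from X to Y by exchanging one point at a time, consecutive interpolants agree at
  m + 1 points, so Rolle's theorem produces zeros of the differences of all derivatives up to order m.\<close>

lemma exchange:
  assumes X: "adm a \<delta> X" and Y: "adm a \<delta> Y" and \<delta>: "\<delta> > 0" and k: "k \<le> m"
  shows "\<bar>(deriv ^^ k) (u X) a - (deriv ^^ k) (u Y) a\<bar> \<le> C' * \<omega> \<delta> * \<delta> ^ (m - k)"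
proof -
  let ?B = "4 * C * 2 ^ m * \<omega> \<delta> * \<delta> ^ (m - k)"
  have B: "?B \<ge> 0" using C_pos \<delta> modulus_nonneg[OF modulus] by simp
  have "\<bar>(deriv ^^ k) (u X) a - (deriv ^^ k) (u Y) a\<bar> \<le> real n * ?B"
    if "adm a \<delta> X" "card (X - Y) = n" for n X
    using that
  proof (induction n arbitrary: X)
    case 0
    then have "X \<subseteq> Y" using admD by auto
    then have "X = Y" using 0 Y by (metis admD card_subset_eq)
    then show ?case by simp
  next
    case (Suc n)
    note X' = admD[OF Suc.prems(1)] and Y' = admD[OF Y]
    have fin: "finite (X - Y)" using X' by auto
    then obtain x where x: "x \<in> X" "x \<notin> Y" using Suc.prems by (metis DiffE card.empty ex_in_conv nat.distinct(1))
    have "\<not> Y \<subseteq> X" using x X' Y' by (metis card_subset_eq)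
    then obtain y where y: "y \<in> Y" "y \<notin> X" by blast
    define X1 where "X1 = insert y (X - {x})"
    have "card (X - {x}) = Suc m" using X' x by simp
    then have cX1: "card X1 = m + 2" using X' y by (simp add: X1_def)
    then have aX1: "adm a \<delta> X1" using Suc.prems Y y by (auto simp: adm_def X1_def)
    have "X1 - Y = (X - Y) - {x}" using y by (auto simp: X1_def)
    then have "card (X1 - Y) = n" using Suc.prems x fin by simp
    then have "\<bar>(deriv ^^ k) (u X1) a - (deriv ^^ k) (u Y) a\<bar> \<le> real n * ?B" using Suc.IH aX1 by blast
    moreover have "\<bar>(deriv ^^ k) (u X) a - (deriv ^^ k) (u X1) a\<bar> \<le> ?B"
      by (rule exchange_one[OF Suc.prems(1) aX1, of "X - {x}"]) (use \<open>card (X - {x}) = Suc m\<close> \<delta> k in \<open>auto simp: X1_def\<close>)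
    ultimately show ?case by (simp add: algebra_simps)
  qed
  from this[OF X refl]
  have "\<bar>(deriv ^^ k) (u X) a - (deriv ^^ k) (u Y) a\<bar> \<le> real (card (X - Y)) * ?B" .
  also have "\<dots> \<le> real (m + 2) * ?B"
  proof (rule mult_right_mono[OF _ B])
    have "card (X - Y) \<le> card X" using admD[OF X] by (intro card_mono) auto
    then show "real (card (X - Y)) \<le> real (m + 2)" using admD[OF X] by simp
  qed
  finally show ?thesis by (simp add: C'_def mult_ac)
qed

text \<open>The exchange estimate is the Cauchy property along sets shrinking to \<open>a\<close>.
  The decay has to come from \<open>\<omega> \<delta>\<close>, since the power of
  \<open>\<delta>\<close> is 1 when \<open>k = m\<close>. For a fixed X the same estimate at the
  scale of X passes to the limit.\<close>

lemma jet_exists: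
  assumes a: "a \<in> K" "a islimpt K" and k: "k \<le> m"
  shows "\<exists>L. \<forall>X \<delta>. \<delta> > 0 \<longrightarrow> adm a \<delta> X \<longrightarrow> \<bar>L - (deriv ^^ k) (u X) a\<bar> \<le> C' * \<omega> \<delta> * \<delta> ^ (m - k)"
proof -
  have "\<exists>X. adm a (1 / real (Suc n)) X" for n
    using exists_subset_near_limpt[OF a(2), of "1 / real (Suc n)" "{}" "m + 2"] by (auto simp: adm_def)
  then obtain S where S: "\<And>n. adm a (1 / real (Suc n)) (S n)" by metis
  have adm_mono: "adm a \<delta>' X" if "adm a \<delta> X" "\<delta> \<le> \<delta>'" for X \<delta> \<delta>'
    using that by (auto simp: adm_def)
  define s where "s n = (deriv ^^ k) (u (S n)) a" for n
  have "Cauchy s"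
  proof (rule CauchyI)
    fix e :: real assume e: "e > 0"
    obtain d where d: "d > 0" "\<And>t. 0 \<le> t \<Longrightarrow> t < d \<Longrightarrow> \<omega> t < e / C'"
      using modulus_small[OF modulus, of "e / C'"] e C'_pos by auto
    obtain N where N: "1 / real (Suc N) < d" using nat_approx_posE[OF d(1)] by blast
    let ?d = "1 / real (Suc N)"
    show "\<exists>M. \<forall>i\<ge>M. \<forall>j\<ge>M. norm (s i - s j) < e"
    proof (intro exI[of _ N] allI impI)
      fix i j assume ij: "N \<le> i" "N \<le> j"
      have "adm a ?d (S i)" "adm a ?d (S j)"
        by (rule adm_mono[OF S]; use ij in \<open>simp add: field_simps\<close>)+
      then have "\<bar>s i - s j\<bar> \<le> C' * \<omega> ?d * ?d ^ (m - k)"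
        unfolding s_def by (rule exchange) (use k in auto)
      also have "\<dots> \<le> C' * \<omega> ?d * 1"
        using C'_pos modulus_nonneg[OF modulus, of ?d] by (intro mult_left_mono power_le_one) auto
      also have "\<dots> < C' * (e / C') * 1"
        using C'_pos d(2)[of ?d] N by (intro mult_strict_right_mono mult_strict_left_mono) auto
      finally show "norm (s i - s j) < e" using C'_pos by simp
    qed
  qed
  then obtain L where L: "s \<longlonglongrightarrow> L" using Cauchy_convergent_iff convergent_def by blast
  show ?thesis
  proof (intro exI[of _ L] allI impI)
    fix X \<delta> assume \<delta>: "\<delta> > 0" and X: "adm a \<delta> X"
    obtain N where N: "1 / real (Suc N) < \<delta>" using nat_approx_posE[OF \<delta>] by blast
    show "\<bar>L - (deriv ^^ k) (u X) a\<bar> \<le> C' * \<omega> \<delta> * \<delta> ^ (m - k)"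
    proof (rule LIMSEQ_le_const2[where X = "\<lambda>n. \<bar>s n - (deriv ^^ k) (u X) a\<bar>"])
      show "(\<lambda>n. \<bar>s n - (deriv ^^ k) (u X) a\<bar>) \<longlonglongrightarrow> \<bar>L - (deriv ^^ k) (u X) a\<bar>"
        by (intro tendsto_intros L)
      show "\<exists>N. \<forall>n\<ge>N. \<bar>s n - (deriv ^^ k) (u X) a\<bar> \<le> C' * \<omega> \<delta> * \<delta> ^ (m - k)"
      proof (intro exI[of _ N] allI impI)
        fix n assume "N \<le> n"
        then have "1 / real (Suc n) \<le> \<delta>" using N by (simp add: field_simps) (smt (verit) mult_left_mono of_nat_mono \<delta>)
        then have "adm a \<delta> (S n)" using adm_mono S by blast
        then show "\<bar>s n - (deriv ^^ k) (u X) a\<bar> \<le> C' * \<omega> \<delta> * \<delta> ^ (m - k)"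
          unfolding s_def using exchange X \<delta> k by blast
      qed
    qed
  qed
qed

definition jet :: "nat \<Rightarrow> real \<Rightarrow> real" where
  "jet k a = (SOME L. \<forall>X \<delta>. \<delta> > 0 \<longrightarrow> adm a \<delta> X \<longrightarrow> \<bar>L - (deriv ^^ k) (u X) a\<bar> \<le> C' * \<omega> \<delta> * \<delta> ^ (m - k))"

lemma jet_approx:
  assumes "a \<in> K" "a islimpt K" "k \<le> m" "\<delta> > 0" "adm a \<delta> X"
  shows "\<bar>jet k a - (deriv ^^ k) (u X) a\<bar> \<le> C' * \<omega> \<delta> * \<delta> ^ (m - k)"
  using someI_ex[OF jet_exists[OF assms(1-3)]] assms(4,5) unfolding jet_def by blast

text \<open>Arbitrarily small admissible sets may be taken to contain \<open>a\<close>, and their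
  interpolants have the value \<open>\<phi> a\<close> there.\<close>

lemma jet_0:
  assumes a: "a \<in> K" "a islimpt K"
  shows "jet 0 a = \<phi> a"
proof (rule ccontr)
  assume "jet 0 a \<noteq> \<phi> a"
  then have e: "\<bar>jet 0 a - \<phi> a\<bar> / C' > 0" using C'_pos by simp
  obtain d where d: "d > 0" "\<And>t. 0 \<le> t \<Longrightarrow> t < d \<Longrightarrow> \<omega> t < \<bar>jet 0 a - \<phi> a\<bar> / C'"
    using modulus_small[OF modulus e] by blast
  define \<delta> where "\<delta> = min 1 (d / 2)"
  have \<delta>: "\<delta> > 0" "\<delta> < d" "\<delta> \<le> 1" using d(1) by (auto simp: \<delta>_def)
  obtain X where X: "adm a \<delta> X" "a \<in> X"
    using exists_subset_near_limpt[OF a(2) \<delta>(1), of "{a}" "m + 2"] a(1) \<delta> by (auto simp: adm_def)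
  have "\<bar>jet 0 a - (deriv ^^ 0) (u X) a\<bar> \<le> C' * \<omega> \<delta> * \<delta> ^ (m - 0)"
    by (rule jet_approx) (use a \<delta> X in auto)
  also have "\<dots> \<le> C' * \<omega> \<delta> * 1"
    using C'_pos modulus_nonneg[OF modulus, of \<delta>] \<delta> by (intro mult_left_mono power_le_one) auto
  also have "\<dots> < C' * (\<bar>jet 0 a - \<phi> a\<bar> / C') * 1"
    using C'_pos d(2)[of \<delta>] \<delta> by (intro mult_strict_right_mono mult_strict_left_mono) auto
  also have "\<dots> = \<bar>jet 0 a - \<phi> a\<bar>" using C'_pos by simp
  finally show False using interp[of X a] admD[OF X(1)] X(2) by simp
qed

text \<open>Both jets are compared with one interpolant: a set within
  \<open>\<delta> = \<bar>b - a\<bar>\<close> of \<open>a\<close> lies within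
  \<open>2 * \<delta>\<close> of \<open>b\<close>. What remains is the Taylor remainder of this
  interpolant along the segment, with base errors from the approximation at
  \<open>a\<close>.\<close>

lemma jet_whitney:
  "\<exists>C2>0. whitney m \<omega> {a \<in> K. a islimpt K} jet C2"
proof -
  define C2 where "C2 = real (m + 1) * (C + C') + C' * 2 * 2 ^ m"
  have C2: "C2 > 0" using C_pos C'_pos by (simp add: C2_def add_pos_pos)
  have "\<bar>jet k b - tjet m jet a k b\<bar> \<le> C2 * \<omega> \<bar>b - a\<bar> * \<bar>b - a\<bar> ^ (m - k)"
    if a: "a \<in> K" "a islimpt K" and b: "b \<in> K" "b islimpt K" and k: "k \<le> m" for a b k
  proof (cases "a = b")
    case True
    then show ?thesis using modulus by (simp add: tjet_base modulus_of_continuity_def)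
  next
    case False
    define \<delta> where "\<delta> = \<bar>b - a\<bar>"
    have \<delta>: "\<delta> > 0" using False by (simp add: \<delta>_def)
    have w0: "\<omega> \<delta> \<ge> 0" using modulus_nonneg[OF modulus] \<delta> by simp
    obtain X where X: "adm a \<delta> X"
      using exists_subset_near_limpt[OF a(2) \<delta>, of "{}" "m + 2"] by (auto simp: adm_def)
    note X' = admD[OF X]
    have Xb: "adm b (2 * \<delta>) X"
    proof -
      have "x \<in> cball b (2 * \<delta>)" if "x \<in> X" for x
      proof -
        have "dist a x \<le> \<delta>" using that X by (auto simp: adm_def)
        moreover have "dist b a = \<delta>" by (simp add: \<delta>_def dist_real_def)
        ultimately show ?thesis using dist_triangle[of b x a] by simp
      qed
      then show ?thesis using X' by (auto simp: adm_def)
    qed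
    define w where "w = (\<lambda>k x. (deriv ^^ k) (u X) x - tjet m jet a k x)"
    have "\<bar>w k b\<bar> \<le> real (m - k + 1) * ((C + C') * \<omega> \<delta>) * \<delta> ^ (m - k)"
    proof (rule derivative_chain_bound[where u = w and c = a and x = b])
      show "(w k has_real_derivative w (Suc k) y) (at y)" if "k < m" for k y
        unfolding w_def using that X' smooth by (intro DERIV_diff Cm_has_derivative tjet_has_derivative) auto
      show "\<bar>w m y\<bar> \<le> (C + C') * \<omega> \<delta>" if y: "y \<in> closed_segment a b" for y
      proof -
        have "\<bar>y - a\<bar> \<le> \<delta>" using y by (auto simp: \<delta>_def closed_segment_eq_real_ivl split: if_splits)
        then have "C * \<omega> \<bar>y - a\<bar> \<le> C * \<omega> \<delta>"
          using C_pos by (intro mult_left_mono modulus_mono[OF modulus]) auto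
        moreover have "\<bar>(deriv ^^ m) (u X) y - (deriv ^^ m) (u X) a\<bar> \<le> C * \<omega> \<bar>y - a\<bar>"
          using holder X' by blast
        moreover have "\<bar>jet m a - (deriv ^^ m) (u X) a\<bar> \<le> C' * \<omega> \<delta>"
          using jet_approx[OF a order_refl \<delta> X] by simp
        ultimately show ?thesis unfolding w_def tjet_top distrib_right by linarith
      qed
      show "\<bar>w k a\<bar> \<le> (C + C') * \<omega> \<delta> * \<delta> ^ (m - k)" if "k < m" for k
      proof -
        have "\<bar>w k a\<bar> \<le> C' * \<omega> \<delta> * \<delta> ^ (m - k)"
          using jet_approx[OF a _ \<delta> X, of k] that by (simp add: w_def tjet_base abs_minus_commute)
        also have "\<dots> \<le> (C + C') * \<omega> \<delta> * \<delta> ^ (m - k)"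
          using C_pos w0 \<delta> by (intro mult_right_mono) auto
        finally show ?thesis .
      qed
    qed (use k in \<open>auto simp: \<delta>_def\<close>)
    also have "\<dots> \<le> real (m + 1) * ((C + C') * \<omega> \<delta>) * \<delta> ^ (m - k)"
      using C_pos C'_pos w0 \<delta> by (intro mult_right_mono) auto
    finally have 1: "\<bar>w k b\<bar> \<le> real (m + 1) * ((C + C') * \<omega> \<delta>) * \<delta> ^ (m - k)" .
    have "\<bar>jet k b - (deriv ^^ k) (u X) b\<bar> \<le> C' * \<omega> (2 * \<delta>) * (2 * \<delta>) ^ (m - k)"
      by (rule jet_approx[OF b k _ Xb]) (use \<delta> in auto)
    also have "\<dots> \<le> C' * (2 * \<omega> \<delta>) * (2 ^ m * \<delta> ^ (m - k))"
    proof (rule mult_mono)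
      show "C' * \<omega> (2 * \<delta>) \<le> C' * (2 * \<omega> \<delta>)"
        using modulus_double[OF modulus, of \<delta>] \<delta> C'_pos by simp
      have "(2::real) ^ (m - k) \<le> 2 ^ m" by (rule power_increasing) auto
      then show "(2 * \<delta>) ^ (m - k) \<le> 2 ^ m * \<delta> ^ (m - k)"
        unfolding power_mult_distrib using \<delta> by (intro mult_right_mono) auto
    qed (use C'_pos w0 \<delta> in auto)
    finally have "\<bar>jet k b - tjet m jet a k b\<bar>
       \<le> C' * (2 * \<omega> \<delta>) * (2 ^ m * \<delta> ^ (m - k)) + real (m + 1) * ((C + C') * \<omega> \<delta>) * \<delta> ^ (m - k)"
      using 1 unfolding w_def by linarith
    also have "\<dots> = C2 * \<omega> \<delta> * \<delta> ^ (m - k)" by (simp add: C2_def algebra_simps)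
    finally show ?thesis by (simp add: \<delta>_def)
  qed
  then show ?thesis using C2 by (auto simp: whitney_def)
qed

text \<open>In unit scale every coefficient of the error is at most
  \<open>C' * \<omega> \<delta> * \<delta> ^ m\<close>; the square of m + 1 counts coefficients and
  one differentiation. Since X contains \<open>a\<close>, the error vanishes at 0, as
  \<open>defect_stable\<close> demands.\<close>

lemma jetpoly_jet_approx:
  assumes a: "a \<in> K" "a islimpt K" and \<delta>: "\<delta> > 0" and X: "adm a \<delta> X" "a \<in> X"
  shows "\<exists>v. jetpoly m jet a \<delta> = jetpoly m (\<lambda>k. (deriv ^^ k) (u X)) a \<delta> + v \<and> poly v 0 = 0 \<and>
    (\<forall>t\<in>{0..1}. \<bar>poly v t\<bar> \<le> ((real m + 1)\<^sup>2 * C') * \<omega> \<delta> * \<delta> ^ m \<and>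
               \<bar>poly (pderiv v) t\<bar> \<le> ((real m + 1)\<^sup>2 * C') * \<omega> \<delta> * \<delta> ^ m)"
proof -
  define v where "v = jetpoly m jet a \<delta> - jetpoly m (\<lambda>k. (deriv ^^ k) (u X)) a \<delta>"
  let ?A = "C' * \<omega> \<delta> * \<delta> ^ m"
  have A: "?A \<ge> 0" using C'_pos \<delta> modulus_nonneg[OF modulus] by simp
  have dv: "degree v \<le> m" unfolding v_def by (intro degree_diff_le degree_jetpoly)
  have cv: "\<bar>coeff v k\<bar> \<le> ?A" for k
  proof (cases "k \<le> m")
    case True
    have "coeff v k = \<delta> ^ k * (jet k a - (deriv ^^ k) (u X) a) / fact k"
      using True by (simp add: v_def coeff_jetpoly right_diff_distrib diff_divide_distrib)
    then have "\<bar>coeff v k\<bar> = \<delta> ^ k * \<bar>jet k a - (deriv ^^ k) (u X) a\<bar> / fact k"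
      using \<delta> by (simp add: abs_mult)
    also have "\<dots> \<le> \<delta> ^ k * \<bar>jet k a - (deriv ^^ k) (u X) a\<bar> / 1"
      using \<delta> by (intro divide_left_mono) auto
    also have "\<dots> \<le> \<delta> ^ k * (C' * \<omega> \<delta> * \<delta> ^ (m - k))"
      using jet_approx[OF a True \<delta> X(1)] \<delta> by (simp add: mult_left_mono)
    also have "\<dots> = ?A" using True by (simp add: mult_ac power_add[symmetric])
    finally show ?thesis .
  next
    case False
    then show ?thesis using A by (simp add: v_def coeff_jetpoly)
  qed
  have "poly v 0 = 0"
    using jet_0[OF a] interp[of X a] admD[OF X(1)] X(2) by (simp add: v_def poly_jetpoly_0)
  moreover have "\<bar>poly v t\<bar> \<le> ((real m + 1)\<^sup>2 * C') * \<omega> \<delta> * \<delta> ^ m \<and>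
      \<bar>poly (pderiv v) t\<bar> \<le> ((real m + 1)\<^sup>2 * C') * \<omega> \<delta> * \<delta> ^ m" if t: "t \<in> {0..1}" for t
  proof
    have "\<bar>poly v t\<bar> \<le> real (m + 1) * ?A" by (rule abs_poly_le_coeffs[OF dv cv]) (use t in auto)
    also have "\<dots> \<le> (real m + 1)\<^sup>2 * ?A"
      by (rule mult_right_mono[OF _ A]) (simp add: power2_eq_square algebra_simps)
    finally show "\<bar>poly v t\<bar> \<le> ((real m + 1)\<^sup>2 * C') * \<omega> \<delta> * \<delta> ^ m" by (simp add: mult_ac)
    have "\<bar>coeff (pderiv v) i\<bar> \<le> real m * ?A" for i
      using abs_coeff_higher_pderiv_le[OF dv cv, of 1 i] by simp
    then have "\<bar>poly (pderiv v) t\<bar> \<le> real (m + 1) * (real m * ?A)"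
      using t dv by (intro abs_poly_le_coeffs) (auto simp: degree_pderiv)
    also have "\<dots> \<le> (real m + 1)\<^sup>2 * ?A"
    proof -
      have "real (m + 1) * real m * ?A \<le> (real m + 1)\<^sup>2 * ?A"
        by (rule mult_right_mono[OF _ A]) (simp add: power2_eq_square algebra_simps)
      then show ?thesis by (simp only: mult.assoc)
    qed
    finally show "\<bar>poly (pderiv v) t\<bar> \<le> ((real m + 1)\<^sup>2 * C') * \<omega> \<delta> * \<delta> ^ m" by (simp add: mult_ac)
  qed
  ultimately show ?thesis by (intro exI[of _ v]) (auto simp: v_def)
qed

end

lemma whitney_mono:
  assumes "modulus_of_continuity \<omega>" "whitney m \<omega> E F C" "C \<le> C'"
  shows "whitney m \<omega> E F C'"
  unfolding whitney_def
proof (intro ballI allI impI)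
  fix a b k assume *: "a \<in> E" "b \<in> E" "k \<le> m"
  then have "\<bar>F k b - tjet m F a k b\<bar> \<le> C * \<omega> \<bar>b - a\<bar> * \<bar>b - a\<bar> ^ (m - k)"
    using assms by (auto simp: whitney_def)
  also have "\<dots> \<le> C' * \<omega> \<bar>b - a\<bar> * \<bar>b - a\<bar> ^ (m - k)"
    using assms modulus_nonneg[OF assms(1)] by (intro mult_right_mono) auto
  finally show "\<bar>F k b - tjet m F a k b\<bar> \<le> C' * \<omega> \<bar>b - a\<bar> * \<bar>b - a\<bar> ^ (m - k)" .
qed

lemma area_cond_mono:
  assumes "modulus_of_continuity \<omega>" "area_cond m \<omega> E F G z C" "C \<le> C'"
  shows "area_cond m \<omega> E F G z C'"
  unfolding area_cond_def
proof (intro ballI impI)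
  fix a b assume *: "a \<in> E" "b \<in> E" "a < b"
  let ?v = "((b - a) ^ m)\<^sup>2 + (b - a) ^ m * speed (jetpoly m F a (b - a)) (jetpoly m G a (b - a))"
  have "\<bar>defect (jetpoly m F a (b - a)) (jetpoly m G a (b - a)) (z b - z a) (F 0 b) (G 0 b)\<bar>
     \<le> C * \<omega> (b - a) * ?v"
    using assms * by (auto simp: area_cond_def)
  also have "\<dots> \<le> C' * \<omega> (b - a) * ?v"
    using assms modulus_nonneg[OF assms(1)] * speed_nonneg by (intro mult_right_mono) auto
  finally show "\<bar>defect (jetpoly m F a (b - a)) (jetpoly m G a (b - a)) (z b - z a) (F 0 b) (G 0 b)\<bar>
     \<le> C' * \<omega> (b - a) * ?v" .
qed

text \<open>For the area condition at a < b, X is taken within \<open>b - a\<close> of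
  \<open>a\<close> and contains both points: the A/V bound then refers to the true values at
  \<open>a\<close> and \<open>b\<close>, while the Taylor polynomials at \<open>a\<close> differ
  from the limit jets only by an admissible perturbation. The same X serves both components.\<close>

lemma limit_point_data:
  assumes f: "interpolant_family m \<omega> K u \<phi> C" and g: "interpolant_family m \<omega> K v \<psi> C"
    and M: "M \<ge> 0" and K: "K \<subseteq> {-R..R}"
    and def: "\<And>X a b. X \<subseteq> K \<Longrightarrow> finite X \<Longrightarrow> card X = m + 2 \<Longrightarrow> a \<in> X \<Longrightarrow> b \<in> X \<Longrightarrow> a < b \<Longrightarrow>
      \<bar>defect (jetpoly m (\<lambda>k. (deriv ^^ k) (u X)) a (b - a)) (jetpoly m (\<lambda>k. (deriv ^^ k) (v X)) a (b - a))
         (z b - z a) (\<phi> b) (\<psi> b)\<bar>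
      \<le> M * \<omega> (b - a) * (((b - a) ^ m)\<^sup>2 + (b - a) ^ m *
         speed (jetpoly m (\<lambda>k. (deriv ^^ k) (u X)) a (b - a)) (jetpoly m (\<lambda>k. (deriv ^^ k) (v X)) a (b - a)))"
  shows "\<exists>F G C. C > 0 \<and> whitney m \<omega> {a \<in> K. a islimpt K} F C \<and> whitney m \<omega> {a \<in> K. a islimpt K} G C \<and>
     area_cond m \<omega> {a \<in> K. a islimpt K} F G z C \<and>
     (\<forall>a\<in>K. a islimpt K \<longrightarrow> F 0 a = \<phi> a \<and> G 0 a = \<psi> a)"
proof -
  interpret f: interpolant_family m \<omega> K u \<phi> C by fact
  interpret g: interpolant_family m \<omega> K v \<psi> C by fact
  let ?E = "{a \<in> K. a islimpt K}"
  obtain Cf where Cf: "Cf > 0" "whitney m \<omega> ?E f.jet Cf" using f.jet_whitney by blast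
  obtain Cg where Cg: "Cg > 0" "whitney m \<omega> ?E g.jet Cg" using g.jet_whitney by blast
  define k where "k = (real m + 1)\<^sup>2 * f.C'"
  have k: "k \<ge> 0" using f.C'_pos by (simp add: k_def)
  define W where "W = \<omega> (2 * R)"
  define c where "c = M + (M + 6 * k) * (1 + 2 * k * W) + 4 * k\<^sup>2 * W"
  have area: "\<bar>defect (jetpoly m f.jet a (b - a)) (jetpoly m g.jet a (b - a)) (z b - z a) (f.jet 0 b) (g.jet 0 b)\<bar>
     \<le> c * \<omega> (b - a) * (((b - a) ^ m)\<^sup>2 + (b - a) ^ m *
          speed (jetpoly m f.jet a (b - a)) (jetpoly m g.jet a (b - a)))"
    if a: "a \<in> K" "a islimpt K" and b: "b \<in> K" "b islimpt K" and ab: "a < b" for a b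
  proof -
    define \<delta> where "\<delta> = b - a"
    have "a \<in> {-R..R}" "b \<in> {-R..R}" using a b K by auto
    then have \<delta>: "\<delta> > 0" "\<delta> \<le> 2 * R" using ab by (auto simp: \<delta>_def)
    have "{a, b} \<subseteq> K \<inter> cball a \<delta>" using a b ab by (auto simp: \<delta>_def dist_real_def)
    then obtain X where X: "f.adm a \<delta> X" "a \<in> X" "b \<in> X"
      using exists_subset_near_limpt[OF a(2) \<delta>(1), of "{a, b}" "m + 2"] ab by (auto simp: f.adm_def)
    have Xg: "g.adm a \<delta> X" using X by (simp add: f.adm_def g.adm_def)
    obtain p where p: "jetpoly m f.jet a \<delta> = jetpoly m (\<lambda>k. (deriv ^^ k) (u X)) a \<delta> + p" "poly p 0 = 0"
      "\<And>t. t \<in> {0..1} \<Longrightarrow> \<bar>poly p t\<bar> \<le> k * \<omega> \<delta> * \<delta> ^ m \<and> \<bar>poly (pderiv p) t\<bar> \<le> k * \<omega> \<delta> * \<delta> ^ m"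
      using f.jetpoly_jet_approx[OF a \<delta>(1) X(1,2)] unfolding k_def by blast
    obtain q where q: "jetpoly m g.jet a \<delta> = jetpoly m (\<lambda>k. (deriv ^^ k) (v X)) a \<delta> + q" "poly q 0 = 0"
      "\<And>t. t \<in> {0..1} \<Longrightarrow> \<bar>poly q t\<bar> \<le> k * \<omega> \<delta> * \<delta> ^ m \<and> \<bar>poly (pderiv q) t\<bar> \<le> k * \<omega> \<delta> * \<delta> ^ m"
      using g.jetpoly_jet_approx[OF a \<delta>(1) Xg X(2)] unfolding k_def by blast
    define P where "P = jetpoly m (\<lambda>k. (deriv ^^ k) (u X)) a \<delta>"
    define Q where "Q = jetpoly m (\<lambda>k. (deriv ^^ k) (v X)) a \<delta>"
    have "\<bar>defect (P + p) (Q + q) (z b - z a) (\<phi> b) (\<psi> b)\<bar>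
      \<le> (M + (M + 6 * k) * (1 + 2 * k * W) + 4 * k\<^sup>2 * W) * \<omega> \<delta> * ((\<delta> ^ m)\<^sup>2 + \<delta> ^ m * speed (P + p) (Q + q))"
    proof (rule defect_transfer[OF p(2) _ _ q(2)])
      show "\<bar>defect P Q (z b - z a) (\<phi> b) (\<psi> b)\<bar> \<le> M * \<omega> \<delta> * ((\<delta> ^ m)\<^sup>2 + \<delta> ^ m * speed P Q)"
        using def[of X a b] f.admD[OF X(1)] X ab by (simp add: \<delta>_def P_def Q_def)
      show "\<omega> \<delta> \<le> W" unfolding W_def using \<delta> by (intro modulus_mono[OF f.modulus]) auto
    qed (use p q \<delta> M k modulus_nonneg[OF f.modulus] in auto)
    then show ?thesis using f.jet_0[OF b] g.jet_0[OF b] p(1) q(1)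
      by (simp only: \<delta>_def P_def Q_def c_def)
  qed
  define D where "D = Cf + Cg + \<bar>c\<bar>"
  have "whitney m \<omega> ?E f.jet D" "whitney m \<omega> ?E g.jet D"
    using Cf Cg whitney_mono[OF f.modulus] by (auto simp: D_def)
  moreover have "area_cond m \<omega> ?E f.jet g.jet z c"
    unfolding area_cond_def using area by blast
  then have "area_cond m \<omega> ?E f.jet g.jet z D"
    by (rule area_cond_mono[OF f.modulus]) (use Cf Cg in \<open>auto simp: D_def\<close>)
  ultimately show ?thesis using f.jet_0 g.jet_0 Cf Cg
    by (intro exI[of _ f.jet] exI[of _ g.jet] exI[of _ D]) (auto simp: D_def)
qed

section \<open>Crude bounds for jets over bounded sets\<close>

lemma tjet_crude_bound:
  assumes "\<And>k. k \<le> m \<Longrightarrow> \<bar>F k a\<bar> \<le> B" "\<bar>x - a\<bar> \<le> D" "D \<ge> 1" "k \<le> m"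
  shows "\<bar>tjet m F a k x\<bar> \<le> real (m + 1) * B * D ^ m"
proof -
  have B: "B \<ge> 0" using assms(1)[of 0] by linarith
  have "\<bar>tjet m F a k x\<bar> \<le> (\<Sum>j\<le>m - k. \<bar>F (k + j) a / fact j * (x - a) ^ j\<bar>)"
    unfolding tjet_def by (rule sum_abs)
  also have "\<dots> \<le> (\<Sum>j\<le>m - k. B * D ^ m)"
  proof (rule sum_mono)
    fix j assume j: "j \<in> {..m - k}"
    have "\<bar>F (k + j) a\<bar> / fact j \<le> \<bar>F (k + j) a\<bar> / 1" by (intro divide_left_mono) auto
    also have "\<dots> \<le> B" using assms(1)[of "k + j"] j assms(4) by auto
    finally have 1: "\<bar>F (k + j) a\<bar> / fact j \<le> B" .
    have "\<bar>x - a\<bar> ^ j \<le> D ^ j" using assms by (intro power_mono) auto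
    also have "\<dots> \<le> D ^ m" using assms j by (intro power_increasing) auto
    finally show "\<bar>F (k + j) a / fact j * (x - a) ^ j\<bar> \<le> B * D ^ m"
      using 1 B unfolding abs_mult abs_divide power_abs by (intro mult_mono) auto
  qed
  also have "\<dots> = real (m - k + 1) * (B * D ^ m)" by simp
  also have "\<dots> \<le> real (m + 1) * (B * D ^ m)" using B assms by (intro mult_right_mono) auto
  finally show ?thesis by (simp add: mult.assoc)
qed

lemma jetpoly_crude_bound:
  assumes B: "\<And>k. k \<le> m \<Longrightarrow> \<bar>F k a\<bar> \<le> B" and d: "0 \<le> d" "d \<le> D" "D \<ge> 1" and t: "t \<in> {0..1}"
  shows "\<bar>poly (jetpoly m F a d) t\<bar> \<le> (real m + 1)\<^sup>2 * B * D ^ m"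
    and "\<bar>poly (pderiv (jetpoly m F a d)) t\<bar> \<le> (real m + 1)\<^sup>2 * B * D ^ m"
proof -
  have B0: "B \<ge> 0" using B[of 0] by linarith
  let ?A = "B * D ^ m"
  have A: "?A \<ge> 0" using B0 d by simp
  have c: "\<bar>coeff (jetpoly m F a d) k\<bar> \<le> ?A" for k
  proof (cases "k \<le> m")
    case True
    have "d ^ k \<le> D ^ k" using d by (intro power_mono) auto
    also have "\<dots> \<le> D ^ m" using d True by (intro power_increasing) auto
    finally have "d ^ k * \<bar>F k a\<bar> \<le> D ^ m * B" using B[OF True] d by (intro mult_mono) auto
    moreover have "d ^ k * \<bar>F k a\<bar> / fact k \<le> d ^ k * \<bar>F k a\<bar> / 1" using d by (intro divide_left_mono) auto
    ultimately show ?thesis using True d by (simp add: coeff_jetpoly abs_mult mult.commute)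
  qed (use A in \<open>simp add: coeff_jetpoly\<close>)
  have "\<bar>poly (jetpoly m F a d) t\<bar> \<le> real (m + 1) * ?A"
    by (rule abs_poly_le_coeffs[OF degree_jetpoly c]) (use t in auto)
  also have "\<dots> \<le> (real m + 1)\<^sup>2 * ?A"
    by (rule mult_right_mono[OF _ A]) (simp add: power2_eq_square algebra_simps)
  finally show "\<bar>poly (jetpoly m F a d) t\<bar> \<le> (real m + 1)\<^sup>2 * B * D ^ m" by (simp add: mult.assoc)
  have "\<bar>coeff (pderiv (jetpoly m F a d)) i\<bar> \<le> real m * ?A" for i
    using abs_coeff_higher_pderiv_le[OF degree_jetpoly c, of 1 i] by simp
  then have "\<bar>poly (pderiv (jetpoly m F a d)) t\<bar> \<le> real (m + 1) * (real m * ?A)"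
    using t degree_jetpoly[of m F a d] by (intro abs_poly_le_coeffs) (auto simp: degree_pderiv)
  also have "\<dots> = real (m + 1) * real m * ?A" by simp
  also have "\<dots> \<le> (real m + 1)\<^sup>2 * ?A"
    by (rule mult_right_mono[OF _ A]) (simp add: power2_eq_square algebra_simps)
  finally show "\<bar>poly (pderiv (jetpoly m F a d)) t\<bar> \<le> (real m + 1)\<^sup>2 * B * D ^ m" by (simp add: mult.assoc)
qed

text \<open>The area term and each of the two correction terms contribute at most
  \<open>4 * L\<^sup>2\<close>.\<close>

lemma defect_crude_bound:
  assumes p: "\<And>t. t \<in> {0..1} \<Longrightarrow> \<bar>poly p t\<bar> \<le> L" "\<And>t. t \<in> {0..1} \<Longrightarrow> \<bar>poly (pderiv p) t\<bar> \<le> L"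
    and q: "\<And>t. t \<in> {0..1} \<Longrightarrow> \<bar>poly q t\<bar> \<le> L" "\<And>t. t \<in> {0..1} \<Longrightarrow> \<bar>poly (pderiv q) t\<bar> \<le> L"
    and y: "\<bar>y1\<bar> \<le> L" "\<bar>y2\<bar> \<le> L"
  shows "\<bar>defect p q z y1 y2 - z\<bar> \<le> 12 * L\<^sup>2" "speed p q \<le> 2 * L"
proof -
  have L: "L \<ge> 0" using y by linarith
  have "\<bar>pint (pderiv p * q)\<bar> \<le> L * L"
    by (rule order_trans[OF abs_pint_mult_le[OF p(2)]]) (use L q in \<open>auto intro!: mult_left_mono pabs_le\<close>)
  moreover have "\<bar>pint (p * pderiv q)\<bar> \<le> L * L"
    by (rule order_trans[OF abs_pint_mult_le[OF p(1)]]) (use L q in \<open>auto intro!: mult_left_mono pabs_le\<close>)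
  ultimately have "\<bar>area p q\<bar> \<le> 2 * L\<^sup>2" unfolding area_def pint_diff power2_eq_square by linarith
  moreover have "\<bar>poly p 0 * (y2 - poly q 1)\<bar> \<le> L * (2 * L)"
    unfolding abs_mult using p(1)[of 0] q(1)[of 1] y L by (intro mult_mono) auto
  moreover have "\<bar>poly q 0 * (y1 - poly p 1)\<bar> \<le> L * (2 * L)"
    unfolding abs_mult using q(1)[of 0] p(1)[of 1] y L by (intro mult_mono) auto
  ultimately show "\<bar>defect p q z y1 y2 - z\<bar> \<le> 12 * L\<^sup>2"
    unfolding defect_def power2_eq_square by linarith
  have "pabs (pderiv p) \<le> L" "pabs (pderiv q) \<le> L" using p q by (auto intro: pabs_le)
  then show "speed p q \<le> 2 * L" by (simp add: speed_def)
qed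

lemma defect_jetpoly_bound:
  assumes "\<And>k. k \<le> m \<Longrightarrow> \<bar>F k a\<bar> \<le> B" "\<And>k. k \<le> m \<Longrightarrow> \<bar>G k a\<bar> \<le> B" "\<bar>y1\<bar> \<le> B" "\<bar>y2\<bar> \<le> B"
    and d: "0 \<le> d" "d \<le> D" "D \<ge> 1" and L: "L = (real m + 1)\<^sup>2 * B * D ^ m"
  shows "\<bar>defect (jetpoly m F a d) (jetpoly m G a d) z y1 y2 - z\<bar> \<le> 12 * L\<^sup>2"
    and "speed (jetpoly m F a d) (jetpoly m G a d) \<le> 2 * L"
proof -
  have "1 * B * 1 \<le> (real m + 1)\<^sup>2 * B * D ^ m"
    using assms by (intro mult_mono one_le_power) auto
  then have y: "\<bar>y1\<bar> \<le> L" "\<bar>y2\<bar> \<le> L" using assms by auto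
  note F = jetpoly_crude_bound[where m = m and F = F and a = a, OF assms(1) d, folded L]
  note G = jetpoly_crude_bound[where m = m and F = G and a = a, OF assms(2) d, folded L]
  show "\<bar>defect (jetpoly m F a d) (jetpoly m G a d) z y1 y2 - z\<bar> \<le> 12 * L\<^sup>2"
    by (rule defect_crude_bound(1)[OF F(1) F(2) G(1) G(2) y]) auto
  show "speed (jetpoly m F a d) (jetpoly m G a d) \<le> 2 * L"
    by (rule defect_crude_bound(2)[OF F(1) F(2) G(1) G(2) y]) auto
qed

definition jet_bounded :: "nat \<Rightarrow> real set \<Rightarrow> (nat \<Rightarrow> real \<Rightarrow> real) \<Rightarrow> real \<Rightarrow> bool" where
  "jet_bounded m E F B \<longleftrightarrow> (\<forall>a\<in>E. \<forall>k\<le>m. \<bar>F k a\<bar> \<le> B)"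

text \<open>The jet at a single point, continued by its Taylor polynomial over the bounded set,
  determines all others up to the Whitney error.\<close>

lemma whitney_imp_bounded:
  assumes mod: "modulus_of_continuity \<omega>" and w: "whitney m \<omega> E F C" and C: "C > 0"
    and E: "E \<subseteq> {-R..R}" and R: "R \<ge> 1"
  shows "\<exists>B>0. jet_bounded m E F B"
proof (cases "E = {}")
  case True
  then show ?thesis by (intro exI[of _ 1]) (simp add: jet_bounded_def)
next
  case False
  then obtain a where a: "a \<in> E" by blast
  define B where "B = (\<Sum>k\<le>m. \<bar>F k a\<bar>)"
  have B: "\<bar>F k a\<bar> \<le> B" if "k \<le> m" for k
    unfolding B_def by (rule member_le_sum[where f = "\<lambda>k. \<bar>F k a\<bar>"]) (use that in auto)
  have B0: "B \<ge> 0" unfolding B_def by (rule sum_nonneg) simp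
  have pos: "C * \<omega> (2 * R) * (2 * R) ^ m > 0" using C R modulus_pos[OF mod, of "2 * R"] by simp
  have "\<bar>F k b\<bar> \<le> real (m + 1) * B * (2 * R) ^ m + C * \<omega> (2 * R) * (2 * R) ^ m"
    if b: "b \<in> E" and k: "k \<le> m" for b k
  proof -
    have ba: "\<bar>b - a\<bar> \<le> 2 * R"
    proof -
      have "a \<in> {-R..R}" "b \<in> {-R..R}" using a b E by auto
      then show ?thesis by (simp add: abs_le_iff)
    qed
    have "\<bar>F k b - tjet m F a k b\<bar> \<le> C * \<omega> \<bar>b - a\<bar> * \<bar>b - a\<bar> ^ (m - k)"
      using w a b k unfolding whitney_def by blast
    also have "\<dots> \<le> C * \<omega> (2 * R) * (2 * R) ^ m"
    proof (intro mult_mono)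
      have "\<bar>b - a\<bar> ^ (m - k) \<le> (2 * R) ^ (m - k)" using ba by (intro power_mono) auto
      also have "\<dots> \<le> (2 * R) ^ m" using R by (intro power_increasing) auto
      finally show "\<bar>b - a\<bar> ^ (m - k) \<le> (2 * R) ^ m" .
      show "\<omega> \<bar>b - a\<bar> \<le> \<omega> (2 * R)" by (rule modulus_mono[OF mod _ ba]) simp
    qed (use C R modulus_nonneg[OF mod] in auto)
    finally have "\<bar>F k b - tjet m F a k b\<bar> \<le> C * \<omega> (2 * R) * (2 * R) ^ m" .
    moreover have "\<bar>tjet m F a k b\<bar> \<le> real (m + 1) * B * (2 * R) ^ m"
      by (rule tjet_crude_bound[where F = F and a = a, OF B ba _ k]) (use R in auto)
    ultimately show ?thesis by linarith
  qed
  then show ?thesis using pos B0 R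
    by (intro exI[of _ "real (m + 1) * B * (2 * R) ^ m + C * \<omega> (2 * R) * (2 * R) ^ m"])
       (auto simp: jet_bounded_def intro!: add_nonneg_pos)
qed

lemma area_cond_imp_bounded:
  assumes mod: "modulus_of_continuity \<omega>" and ac: "area_cond m \<omega> E F G z C" and C: "C > 0"
    and E: "E \<subseteq> {-R..R}" and R: "R \<ge> 1" and F: "jet_bounded m E F B" and G: "jet_bounded m E G B"
    and B: "B > 0"
  shows "\<exists>D>0. \<forall>a\<in>E. \<bar>z a\<bar> \<le> D"
proof (cases "E = {}")
  case True
  then show ?thesis by (intro exI[of _ 1]) simp
next
  case False
  then obtain a0 where a0: "a0 \<in> E" by blast
  define L where "L = (real m + 1)\<^sup>2 * B * (2 * R) ^ m"
  have BL: "B \<le> L"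
  proof -
    have "1 * B * 1 \<le> (real m + 1)\<^sup>2 * B * (2 * R) ^ m"
      using R B by (intro mult_mono one_le_power) auto
    then show ?thesis by (simp add: L_def)
  qed
  define D where "D = C * \<omega> (2 * R) * (((2 * R) ^ m)\<^sup>2 + (2 * R) ^ m * (2 * L)) + 12 * L\<^sup>2"
  have zd: "\<bar>z b - z a\<bar> \<le> D" if a: "a \<in> E" and b: "b \<in> E" and ab: "a < b" for a b
  proof -
    let ?P = "jetpoly m F a (b - a)" and ?Q = "jetpoly m G a (b - a)"
    have d: "b - a \<le> 2 * R"
    proof -
      have "a \<in> {-R..R}" "b \<in> {-R..R}" using a b E by auto
      then show ?thesis by simp
    qed
    have Fb: "\<And>k. k \<le> m \<Longrightarrow> \<bar>F k a\<bar> \<le> B" "\<And>k. k \<le> m \<Longrightarrow> \<bar>G k a\<bar> \<le> B"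
      "\<bar>F 0 b\<bar> \<le> B" "\<bar>G 0 b\<bar> \<le> B"
      using F G a b by (auto simp: jet_bounded_def)
    have cb: "\<bar>defect ?P ?Q (z b - z a) (F 0 b) (G 0 b) - (z b - z a)\<bar> \<le> 12 * L\<^sup>2" "speed ?P ?Q \<le> 2 * L"
      by (rule defect_jetpoly_bound[OF _ _ _ _ _ d _ L_def]; use Fb ab R in simp)+
    have "\<bar>defect ?P ?Q (z b - z a) (F 0 b) (G 0 b)\<bar>
        \<le> C * \<omega> (b - a) * (((b - a) ^ m)\<^sup>2 + (b - a) ^ m * speed ?P ?Q)"
      using ac a b ab by (auto simp: area_cond_def)
    also have "\<dots> \<le> C * \<omega> (2 * R) * (((2 * R) ^ m)\<^sup>2 + (2 * R) ^ m * (2 * L))"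
      using C ab d cb speed_nonneg modulus_nonneg[OF mod] R B BL
      by (intro mult_mono add_mono power_mono modulus_mono[OF mod]) auto
    finally show ?thesis using cb by (simp add: D_def)
  qed
  have "\<bar>z a\<bar> \<le> \<bar>z a0\<bar> + \<bar>D\<bar> + 1" if "a \<in> E" for a
  proof (cases a a0 rule: linorder_cases)
    case less
    then show ?thesis using zd[OF that a0] by linarith
  next
    case greater
    then show ?thesis using zd[OF a0 that] by linarith
  qed simp
  then show ?thesis by (intro exI[of _ "\<bar>z a0\<bar> + \<bar>D\<bar> + 1"]) auto
qed

section \<open>Adding isolated points\<close>

lemma whitney_cong:
  assumes "\<And>a k. a \<in> E \<Longrightarrow> F k a = F' k a"
  shows "whitney m \<omega> E F C \<longleftrightarrow> whitney m \<omega> E F' C"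
  unfolding whitney_def tjet_def using assms by simp

lemma area_cond_cong:
  assumes "\<And>a k. a \<in> E \<Longrightarrow> F k a = F' k a" "\<And>a k. a \<in> E \<Longrightarrow> G k a = G' k a"
  shows "area_cond m \<omega> E F G z C \<longleftrightarrow> area_cond m \<omega> E F' G' z C"
  unfolding area_cond_def jetpoly_def using assms by simp

lemma whitney_insert:
  assumes mod: "modulus_of_continuity \<omega>" and w: "whitney m \<omega> E F C"
    and bd: "jet_bounded m (insert s E) F B" and sub: "insert s E \<subseteq> {-R..R}" and R: "R \<ge> 1"
    and \<eta>: "0 < \<eta>" "\<eta> \<le> 1" "\<And>a. a \<in> E \<Longrightarrow> \<eta> \<le> \<bar>s - a\<bar>"
  shows "\<exists>C'>0. whitney m \<omega> (insert s E) F C'"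
proof -
  define B1 where "B1 = B + real (m + 1) * B * (2 * R) ^ m"
  have B: "B \<ge> 0" using bd by (force simp: jet_bounded_def)
  \<comment> \<open>A lower bound for the right-hand factor at distance at least
    \<open>\<eta>\<close>, the same for all orders: \<open>\<eta> \<le> 1\<close> makes
    \<open>\<eta> ^ m\<close> the smallest of the powers \<open>\<eta> ^ (m - k)\<close>.\<close>
  define e where "e = \<omega> \<eta> * \<eta> ^ m"
  have e: "e > 0" using modulus_pos[OF mod] \<eta> by (simp add: e_def)
  define C' where "C' = \<bar>C\<bar> + B1 / e + 1"
  have "B1 \<ge> 0" using B R by (simp add: B1_def)
  then have "B1 / e \<ge> 0" using e by simp
  then have C': "C' > 0" "C \<le> C'" "B1 / e \<le> C'" unfolding C'_def by linarith+
  have "\<bar>F k b - tjet m F a k b\<bar> \<le> C' * \<omega> \<bar>b - a\<bar> * \<bar>b - a\<bar> ^ (m - k)"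
    if a: "a \<in> insert s E" and b: "b \<in> insert s E" and k: "k \<le> m" for a b k
  proof -
    consider "a = b" | "a \<in> E" "b \<in> E" | "\<eta> \<le> \<bar>b - a\<bar>" using a b \<eta>(3) by (metis abs_minus_commute insertE)
    then show ?thesis
    proof cases
      case 1
      then show ?thesis using mod by (simp add: tjet_base modulus_of_continuity_def)
    next
      case 2
      then show ?thesis using whitney_mono[OF mod w C'(2)] k by (simp add: whitney_def)
    next
      case 3
      have "a \<in> {-R..R}" "b \<in> {-R..R}" using a b sub by auto
      then have d: "\<bar>b - a\<bar> \<le> 2 * R" by (simp add: abs_le_iff)
      have "\<bar>tjet m F a k b\<bar> \<le> real (m + 1) * B * (2 * R) ^ m"
        by (rule tjet_crude_bound[where F = F and a = a and B = B, OF _ d _ k]) (use bd a R in \<open>auto simp: jet_bounded_def\<close>)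
      moreover have "\<bar>F k b\<bar> \<le> B" using bd b k by (auto simp: jet_bounded_def)
      ultimately have "\<bar>F k b - tjet m F a k b\<bar> \<le> B1" unfolding B1_def by linarith
      also have "\<dots> = B1 / e * e" using e by simp
      also have "\<dots> \<le> C' * (\<omega> \<bar>b - a\<bar> * \<bar>b - a\<bar> ^ (m - k))"
      proof (intro mult_mono C'(3))
        have "\<eta> ^ m \<le> \<eta> ^ (m - k)" using \<eta> by (intro power_decreasing) auto
        also have "\<dots> \<le> \<bar>b - a\<bar> ^ (m - k)" using \<eta> 3 by (intro power_mono) auto
        finally show "e \<le> \<omega> \<bar>b - a\<bar> * \<bar>b - a\<bar> ^ (m - k)"
          unfolding e_def using 3 \<eta> modulus_nonneg[OF mod] by (intro mult_mono modulus_mono[OF mod]) auto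
      qed (use C' e in auto)
      finally show ?thesis by (simp add: mult.assoc)
    qed
  qed
  then show ?thesis unfolding whitney_def using C'(1) by blast
qed

lemma area_cond_insert:
  assumes mod: "modulus_of_continuity \<omega>" and ac: "area_cond m \<omega> E F G z C"
    and bd: "jet_bounded m (insert s E) F B" "jet_bounded m (insert s E) G B"
    and D: "\<And>a. a \<in> insert s E \<Longrightarrow> \<bar>z a\<bar> \<le> D"
    and sub: "insert s E \<subseteq> {-R..R}" and R: "R \<ge> 1"
    and \<eta>: "0 < \<eta>" "\<eta> \<le> 1" "\<And>a. a \<in> E \<Longrightarrow> \<eta> \<le> \<bar>s - a\<bar>"
  shows "\<exists>C'>0. area_cond m \<omega> (insert s E) F G z C'"
proof -
  define L where "L = (real m + 1)\<^sup>2 * B * (2 * R) ^ m"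
  define B1 where "B1 = 2 * D + 12 * L\<^sup>2"
  have D0: "D \<ge> 0" using D[of s] by simp
  define e where "e = \<omega> \<eta> * (\<eta> ^ m)\<^sup>2"
  have e: "e > 0" using modulus_pos[OF mod] \<eta> by (simp add: e_def)
  define C' where "C' = \<bar>C\<bar> + B1 / e + 1"
  have "B1 \<ge> 0" using D0 by (simp add: B1_def)
  then have "B1 / e \<ge> 0" using e by simp
  then have C': "C' > 0" "C \<le> C'" "B1 / e \<le> C'" unfolding C'_def by linarith+
  have "\<bar>defect (jetpoly m F a (b - a)) (jetpoly m G a (b - a)) (z b - z a) (F 0 b) (G 0 b)\<bar>
     \<le> C' * \<omega> (b - a) * (((b - a) ^ m)\<^sup>2 + (b - a) ^ m *
          speed (jetpoly m F a (b - a)) (jetpoly m G a (b - a)))"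
    if a: "a \<in> insert s E" and b: "b \<in> insert s E" and ab: "a < b" for a b
  proof (cases "a \<in> E \<and> b \<in> E")
    case True
    then show ?thesis using area_cond_mono[OF mod ac C'(2)] ab by (simp add: area_cond_def)
  next
    case False
    then have d\<eta>: "\<eta> \<le> b - a" using a b ab \<eta>(3) by force
    have "a \<in> {-R..R}" "b \<in> {-R..R}" using a b sub by auto
    then have d: "b - a \<le> 2 * R" by simp
    let ?S = "speed (jetpoly m F a (b - a)) (jetpoly m G a (b - a))"
    let ?d = "defect (jetpoly m F a (b - a)) (jetpoly m G a (b - a)) (z b - z a) (F 0 b) (G 0 b)"
    have "\<bar>?d - (z b - z a)\<bar> \<le> 12 * L\<^sup>2"
      by (rule defect_jetpoly_bound(1)[OF _ _ _ _ _ d _ L_def])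
        (use bd a b ab R in \<open>auto simp: jet_bounded_def\<close>)
    then have "\<bar>?d\<bar> \<le> B1" using D[OF a] D[OF b] unfolding B1_def by linarith
    also have "\<dots> = B1 / e * e" using e by simp
    also have "\<dots> \<le> C' * (\<omega> (b - a) * (((b - a) ^ m)\<^sup>2 + (b - a) ^ m * ?S))"
    proof (intro mult_mono C'(3))
      have "(\<eta> ^ m)\<^sup>2 \<le> ((b - a) ^ m)\<^sup>2" using \<eta> d\<eta> by (intro power_mono) auto
      also have "\<dots> \<le> ((b - a) ^ m)\<^sup>2 + (b - a) ^ m * ?S" using ab speed_nonneg by simp
      finally show "e \<le> \<omega> (b - a) * (((b - a) ^ m)\<^sup>2 + (b - a) ^ m * ?S)"
        unfolding e_def using d\<eta> \<eta> modulus_nonneg[OF mod] by (intro mult_mono modulus_mono[OF mod]) auto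
    qed (use C' e in auto)
    finally show ?thesis by (simp add: mult.assoc)
  qed
  then show ?thesis unfolding area_cond_def using C'(1) by blast
qed

definition field_data where
  "field_data m \<omega> E F G z C \<longleftrightarrow> C > 0 \<and> whitney m \<omega> E F C \<and> whitney m \<omega> E G C \<and> area_cond m \<omega> E F G z C"

text \<open>At an isolated point the jets are free; all conditions against points at distance at least
  \<eta> hold after enlarging the constant, since V is at least the 2m-th power of the distance.\<close>

lemma field_data_add_isolated:
  assumes mod: "modulus_of_continuity \<omega>" and fd: "field_data m \<omega> E F G z C"
    and E: "closed E" "s \<notin> E" and sub: "insert s E \<subseteq> {-R..R}" and R: "R \<ge> 1"
  shows "\<exists>C'. field_data m \<omega> (insert s E) (\<lambda>k x. if x = s then if k = 0 then y1 else 0 else F k x)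
     (\<lambda>k x. if x = s then if k = 0 then y2 else 0 else G k x) z C'"
proof -
  have C: "C > 0" "whitney m \<omega> E F C" "whitney m \<omega> E G C" "area_cond m \<omega> E F G z C"
    using fd by (auto simp: field_data_def)
  let ?F = "\<lambda>k x. if x = s then if k = 0 then y1 else 0 else F k x"
  let ?G = "\<lambda>k x. if x = s then if k = 0 then y2 else 0 else G k x"
  have cF: "\<And>a k. a \<in> E \<Longrightarrow> F k a = ?F k a" and cG: "\<And>a k. a \<in> E \<Longrightarrow> G k a = ?G k a" using E by auto
  have subE: "E \<subseteq> {-R..R}" using sub by auto
  obtain B1 where B1: "B1 > 0" "jet_bounded m E F B1" using whitney_imp_bounded[OF mod C(2,1) subE R] by blast
  obtain B2 where B2: "B2 > 0" "jet_bounded m E G B2" using whitney_imp_bounded[OF mod C(3,1) subE R] by blast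
  have "\<exists>D>0. \<forall>a\<in>E. \<bar>z a\<bar> \<le> D"
    by (rule area_cond_imp_bounded[OF mod C(4,1) subE R, of "B1 + B2"])
      (use B1 B2 in \<open>force simp: jet_bounded_def\<close>)+
  then obtain D where D: "D > 0" "\<And>a. a \<in> E \<Longrightarrow> \<bar>z a\<bar> \<le> D" by blast
  define B where "B = B1 + B2 + \<bar>y1\<bar> + \<bar>y2\<bar>"
  have bd: "jet_bounded m (insert s E) ?F B" "jet_bounded m (insert s E) ?G B"
    using B1 B2 unfolding jet_bounded_def B_def by force+
  obtain r where r: "r > 0" "ball s r \<subseteq> - E"
    using E openE[of "- E" s] by (auto simp: open_Compl)
  define \<eta> where "\<eta> = min r 1"
  have \<eta>: "0 < \<eta>" "\<eta> \<le> 1" using r by (auto simp: \<eta>_def)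
  have \<eta>s: "\<eta> \<le> \<bar>s - a\<bar>" if "a \<in> E" for a
  proof -
    have "a \<notin> ball s r" using r that by auto
    then show ?thesis by (simp add: \<eta>_def dist_real_def)
  qed
  have "whitney m \<omega> E ?F C" using whitney_cong[of E F ?F, OF cF] C by simp
  from whitney_insert[OF mod this bd(1) sub R \<eta> \<eta>s]
  obtain C1 where C1: "C1 > 0" "whitney m \<omega> (insert s E) ?F C1" by blast
  have "whitney m \<omega> E ?G C" using whitney_cong[of E G ?G, OF cG] C by simp
  from whitney_insert[OF mod this bd(2) sub R \<eta> \<eta>s]
  obtain C2 where C2: "C2 > 0" "whitney m \<omega> (insert s E) ?G C2" by blast
  have "area_cond m \<omega> E ?F ?G z C" using area_cond_cong[of E F ?F G ?G, OF cF cG] C by simp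
  moreover have "\<bar>z a\<bar> \<le> D + \<bar>z s\<bar>" if "a \<in> insert s E" for a using that D by force
  ultimately obtain C3 where C3: "C3 > 0" "area_cond m \<omega> (insert s E) ?F ?G z C3"
    using area_cond_insert[OF mod _ bd _ sub R \<eta> \<eta>s] by blast
  have "field_data m \<omega> (insert s E) ?F ?G z (C1 + C2 + C3)"
    unfolding field_data_def
  proof (intro conjI)
    show "whitney m \<omega> (insert s E) ?F (C1 + C2 + C3)"
      by (rule whitney_mono[OF mod C1(2)]) (use C2 C3 in auto)
    show "whitney m \<omega> (insert s E) ?G (C1 + C2 + C3)"
      by (rule whitney_mono[OF mod C2(2)]) (use C1 C3 in auto)
    show "area_cond m \<omega> (insert s E) ?F ?G z (C1 + C2 + C3)"
      by (rule area_cond_mono[OF mod C3(2)]) (use C1 C2 in auto)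
  qed (use C1 C2 C3 in auto)
  then show ?thesis by blast
qed

text \<open>The vanishing of the higher jets on S is recorded for the two artificial end points,
  where the extension has to join constants smoothly.\<close>

lemma field_data_add_finite:
  assumes mod: "modulus_of_continuity \<omega>" and fd: "field_data m \<omega> E F G z C"
    and E: "closed E" "E \<inter> S = {}" "finite S" and sub: "E \<union> S \<subseteq> {-R..R}" and R: "R \<ge> 1"
    and val: "\<And>a. a \<in> E \<Longrightarrow> F 0 a = \<phi> a \<and> G 0 a = \<psi> a"
  shows "\<exists>F G C. field_data m \<omega> (E \<union> S) F G z C \<and> (\<forall>a\<in>E \<union> S. F 0 a = \<phi> a \<and> G 0 a = \<psi> a) \<and>
     (\<forall>a\<in>S. \<forall>k>0. F k a = 0 \<and> G k a = 0)"
  using E(3,2) sub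
proof (induction S rule: finite_induct)
  case empty
  then show ?case using fd val by auto
next
  case (insert s S)
  obtain F G C where fd: "field_data m \<omega> (E \<union> S) F G z C" "\<forall>a\<in>E \<union> S. F 0 a = \<phi> a \<and> G 0 a = \<psi> a"
     "\<forall>a\<in>S. \<forall>k>0. F k a = 0 \<and> G k a = 0" using insert by auto
  have cl: "closed (E \<union> S)" using E insert by (auto intro: finite_imp_closed)
  have "s \<notin> E \<union> S" using insert by auto
  then show ?case
    using field_data_add_isolated[OF mod fd(1) cl _ _ R, of s "\<phi> s" "\<psi> s"] insert.prems fd(2,3) insert.hyps(2)
    by (simp add: Un_insert_right) (smt (verit) neq0_conv)
qed

section \<open>Extension from jets and gap polynomials\<close>

lemma has_derivative_of_small_error:
  fixes g :: "real \<Rightarrow> real"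
  assumes "\<And>e. e > 0 \<Longrightarrow> \<exists>d>0. \<forall>y. \<bar>y - a\<bar> < d \<longrightarrow> \<bar>g y - g a - D * (y - a)\<bar> \<le> e * \<bar>y - a\<bar>"
  shows "(g has_real_derivative D) (at a)"
  unfolding has_field_derivative_def has_derivative_at_alt
  using assms by (auto intro: bounded_linear_mult_right)

lemma continuous_of_modulus:
  fixes u :: "real \<Rightarrow> real"
  assumes mod: "modulus_of_continuity \<rho>" and C: "C > 0"
    and u: "\<And>x y. \<bar>u x - u y\<bar> \<le> C * \<rho> \<bar>x - y\<bar>"
  shows "continuous_on UNIV u"
  unfolding continuous_on_iff
proof (intro ballI allI impI)
  fix x e :: real assume e: "e > 0"
  obtain d where d: "d > 0" "\<And>t. 0 \<le> t \<Longrightarrow> t < d \<Longrightarrow> \<rho> t < e / C"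
    using modulus_small[OF mod, of "e / C"] e C by auto
  have "dist (u y) (u x) < e" if "dist y x < d" for y
  proof -
    have "\<bar>u y - u x\<bar> \<le> C * \<rho> \<bar>y - x\<bar>" by (rule u)
    also have "\<dots> < C * (e / C)" using d(2)[of "\<bar>y - x\<bar>"] that C by (intro mult_strict_left_mono) (auto simp: dist_real_def)
    finally show ?thesis using C by (simp add: dist_real_def)
  qed
  then show "\<exists>d>0. \<forall>y\<in>UNIV. dist y x < d \<longrightarrow> dist (u y) (u x) < e" using d(1) by auto
qed

text \<open>\<open>gp x\<close> is the polynomial used on the component of the complement of E that
  contains x. The condition \<open>gp_top\<close> bounds the change of the derivative of order m
  over any piece of a gap by the modulus of the length of that piece; its product form covers
  \<open>x = c\<close>.\<close>

locale jet_extension =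
  fixes m :: nat and E :: "real set" and F :: "nat \<Rightarrow> real \<Rightarrow> real"
    and gp :: "real \<Rightarrow> real poly" and \<rho> :: "real \<Rightarrow> real" and C :: real
  assumes E_closed: "closed E"
    and modulus: "modulus_of_continuity \<rho>"
    and C_pos: "C > 0"
    and gp_const: "\<And>x y. closed_segment x y \<inter> E = {} \<Longrightarrow> gp x = gp y"
    and gp_jet: "\<And>a x k. a \<in> E \<Longrightarrow> x \<notin> E \<Longrightarrow> open_segment a x \<inter> E = {} \<Longrightarrow> k \<le> m \<Longrightarrow>
        poly ((pderiv ^^ k) (gp x)) a = F k a"
    and gp_top: "\<And>c x y. x \<notin> E \<Longrightarrow> open_segment c x \<inter> E = {} \<Longrightarrow> y \<in> closed_segment c x \<Longrightarrow>
        \<bar>poly ((pderiv ^^ Suc m) (gp x)) y\<bar> * \<bar>x - c\<bar> \<le> C * \<rho> \<bar>x - c\<bar>"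
    and wh: "whitney m \<rho> E F C"
begin

definition ext :: "nat \<Rightarrow> real \<Rightarrow> real" where
  "ext k x = (if x \<in> E then F k x else poly ((pderiv ^^ k) (gp x)) x)"

lemma top_increment:
  assumes "x \<notin> E" "open_segment c x \<inter> E = {}" "y \<in> closed_segment c x"
  shows "\<bar>poly ((pderiv ^^ m) (gp x)) y - poly ((pderiv ^^ m) (gp x)) c\<bar> \<le> C * \<rho> \<bar>x - c\<bar>"
proof (cases "x = c")
  case True
  then show ?thesis using assms modulus by (simp add: modulus_of_continuity_def)
next
  case False
  then have xc: "\<bar>x - c\<bar> > 0" by simp
  define B where "B = C * \<rho> \<bar>x - c\<bar> / \<bar>x - c\<bar>"
  have B: "B \<ge> 0" using C_pos modulus_nonneg[OF modulus, of "\<bar>x - c\<bar>"] by (simp add: B_def)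
  have "norm (poly ((pderiv ^^ m) (gp x)) y - poly ((pderiv ^^ m) (gp x)) c) \<le> B * norm (y - c)"
  proof (rule field_differentiable_bound[of "closed_segment c x"])
    show "(poly ((pderiv ^^ m) (gp x)) has_real_derivative poly ((pderiv ^^ Suc m) (gp x)) z) (at z within closed_segment c x)" for z
      using poly_chain_derivative by (rule DERIV_subset) simp
    show "norm (poly ((pderiv ^^ Suc m) (gp x)) z) \<le> B" if "z \<in> closed_segment c x" for z
      using gp_top[OF assms(1,2) that] xc by (simp add: B_def pos_le_divide_eq)
  qed (use assms in auto)
  also have "\<dots> \<le> B * \<bar>x - c\<bar>"
    using B assms(3) by (intro mult_left_mono) (auto simp: closed_segment_eq_real_ivl split: if_splits)
  also have "\<dots> = C * \<rho> \<bar>x - c\<bar>" using xc by (simp add: B_def)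
  finally show ?thesis by simp
qed

definition C1 :: real where "C1 = real (m + 1) * (2 * C)"

lemma C1_pos: "C1 > 0" using C_pos by (simp add: C1_def)

lemma C_le_C1: "C \<le> C1"
proof -
  have "1 * C \<le> real (m + 1) * (2 * C)" using C_pos by (intro mult_mono) auto
  then show ?thesis by (simp add: C1_def)
qed

text \<open>Off E, let \<open>c\<close> be the point of E nearest to x on the segment from
  \<open>a\<close>. Whitney's condition compares the jets of \<open>a\<close> and \<open>c\<close>;
  from \<open>c\<close> to x the difference of two polynomials is integrated up. Each of the two
  steps costs one C, and the integration the factor m + 1.\<close>

lemma ext_taylor:
  assumes a: "a \<in> E" and k: "k \<le> m"
  shows "\<bar>ext k x - tjet m F a k x\<bar> \<le> C1 * \<rho> \<bar>x - a\<bar> * \<bar>x - a\<bar> ^ (m - k)"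
proof (cases "x \<in> E")
  case True
  then show ?thesis using whitney_mono[OF modulus wh C_le_C1] a k by (simp add: whitney_def ext_def)
next
  case False
  have "compact (E \<inter> closed_segment a x)" using E_closed by (simp add: closed_Int_compact)
  then obtain c where c: "c \<in> E \<inter> closed_segment a x" "\<And>y. y \<in> E \<inter> closed_segment a x \<Longrightarrow> dist x c \<le> dist x y"
    using distance_attains_inf[of "E \<inter> closed_segment a x" x] a compact_imp_closed by auto
  have cx: "open_segment c x \<inter> E = {}"
  proof (rule ccontr)
    assume "open_segment c x \<inter> E \<noteq> {}"
    then obtain y where y: "y \<in> open_segment c x" "y \<in> E" by blast
    then have "y \<in> closed_segment a x" "dist x y < dist x c"
      using c(1) by (auto simp: open_segment_eq_real_ivl closed_segment_eq_real_ivl dist_real_def split: if_splits)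
    then show False using c(2)[of y] y by simp
  qed
  define s where "s = \<bar>x - a\<bar>"
  have cs: "\<bar>c - a\<bar> \<le> s" "\<bar>x - c\<bar> \<le> s"
    using c(1) by (auto simp: s_def closed_segment_eq_real_ivl split: if_splits)
  have \<rho>s: "\<rho> s \<ge> 0" using modulus_nonneg[OF modulus] by (simp add: s_def)
  define w where "w = (\<lambda>k y. poly ((pderiv ^^ k) (gp x)) y - tjet m F a k y)"
  have wc: "\<bar>w k c\<bar> \<le> C * \<rho> s * s ^ (m - k)" if "k \<le> m" for k
  proof -
    have "\<bar>w k c\<bar> = \<bar>F k c - tjet m F a k c\<bar>" using gp_jet[OF _ False cx that] c by (simp add: w_def)
    also have "\<dots> \<le> C * \<rho> \<bar>c - a\<bar> * \<bar>c - a\<bar> ^ (m - k)" using wh a c that by (auto simp: whitney_def)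
    also have "\<dots> \<le> C * \<rho> s * s ^ (m - k)"
      using C_pos cs modulus_nonneg[OF modulus] by (intro mult_mono power_mono modulus_mono[OF modulus]) auto
    finally show ?thesis .
  qed
  have "\<bar>w k x\<bar> \<le> real (m - k + 1) * (2 * C * \<rho> s) * s ^ (m - k)"
  proof (rule derivative_chain_bound[where u = w and c = c and x = x])
    show "(w k has_real_derivative w (Suc k) y) (at y)" if "k < m" for k y
      unfolding w_def using that by (intro DERIV_diff poly_chain_derivative tjet_has_derivative)
    show "\<bar>w m y\<bar> \<le> 2 * C * \<rho> s" if y: "y \<in> closed_segment c x" for y
    proof -
      have "\<bar>w m y - w m c\<bar> \<le> C * \<rho> \<bar>x - c\<bar>"
        using top_increment[OF False cx y] by (simp add: w_def tjet_top)
      also have "\<dots> \<le> C * \<rho> s" using C_pos cs by (intro mult_left_mono modulus_mono[OF modulus]) auto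
      finally show ?thesis using wc[of m] by simp
    qed
    show "\<bar>w k c\<bar> \<le> 2 * C * \<rho> s * s ^ (m - k)" if "k < m" for k
    proof -
      have "0 \<le> C * \<rho> s * s ^ (m - k)" using C_pos \<rho>s by (simp add: s_def)
      then show ?thesis using wc[of k] that by linarith
    qed
  qed (use cs k in auto)
  also have "\<dots> \<le> real (m + 1) * (2 * C * \<rho> s) * s ^ (m - k)"
    using C_pos \<rho>s by (intro mult_right_mono) (auto simp: s_def)
  finally show ?thesis using False by (simp add: w_def ext_def C1_def s_def algebra_simps)
qed

text \<open>Either no point of E lies between x and y, and both values come from the same
  polynomial, or the comparison goes through such a point.\<close>

lemma ext_top_holder: "\<bar>ext m x - ext m y\<bar> \<le> 2 * C1 * \<rho> \<bar>x - y\<bar>"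
proof (cases "closed_segment x y \<inter> E = {}")
  case True
  then have "x \<notin> E" "y \<notin> E" "gp x = gp y" by (auto intro: gp_const)
  moreover have "open_segment y x \<inter> E = {}" using True open_closed_segment closed_segment_commute by fastforce
  ultimately have "\<bar>ext m x - ext m y\<bar> \<le> C * \<rho> \<bar>x - y\<bar>"
    using top_increment[of x y x] by (simp add: ext_def)
  also have "\<dots> \<le> 2 * C1 * \<rho> \<bar>x - y\<bar>"
    using C_le_C1 C1_pos modulus_nonneg[OF modulus] by (intro mult_right_mono) auto
  finally show ?thesis .
next
  case False
  then obtain a where a: "a \<in> E" "a \<in> closed_segment x y" by blast
  have d: "\<bar>x - a\<bar> \<le> \<bar>x - y\<bar>" "\<bar>y - a\<bar> \<le> \<bar>x - y\<bar>"
    using a(2) by (auto simp: closed_segment_eq_real_ivl split: if_splits)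
  have "\<bar>ext m x - F m a\<bar> \<le> C1 * \<rho> \<bar>x - a\<bar>" "\<bar>ext m y - F m a\<bar> \<le> C1 * \<rho> \<bar>y - a\<bar>"
    using ext_taylor[OF a(1), of m] by (auto simp: tjet_top)
  moreover have "C1 * \<rho> \<bar>x - a\<bar> \<le> C1 * \<rho> \<bar>x - y\<bar>" "C1 * \<rho> \<bar>y - a\<bar> \<le> C1 * \<rho> \<bar>x - y\<bar>"
    using d C1_pos by (auto intro!: mult_left_mono modulus_mono[OF modulus])
  ultimately show ?thesis by linarith
qed

text \<open>At a point of E subtract its Taylor polynomial: by \<open>ext_taylor\<close> the rest is
  of order rho times a power of the distance with exponent at least 1, so its derivative vanishes.
  This handles points of E that are approached by gaps and by other points of E at once.\<close>

lemma ext_has_derivative: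
  assumes k: "k < m"
  shows "(ext k has_real_derivative ext (Suc k) x) (at x)"
proof (cases "x \<in> E")
  case True
  define g where "g = (\<lambda>y. ext k y - tjet m F x k y)"
  have "(g has_real_derivative 0) (at x)"
  proof (rule has_derivative_of_small_error)
    fix e :: real assume e: "e > 0"
    obtain d where d: "d > 0" "\<And>t. 0 \<le> t \<Longrightarrow> t < d \<Longrightarrow> \<rho> t < e / C1"
      using modulus_small[OF modulus, of "e / C1"] e C1_pos by auto
    have "\<bar>g y - g x - 0 * (y - x)\<bar> \<le> e * \<bar>y - x\<bar>" if y: "\<bar>y - x\<bar> < min d 1" for y
    proof -
      obtain j where j: "m - k = Suc j" using k by (metis Suc_diff_Suc)
      have "g x = 0" using True by (simp add: g_def ext_def tjet_base)
      then have "\<bar>g y - g x - 0 * (y - x)\<bar> \<le> C1 * \<rho> \<bar>y - x\<bar> * \<bar>y - x\<bar> ^ (m - k)"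
        using ext_taylor[OF True, of k y] k by (simp add: g_def)
      also have "\<dots> \<le> C1 * (e / C1) * \<bar>y - x\<bar>"
      proof (rule mult_mono)
        show "C1 * \<rho> \<bar>y - x\<bar> \<le> C1 * (e / C1)"
          using C1_pos y d(2)[of "\<bar>y - x\<bar>"] by (intro mult_left_mono) auto
        have "\<bar>y - x\<bar> * \<bar>y - x\<bar> ^ j \<le> \<bar>y - x\<bar> * 1"
          using y by (intro mult_left_mono power_le_one) auto
        then show "\<bar>y - x\<bar> ^ (m - k) \<le> \<bar>y - x\<bar>" by (simp add: j)
      qed (use C1_pos e in auto)
      finally show ?thesis using C1_pos by simp
    qed
    then show "\<exists>d>0. \<forall>y. \<bar>y - x\<bar> < d \<longrightarrow> \<bar>g y - g x - 0 * (y - x)\<bar> \<le> e * \<bar>y - x\<bar>"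
      using d(1) by (intro exI[of _ "min d 1"]) auto
  qed
  then have "((\<lambda>y. g y + tjet m F x k y) has_real_derivative 0 + tjet m F x (Suc k) x) (at x)"
    by (intro DERIV_add tjet_has_derivative k)
  moreover have "(\<lambda>y. g y + tjet m F x k y) = ext k" by (simp add: g_def)
  moreover have "0 + tjet m F x (Suc k) x = ext (Suc k) x" using True by (simp add: tjet_base ext_def)
  ultimately show ?thesis by simp
next
  case False
  then obtain r where r: "r > 0" "ball x r \<subseteq> - E"
    using E_closed openE[of "- E" x] by (auto simp: open_Compl)
  show ?thesis
  proof (rule has_field_derivative_transform_within_open[where S = "ball x r"])
    show "(poly ((pderiv ^^ k) (gp x)) has_real_derivative ext (Suc k) x) (at x)"
      using poly_chain_derivative[of k "gp x" x] False by (simp add: ext_def)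
    show "poly ((pderiv ^^ k) (gp x)) y = ext k y" if "y \<in> ball x r" for y
    proof -
      have "closed_segment x y \<subseteq> ball x r" using that r(1) by (intro closed_segment_subset) auto
      then have "closed_segment x y \<inter> E = {}" using r(2) by blast
      then have "gp x = gp y" "y \<notin> E" by (auto intro: gp_const)
      then show ?thesis by (simp add: ext_def)
    qed
  qed (use r in auto)
qed

lemma ext_continuous: "k \<le> m \<Longrightarrow> continuous_on UNIV (ext k)"
proof (cases "k = m")
  case True
  then show ?thesis using continuous_of_modulus[OF modulus _ ext_top_holder] C1_pos by simp
next
  case False
  assume "k \<le> m"
  then have "k < m" using False by simp
  then show ?thesis
    using ext_has_derivative by (meson DERIV_continuous continuous_at_imp_continuous_on)
qed

end

section \<open>The algebra of bounded Hoelder functions and their derivatives\<close>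

definition holder_bounded :: "(real \<Rightarrow> real) \<Rightarrow> (real \<Rightarrow> real) \<Rightarrow> bool" where
  "holder_bounded \<rho> u \<longleftrightarrow> (\<exists>C. (\<forall>x. \<bar>u x\<bar> \<le> C) \<and> (\<forall>x y. \<bar>u x - u y\<bar> \<le> C * \<rho> \<bar>x - y\<bar>))"

lemma holder_boundedI:
  assumes "modulus_of_continuity \<rho>" "\<And>x. \<bar>u x\<bar> \<le> A" "\<And>x y. \<bar>u x - u y\<bar> \<le> B * \<rho> \<bar>x - y\<bar>"
  shows "holder_bounded \<rho> u"
  unfolding holder_bounded_def
proof (intro exI[of _ "max A B"] conjI allI)
  fix x y
  show "\<bar>u x\<bar> \<le> max A B" using assms(2)[of x] by simp
  have "B * \<rho> \<bar>x - y\<bar> \<le> max A B * \<rho> \<bar>x - y\<bar>"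
    using modulus_nonneg[OF assms(1)] by (intro mult_right_mono) auto
  then show "\<bar>u x - u y\<bar> \<le> max A B * \<rho> \<bar>x - y\<bar>" using assms(3)[of x y] by linarith
qed

text \<open>At distances up to 1 the modulus dominates a multiple of the distance by
  \<open>modulus_star\<close>; at larger distances the sup bound suffices.\<close>

lemma holder_bounded_lipschitz:
  assumes mod: "modulus_of_continuity \<rho>" and b: "\<And>x. \<bar>u x\<bar> \<le> A" and l: "\<And>x y. \<bar>u x - u y\<bar> \<le> L * \<bar>x - y\<bar>"
  shows "holder_bounded \<rho> u"
proof (rule holder_boundedI[OF mod b])
  fix x y :: real
  define t where "t = \<bar>x - y\<bar>"
  have A: "A \<ge> 0" using b[of 0] by linarith
  have L: "L \<ge> 0" using l[of 0 1] by simp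
  have \<rho>1: "\<rho> 1 > 0" using modulus_pos[OF mod] by simp
  have "\<bar>u x - u y\<bar> * \<rho> 1 \<le> (2 * A + L) * \<rho> t"
  proof (cases "t \<le> 1")
    case True
    have "t * \<rho> 1 \<le> \<rho> t"
    proof (cases "t = 0")
      case False
      then have "t > 0" by (simp add: t_def)
      then show ?thesis using modulus_star[OF mod _ True] by (simp add: mult.commute)
    qed (use modulus_nonneg[OF mod] in auto)
    then have "L * (t * \<rho> 1) \<le> L * \<rho> t" using L by (rule mult_left_mono)
    moreover have "\<bar>u x - u y\<bar> * \<rho> 1 \<le> L * t * \<rho> 1"
      using l[of x y] \<rho>1 by (intro mult_right_mono) (auto simp: t_def)
    moreover have "0 \<le> 2 * A * \<rho> t" using A modulus_nonneg[OF mod, of t] by (simp add: t_def)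
    ultimately show ?thesis by (simp add: algebra_simps)
  next
    case False
    have "\<bar>u x - u y\<bar> \<le> 2 * A + L" using b[of x] b[of y] L by linarith
    then show ?thesis using modulus_mono[OF mod, of 1 t] False \<rho>1 A L by (intro mult_mono) auto
  qed
  then show "\<bar>u x - u y\<bar> \<le> (2 * A + L) / \<rho> 1 * \<rho> \<bar>x - y\<bar>" using \<rho>1 by (simp add: t_def field_simps)
qed

lemma holder_bounded_add:
  assumes mod: "modulus_of_continuity \<rho>" and "holder_bounded \<rho> u" "holder_bounded \<rho> v"
  shows "holder_bounded \<rho> (\<lambda>x. u x + v x)"
proof -
  obtain A where A: "\<And>x. \<bar>u x\<bar> \<le> A" "\<And>x y. \<bar>u x - u y\<bar> \<le> A * \<rho> \<bar>x - y\<bar>"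
    using assms by (auto simp: holder_bounded_def)
  obtain B where B: "\<And>x. \<bar>v x\<bar> \<le> B" "\<And>x y. \<bar>v x - v y\<bar> \<le> B * \<rho> \<bar>x - y\<bar>"
    using assms by (auto simp: holder_bounded_def)
  show ?thesis
  proof (rule holder_boundedI[OF mod])
    fix x y
    show "\<bar>u x + v x\<bar> \<le> A + B" using A(1)[of x] B(1)[of x] by linarith
    show "\<bar>u x + v x - (u y + v y)\<bar> \<le> (A + B) * \<rho> \<bar>x - y\<bar>"
      using A(2)[of x y] B(2)[of x y] unfolding distrib_right by linarith
  qed
qed

text \<open>The increment of a product needs sup bounds of the factors, which is why they are part
  of \<open>holder_bounded\<close>.\<close>

lemma holder_bounded_mult:
  assumes mod: "modulus_of_continuity \<rho>" and "holder_bounded \<rho> u" "holder_bounded \<rho> v"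
  shows "holder_bounded \<rho> (\<lambda>x. u x * v x)"
proof -
  obtain A where A: "\<And>x. \<bar>u x\<bar> \<le> A" "\<And>x y. \<bar>u x - u y\<bar> \<le> A * \<rho> \<bar>x - y\<bar>"
    using assms by (auto simp: holder_bounded_def)
  obtain B where B: "\<And>x. \<bar>v x\<bar> \<le> B" "\<And>x y. \<bar>v x - v y\<bar> \<le> B * \<rho> \<bar>x - y\<bar>"
    using assms by (auto simp: holder_bounded_def)
  have A0: "A \<ge> 0" and B0: "B \<ge> 0" using A(1)[of 0] B(1)[of 0] by linarith+
  show ?thesis
  proof (rule holder_boundedI[OF mod])
    fix x y
    show "\<bar>u x * v x\<bar> \<le> A * B" unfolding abs_mult using A(1)[of x] B(1)[of x] A0 by (intro mult_mono) auto
    have "u x * v x - u y * v y = u x * (v x - v y) + (u x - u y) * v y" by (simp add: algebra_simps)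
    then have "\<bar>u x * v x - u y * v y\<bar> \<le> \<bar>u x\<bar> * \<bar>v x - v y\<bar> + \<bar>u x - u y\<bar> * \<bar>v y\<bar>"
      by (metis abs_mult abs_triangle_ineq)
    also have "\<dots> \<le> A * (B * \<rho> \<bar>x - y\<bar>) + (A * \<rho> \<bar>x - y\<bar>) * B"
      using A B A0 B0 modulus_nonneg[OF mod] by (intro add_mono mult_mono) auto
    finally show "\<bar>u x * v x - u y * v y\<bar> \<le> (2 * A * B) * \<rho> \<bar>x - y\<bar>" by (simp add: algebra_simps)
  qed
qed

text \<open>Derivatives up to order k, all bounded and Hoelder. The recursive form with an explicit
  derivative lets the product rule be applied by induction, without formulas for higher derivatives
  of products.\<close>

fun Ck_holder :: "(real \<Rightarrow> real) \<Rightarrow> nat \<Rightarrow> (real \<Rightarrow> real) \<Rightarrow> bool" where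
  "Ck_holder \<rho> 0 u \<longleftrightarrow> holder_bounded \<rho> u"
| "Ck_holder \<rho> (Suc k) u \<longleftrightarrow> holder_bounded \<rho> u \<and>
     (\<exists>u'. (\<forall>x. (u has_real_derivative u' x) (at x)) \<and> Ck_holder \<rho> k u')"

lemma Ck_holder_Suc_imp: "Ck_holder \<rho> (Suc k) u \<Longrightarrow> Ck_holder \<rho> k u"
  by (induction k arbitrary: u) auto

lemma Ck_holder_imp_holder: "Ck_holder \<rho> k u \<Longrightarrow> holder_bounded \<rho> u"
  by (cases k) auto

lemma Ck_holder_add:
  assumes "modulus_of_continuity \<rho>" "Ck_holder \<rho> k u" "Ck_holder \<rho> k v"
  shows "Ck_holder \<rho> k (\<lambda>x. u x + v x)"
  using assms(2,3)
proof (induction k arbitrary: u v)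
  case 0
  then show ?case using holder_bounded_add[OF assms(1)] by simp
next
  case (Suc k)
  obtain u' where u': "\<And>x. (u has_real_derivative u' x) (at x)" "Ck_holder \<rho> k u'" using Suc.prems by auto
  obtain v' where v': "\<And>x. (v has_real_derivative v' x) (at x)" "Ck_holder \<rho> k v'" using Suc.prems by auto
  have "\<forall>x. ((\<lambda>x. u x + v x) has_real_derivative u' x + v' x) (at x)"
    using u' v' by (auto intro: DERIV_add)
  then show ?case using Suc.IH[OF u'(2) v'(2)] Suc.prems holder_bounded_add[OF assms(1)]
    by (auto intro!: exI[of _ "\<lambda>x. u' x + v' x"])
qed

lemma Ck_holder_mult:
  assumes "modulus_of_continuity \<rho>" "Ck_holder \<rho> k u" "Ck_holder \<rho> k v"
  shows "Ck_holder \<rho> k (\<lambda>x. u x * v x)"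
  using assms(2,3)
proof (induction k arbitrary: u v)
  case 0
  then show ?case using holder_bounded_mult[OF assms(1)] by simp
next
  case (Suc k)
  obtain u' where u': "\<And>x. (u has_real_derivative u' x) (at x)" "Ck_holder \<rho> k u'" using Suc.prems by auto
  obtain v' where v': "\<And>x. (v has_real_derivative v' x) (at x)" "Ck_holder \<rho> k v'" using Suc.prems by auto
  have uv: "Ck_holder \<rho> k u" "Ck_holder \<rho> k v" using Suc.prems by (auto intro: Ck_holder_Suc_imp simp del: Ck_holder.simps)
  have "((\<lambda>x. u x * v x) has_real_derivative u' x * v x + u x * v' x) (at x)" for x
    using DERIV_mult[OF u'(1)[of x] v'(1)[of x]] by (simp add: mult.commute)
  moreover have "Ck_holder \<rho> k (\<lambda>x. u' x * v x + u x * v' x)"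
    by (intro Ck_holder_add[OF assms(1)] Suc.IH u'(2) v'(2) uv)
  ultimately show ?case using Suc.prems holder_bounded_mult[OF assms(1)]
    by (auto intro!: exI[of _ "\<lambda>x. u' x * v x + u x * v' x"])
qed

lemma holder_bounded_const: "modulus_of_continuity \<rho> \<Longrightarrow> holder_bounded \<rho> (\<lambda>_. c)"
  by (rule holder_bounded_lipschitz[where A = "\<bar>c\<bar>" and L = 0]) auto

lemma Ck_holder_const: "modulus_of_continuity \<rho> \<Longrightarrow> Ck_holder \<rho> k (\<lambda>_. c)"
  by (induction k arbitrary: c) (auto simp: holder_bounded_const intro!: exI[of _ "\<lambda>_. 0"])

lemma Ck_holder_higher_deriv:
  assumes "Ck_holder \<rho> k u" "j \<le> k"
  shows "holder_bounded \<rho> ((deriv ^^ j) u)"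
    and "j < k \<Longrightarrow> (deriv ^^ j) u differentiable at x"
proof -
  have "holder_bounded \<rho> ((deriv ^^ j) u) \<and> (j < k \<longrightarrow> (\<forall>x. (deriv ^^ j) u differentiable at x))"
    using assms
  proof (induction j arbitrary: k u)
    case 0
    then show ?case by (cases k) (auto simp: real_differentiable_def)
  next
    case (Suc j)
    then obtain k' where k: "k = Suc k'" by (cases k) auto
    then obtain u' where u': "\<And>x. (u has_real_derivative u' x) (at x)" "Ck_holder \<rho> k' u'"
      using Suc.prems by auto
    have "deriv u = u'" using u'(1) by (intro ext DERIV_imp_deriv)
    then show ?case using Suc.IH[OF u'(2)] Suc.prems k by (simp add: funpow_Suc_right del: funpow.simps)
  qed
  then show "holder_bounded \<rho> ((deriv ^^ j) u)" "j < k \<Longrightarrow> (deriv ^^ j) u differentiable at x" by auto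
qed

text \<open>The bounds are asked of \<open>u'\<close> and not of \<open>u\<close>, so the lemma fits
  the z-component of the lift, which is given as an antiderivative.\<close>

lemma Cmw_of_Ck_holder_deriv:
  assumes mod: "modulus_of_continuity \<rho>" and der: "\<And>x. (u has_real_derivative u' x) (at x)"
    and u': "Ck_holder \<rho> k u'"
  shows "Cmw (Suc k) \<rho> u"
proof -
  have du: "deriv u = u'" using der by (intro ext DERIV_imp_deriv)
  have shift: "(deriv ^^ Suc j) u = (deriv ^^ j) u'" for j by (simp add: funpow_Suc_right du del: funpow.simps)
  obtain C where C: "\<And>x y. \<bar>(deriv ^^ k) u' x - (deriv ^^ k) u' y\<bar> \<le> C * \<rho> \<bar>x - y\<bar>" "\<And>x. \<bar>(deriv ^^ k) u' x\<bar> \<le> C"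
    using Ck_holder_higher_deriv(1)[OF u' order_refl] by (auto simp: holder_bounded_def)
  have "\<bar>(deriv ^^ k) u' x - (deriv ^^ k) u' y\<bar> \<le> (\<bar>C\<bar> + 1) * \<rho> \<bar>x - y\<bar>" for x y
  proof -
    have "C * \<rho> \<bar>x - y\<bar> \<le> (\<bar>C\<bar> + 1) * \<rho> \<bar>x - y\<bar>"
      using modulus_nonneg[OF mod] by (intro mult_right_mono) auto
    then show ?thesis using C(1)[of x y] by linarith
  qed
  then have cont: "continuous_on UNIV ((deriv ^^ k) u')"
    by (rule continuous_of_modulus[OF mod, rotated]) simp
  have "Cm (Suc k) u"
    unfolding Cm_def shift
  proof (intro conjI allI impI cont)
    fix j x assume j: "j < Suc k"
    show "(deriv ^^ j) u differentiable at x"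
    proof (cases j)
      case 0
      then show ?thesis using der by (auto simp: real_differentiable_def)
    next
      case (Suc i)
      then show ?thesis unfolding Suc shift using Ck_holder_higher_deriv(2)[OF u', of i] j Suc by auto
    qed
  qed
  moreover have "bdd_above {\<bar>(deriv ^^ Suc k) u b - (deriv ^^ Suc k) u a\<bar> / \<rho> \<bar>b - a\<bar> | a b. a \<noteq> b}"
    unfolding shift
  proof (rule bdd_aboveI[of _ C], clarify)
    fix a b :: real assume "a \<noteq> b"
    then have "\<rho> \<bar>b - a\<bar> > 0" by (intro modulus_pos[OF mod]) simp
    then show "\<bar>(deriv ^^ k) u' b - (deriv ^^ k) u' a\<bar> / \<rho> \<bar>b - a\<bar> \<le> C"
      using C(1)[of b a] by (simp add: divide_le_eq)
  qed
  ultimately show ?thesis by (simp add: Cmw_def)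
qed

section \<open>Filling a gap\<close>

lemma poly_rescaled_higher_pderiv:
  assumes "d > 0"
  shows "poly ((pderiv ^^ k) (pcompose P [:- c / d, 1 / d:])) x = poly ((pderiv ^^ k) P) ((x - c) / d) / (d :: real) ^ k"
proof -
  have "- c / d + x / d = (x - c) / d" using assms by (simp add: field_simps)
  then show ?thesis by (simp add: higher_pderiv_pcompose_linear poly_pcompose power_one_over mult.commute)
qed

text \<open>\<open>D\<close> is the Taylor polynomial at 1 of the discrepancy between the jet at
  \<open>d\<close> and the continued jet of \<open>c\<close>. Whitney's condition gives each
  coefficient in unit scale the same order omega(d - c) (d - c)^m.\<close>

lemma endpoint_correction:
  assumes w: "whitney m \<omega> E F C" and C: "C > 0" and \<omega>: "\<omega> (d - c) \<ge> 0" and cd: "c \<in> E" "d \<in> E" "c < d"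
  shows "\<exists>D. degree D \<le> m \<and>
    (\<forall>k\<le>m. poly ((pderiv ^^ k) (jetpoly m F c (d - c) + D)) 1 = (d - c) ^ k * F k d) \<and>
    (\<forall>t\<in>{0..1}. \<bar>poly D t\<bar> \<le> real (m + 1) * C * \<omega> (d - c) * (d - c) ^ m)"
proof -
  define \<delta> where "\<delta> = d - c"
  have \<delta>: "\<delta> > 0" using cd by (simp add: \<delta>_def)
  define H where "H = (\<lambda>k (x::real). F k d - tjet m F c k d)"
  define J where "J = jetpoly m H d \<delta>"
  define D where "D = pcompose J [:- 1, 1:]"
  have HB: "\<bar>H k d\<bar> \<le> C * \<omega> \<delta> * \<delta> ^ (m - k)" if "k \<le> m" for k
    using w cd that unfolding whitney_def H_def \<delta>_def by fastforce
  have A0: "0 \<le> C * \<omega> \<delta> * \<delta> ^ m" using C \<omega> \<delta> by (simp add: \<delta>_def)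
  have cJ: "\<bar>coeff J k\<bar> \<le> C * \<omega> \<delta> * \<delta> ^ m" for k
  proof (cases "k \<le> m")
    case True
    have "\<bar>coeff J k\<bar> = \<delta> ^ k * \<bar>H k d\<bar> / fact k"
      using True \<delta> by (simp add: J_def coeff_jetpoly abs_mult)
    also have "\<dots> \<le> \<delta> ^ k * \<bar>H k d\<bar> / 1" using \<delta> by (intro divide_left_mono) auto
    also have "\<dots> \<le> \<delta> ^ k * (C * \<omega> \<delta> * \<delta> ^ (m - k))" using HB[OF True] \<delta> by (simp add: mult_left_mono)
    also have "\<dots> = C * \<omega> \<delta> * \<delta> ^ m" using True by (simp add: mult_ac power_add[symmetric])
    finally show ?thesis .
  qed (use A0 in \<open>simp add: J_def coeff_jetpoly\<close>)
  have dJ: "degree J \<le> m" by (simp add: J_def degree_jetpoly)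
  have "poly ((pderiv ^^ k) (jetpoly m F c \<delta> + D)) 1 = \<delta> ^ k * F k d" if k: "k \<le> m" for k
  proof -
    have "poly ((pderiv ^^ k) D) 1 = poly ((pderiv ^^ k) J) 0"
      by (simp add: D_def higher_pderiv_pcompose_linear poly_pcompose)
    also have "\<dots> = \<delta> ^ k * H k d" using k by (simp add: J_def poly_higher_pderiv_jetpoly tjet_base)
    finally show ?thesis
      using k by (simp add: higher_pderiv_add poly_higher_pderiv_jetpoly H_def \<delta>_def algebra_simps)
  qed
  moreover have "degree D \<le> m" using dJ by (simp add: D_def degree_pcompose)
  moreover have "\<bar>poly D t\<bar> \<le> real (m + 1) * C * \<omega> \<delta> * \<delta> ^ m" if "t \<in> {0..1}" for t
  proof -
    have "\<bar>poly J (t - 1)\<bar> \<le> real (m + 1) * (C * \<omega> \<delta> * \<delta> ^ m)"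
      by (rule abs_poly_le_coeffs[OF dJ cJ]) (use that in auto)
    then show ?thesis by (simp add: D_def poly_pcompose mult.assoc)
  qed
  ultimately show ?thesis unfolding \<delta>_def by blast
qed

text \<open>\<open>unit_gap\<close> in the original parameter, for any two points of E. Rescaling
  divides the derivative of order m + 1 by the power m + 1 of the length, so the deviation of order
  sqrt(omega) times the power m leaves sqrt(omega) over the length, which is just what the modulus
  sqrt(omega) tolerates.\<close>

lemma gap_fill:
  assumes mod: "modulus_of_continuity \<omega>" and fd: "field_data m \<omega> E F G z C"
    and sub: "E \<subseteq> {-R..R}" and R: "R \<ge> 1"
  shows "\<exists>C'>0. \<forall>c\<in>E. \<forall>d\<in>E. c < d \<longrightarrow> (\<exists>p q.
     (\<forall>k\<le>m. poly ((pderiv ^^ k) p) c = F k c \<and> poly ((pderiv ^^ k) p) d = F k d \<and>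
            poly ((pderiv ^^ k) q) c = G k c \<and> poly ((pderiv ^^ k) q) d = G k d) \<and>
     (\<forall>y\<in>{c..d}. \<bar>poly ((pderiv ^^ Suc m) p) y\<bar> * (d - c) \<le> C' * sqrt (\<omega> (d - c)) \<and>
                 \<bar>poly ((pderiv ^^ Suc m) q) y\<bar> * (d - c) \<le> C' * sqrt (\<omega> (d - c))) \<and>
     z d - z c = 2 * integral {c..d} (poly (pderiv p * q - p * pderiv q)))"
proof -
  have C: "C > 0" "whitney m \<omega> E F C" "whitney m \<omega> E G C" "area_cond m \<omega> E F G z C"
    using fd by (auto simp: field_data_def)
  define W where "W = \<omega> (2 * R)"
  have W: "W > 0" unfolding W_def using R by (intro modulus_pos[OF mod]) auto
  define C1 where "C1 = real (m + 1) * C"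
  have C1: "C1 > 0" "C \<le> C1"
  proof -
    have "1 * C \<le> real (m + 1) * C" using C by (intro mult_right_mono) auto
    then show "C1 > 0" "C \<le> C1" using C by (auto simp: C1_def)
  qed
  obtain N C2 where C2: "C2 > 0" and gap: "\<forall>p q D1 D2 w \<Delta> z.
    degree p \<le> m \<and> degree q \<le> m \<and> degree D1 \<le> m \<and> degree D2 \<le> m \<and>
    0 < w \<and> w \<le> W \<and> \<Delta> > 0 \<and>
    (\<forall>t\<in>{0..1}. \<bar>poly D1 t\<bar> \<le> C1 * w * \<Delta> \<and> \<bar>poly D2 t\<bar> \<le> C1 * w * \<Delta>) \<and>
    \<bar>defect p q z (poly (p + D1) 1) (poly (q + D2) 1)\<bar> \<le> C1 * w * (\<Delta>\<^sup>2 + \<Delta> * speed p q) \<longrightarrow>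
    (\<exists>P Q. degree P \<le> N \<and> degree Q \<le> N \<and>
       [:0, 1:] ^ Suc m dvd P - p \<and> [:- 1, 1:] ^ Suc m dvd P - (p + D1) \<and>
       [:0, 1:] ^ Suc m dvd Q - q \<and> [:- 1, 1:] ^ Suc m dvd Q - (q + D2) \<and>
       (\<forall>t\<in>{0..1}. \<bar>poly (P - p) t\<bar> \<le> C2 * sqrt w * \<Delta> \<and> \<bar>poly (Q - q) t\<bar> \<le> C2 * sqrt w * \<Delta>) \<and>
       z = 2 * area P Q)"
    using unit_gap[OF W C1(1), of m] by (elim exE conjE) (rule that)
  \<comment> \<open>Markov's inequality is applied to the deviation from the Taylor polynomial,
    whose degree is at most the maximum of \<open>N\<close> and \<open>m\<close>.\<close>
  obtain CM where CM: "CM > 0" "\<And>p B t. degree p \<le> max N m \<Longrightarrow> (\<And>t. t \<in> {0..1} \<Longrightarrow> \<bar>poly p t\<bar> \<le> B) \<Longrightarrow>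
      t \<in> {0..1} \<Longrightarrow> \<bar>poly ((pderiv ^^ Suc m) p) t\<bar> \<le> CM * (B::real)"
    using markov[of "max N m" "Suc m"] by metis
  show ?thesis
  proof (intro exI[of _ "CM * C2"] conjI ballI impI)
    show "CM * C2 > 0" using CM C2 by simp
    fix c d assume cd: "c \<in> E" "d \<in> E" "c < d"
    define \<delta> where "\<delta> = d - c"
    define w where "w = \<omega> \<delta>"
    have "c \<in> {-R..R}" "d \<in> {-R..R}" using cd sub by auto
    then have \<delta>: "\<delta> > 0" "\<delta> \<le> 2 * R" using cd by (auto simp: \<delta>_def)
    have w: "w > 0" "w \<le> W" unfolding w_def W_def
      using \<delta> by (auto intro: modulus_pos[OF mod] modulus_mono[OF mod])
    have \<omega>0: "\<omega> (d - c) \<ge> 0" using w by (simp add: w_def \<delta>_def)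
    let ?P = "jetpoly m F c \<delta>" and ?Q = "jetpoly m G c \<delta>"
    obtain D1 where D1: "degree D1 \<le> m" "\<And>k. k \<le> m \<Longrightarrow> poly ((pderiv ^^ k) (?P + D1)) 1 = \<delta> ^ k * F k d"
        "\<And>t. t \<in> {0..1} \<Longrightarrow> \<bar>poly D1 t\<bar> \<le> C1 * w * \<delta> ^ m"
      using endpoint_correction[OF C(2,1) \<omega>0 cd] unfolding \<delta>_def[symmetric] w_def[symmetric] C1_def by blast
    obtain D2 where D2: "degree D2 \<le> m" "\<And>k. k \<le> m \<Longrightarrow> poly ((pderiv ^^ k) (?Q + D2)) 1 = \<delta> ^ k * G k d"
        "\<And>t. t \<in> {0..1} \<Longrightarrow> \<bar>poly D2 t\<bar> \<le> C1 * w * \<delta> ^ m"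
      using endpoint_correction[OF C(3,1) \<omega>0 cd] unfolding \<delta>_def[symmetric] w_def[symmetric] C1_def by blast
    have "\<bar>defect ?P ?Q (z d - z c) (F 0 d) (G 0 d)\<bar> \<le> C1 * w * ((\<delta> ^ m)\<^sup>2 + \<delta> ^ m * speed ?P ?Q)"
      using area_cond_mono[OF mod C(4) C1(2)] cd by (simp add: area_cond_def \<delta>_def w_def)
    moreover have "poly (?P + D1) 1 = F 0 d" "poly (?Q + D2) 1 = G 0 d" using D1(2)[of 0] D2(2)[of 0] by auto
    ultimately have "degree ?P \<le> m \<and> degree ?Q \<le> m \<and> degree D1 \<le> m \<and> degree D2 \<le> m \<and>
      0 < w \<and> w \<le> W \<and> \<delta> ^ m > 0 \<and>
      (\<forall>t\<in>{0..1}. \<bar>poly D1 t\<bar> \<le> C1 * w * \<delta> ^ m \<and> \<bar>poly D2 t\<bar> \<le> C1 * w * \<delta> ^ m) \<and>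
      \<bar>defect ?P ?Q (z d - z c) (poly (?P + D1) 1) (poly (?Q + D2) 1)\<bar>
        \<le> C1 * w * ((\<delta> ^ m)\<^sup>2 + \<delta> ^ m * speed ?P ?Q)"
      using D1(1,3) D2(1,3) w \<delta> degree_jetpoly by (simp only:) simp
    from gap[rule_format, OF this] obtain P Q where PQ: "degree P \<le> N" "degree Q \<le> N"
       "[:0, 1:] ^ Suc m dvd P - ?P" "[:- 1, 1:] ^ Suc m dvd P - (?P + D1)"
       "[:0, 1:] ^ Suc m dvd Q - ?Q" "[:- 1, 1:] ^ Suc m dvd Q - (?Q + D2)"
       "\<And>t. t \<in> {0..1} \<Longrightarrow> \<bar>poly (P - ?P) t\<bar> \<le> C2 * sqrt w * \<delta> ^ m \<and> \<bar>poly (Q - ?Q) t\<bar> \<le> C2 * sqrt w * \<delta> ^ m"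
       "z d - z c = 2 * area P Q"
      by blast
    define p where "p = pcompose P [:- c / \<delta>, 1 / \<delta>:]"
    define q where "q = pcompose Q [:- c / \<delta>, 1 / \<delta>:]"
    note pq = poly_rescaled_higher_pderiv[OF \<delta>(1), of _ P c, folded p_def]
      poly_rescaled_higher_pderiv[OF \<delta>(1), of _ Q c, folded q_def]
    have dc: "(d - c) / \<delta> = 1" using \<delta> by (simp add: \<delta>_def)
    have jets: "poly ((pderiv ^^ k) X) c = f k c" "poly ((pderiv ^^ k) X) d = f k d"
      if "k \<le> m" "X = pcompose Y [:- c / \<delta>, 1 / \<delta>:]" "[:0, 1:] ^ Suc m dvd Y - jetpoly m f c \<delta>"
        "[:- 1, 1:] ^ Suc m dvd Y - (jetpoly m f c \<delta> + D)"
        "poly ((pderiv ^^ k) (jetpoly m f c \<delta> + D)) 1 = \<delta> ^ k * f k d" for k X Y D f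
    proof -
      have "poly ((pderiv ^^ k) (Y - jetpoly m f c \<delta>)) 0 = 0"
        by (rule poly_higher_pderiv_dvd_0[of 0 "Suc m"]) (use that in auto)
      then have "poly ((pderiv ^^ k) Y) 0 = \<delta> ^ k * f k c"
        using that by (simp add: higher_pderiv_diff poly_higher_pderiv_jetpoly tjet_base)
      then show "poly ((pderiv ^^ k) X) c = f k c"
        using poly_rescaled_higher_pderiv[OF \<delta>(1), of k Y c c] that \<delta> by simp
      have "poly ((pderiv ^^ k) (Y - (jetpoly m f c \<delta> + D))) 1 = 0"
        by (rule poly_higher_pderiv_dvd_0[of 1 "Suc m"]) (use that in auto)
      then have "poly ((pderiv ^^ k) Y) 1 = \<delta> ^ k * f k d"
        using that by (simp add: higher_pderiv_diff)
      then show "poly ((pderiv ^^ k) X) d = f k d"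
        using poly_rescaled_higher_pderiv[OF \<delta>(1), of k Y c d] that \<delta> dc by simp
    qed
    have top: "\<bar>poly ((pderiv ^^ Suc m) X) y\<bar> * (d - c) \<le> CM * C2 * sqrt (\<omega> (d - c))"
      if X: "X = pcompose Y [:- c / \<delta>, 1 / \<delta>:]" and Y: "degree Y \<le> N"
        "\<And>t. t \<in> {0..1} \<Longrightarrow> \<bar>poly (Y - jetpoly m f c \<delta>) t\<bar> \<le> C2 * sqrt w * \<delta> ^ m"
        and y: "y \<in> {c..d}" for X Y f y
    proof -
      have t: "(y - c) / \<delta> \<in> {0..1}" using y \<delta> by (auto simp: \<delta>_def)
      \<comment> \<open>The Taylor polynomial has degree at most m, so only the small deviation
        contributes to the derivative of order m + 1.\<close>
      have "degree (jetpoly m f c \<delta>) < Suc m" using degree_jetpoly by (simp add: less_Suc_eq_le)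
      then have "(pderiv ^^ Suc m) (jetpoly m f c \<delta>) = 0" by (rule higher_pderiv_eq_0)
      then have "(pderiv ^^ Suc m) Y = (pderiv ^^ Suc m) (Y - jetpoly m f c \<delta>)"
        by (simp only: higher_pderiv_diff diff_zero)
      moreover have "\<bar>poly ((pderiv ^^ Suc m) (Y - jetpoly m f c \<delta>)) ((y - c) / \<delta>)\<bar> \<le> CM * (C2 * sqrt w * \<delta> ^ m)"
        by (rule CM(2)[OF degree_diff_le Y(2) t])
          (use Y(1) degree_jetpoly[of m f c \<delta>] in auto)
      ultimately have "\<bar>poly ((pderiv ^^ Suc m) Y) ((y - c) / \<delta>)\<bar> \<le> CM * (C2 * sqrt w * \<delta> ^ m)" by simp
      then have "\<bar>poly ((pderiv ^^ Suc m) Y) ((y - c) / \<delta>)\<bar> / \<delta> ^ Suc m * \<delta> \<le> CM * (C2 * sqrt w * \<delta> ^ m) / \<delta> ^ Suc m * \<delta>"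
        using \<delta> by (intro mult_right_mono divide_right_mono) auto
      also have "\<dots> = CM * C2 * sqrt w" using \<delta> by simp
      finally show ?thesis
        unfolding X poly_rescaled_higher_pderiv[OF \<delta>(1)] using \<delta> by (simp add: w_def \<delta>_def abs_divide del: funpow.simps)
    qed
    have ar: "integral {c..d} (poly (pderiv p * q - p * pderiv q)) = area P Q"
    proof -
      let ?\<phi> = "poly (pderiv P * Q - P * pderiv Q)"
      have "poly (pderiv p * q - p * pderiv q) = (\<lambda>x. ?\<phi> ((x - c) / (d - c)) / (d - c))"
        using pq(1)[of 1] pq(2)[of 1] pq(1)[of 0] pq(2)[of 0]
        by (auto simp: fun_eq_iff \<delta>_def diff_divide_distrib)
      then have "integral {c..d} (poly (pderiv p * q - p * pderiv q)) = integral {c..d} (\<lambda>x. ?\<phi> ((x - c) / (d - c)) / (d - c))"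
        by simp
      also have "\<dots> = area P Q" unfolding area_def pint_def
        by (rule integral_unit_interval[OF cd(3)]) (intro continuous_intros)
      finally show ?thesis .
    qed
    show "\<exists>p q.
     (\<forall>k\<le>m. poly ((pderiv ^^ k) p) c = F k c \<and> poly ((pderiv ^^ k) p) d = F k d \<and>
            poly ((pderiv ^^ k) q) c = G k c \<and> poly ((pderiv ^^ k) q) d = G k d) \<and>
     (\<forall>y\<in>{c..d}. \<bar>poly ((pderiv ^^ Suc m) p) y\<bar> * (d - c) \<le> CM * C2 * sqrt (\<omega> (d - c)) \<and>
                 \<bar>poly ((pderiv ^^ Suc m) q) y\<bar> * (d - c) \<le> CM * C2 * sqrt (\<omega> (d - c))) \<and>
     z d - z c = 2 * integral {c..d} (poly (pderiv p * q - p * pderiv q))"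
    proof (rule exI[of _ p], rule exI[of _ q], intro conjI allI impI ballI)
      show "z d - z c = 2 * integral {c..d} (poly (pderiv p * q - p * pderiv q))" using ar PQ(8) by simp
      fix k assume k: "k \<le> m"
      show "poly ((pderiv ^^ k) p) c = F k c" "poly ((pderiv ^^ k) p) d = F k d"
        by (rule jets[OF k p_def PQ(3,4) D1(2)[OF k]])+
      show "poly ((pderiv ^^ k) q) c = G k c" "poly ((pderiv ^^ k) q) d = G k d"
        by (rule jets[OF k q_def PQ(5,6) D2(2)[OF k]])+
    next
      fix y assume y: "y \<in> {c..d}"
      show "\<bar>poly ((pderiv ^^ Suc m) p) y\<bar> * (d - c) \<le> CM * C2 * sqrt (\<omega> (d - c))"
        by (rule top[OF p_def PQ(1) _ y]) (use PQ(7) in blast)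
      show "\<bar>poly ((pderiv ^^ Suc m) q) y\<bar> * (d - c) \<le> CM * C2 * sqrt (\<omega> (d - c))"
        by (rule top[OF q_def PQ(2) _ y]) (use PQ(7) in blast)
    qed
  qed
qed

section \<open>Neighbouring points of E and the polynomials between them\<close>

definition left_nbr :: "real set \<Rightarrow> real \<Rightarrow> real" where "left_nbr E x = Sup (E \<inter> {..x})"
definition right_nbr :: "real set \<Rightarrow> real \<Rightarrow> real" where "right_nbr E x = Inf (E \<inter> {x..})"

lemma left_nbr_props:
  assumes "closed E" "a \<in> E" "a \<le> x"
  shows "left_nbr E x \<in> E" "left_nbr E x \<le> x" "\<And>e. e \<in> E \<Longrightarrow> e \<le> x \<Longrightarrow> e \<le> left_nbr E x"
proof -
  have ne: "E \<inter> {..x} \<noteq> {}" and bd: "bdd_above (E \<inter> {..x})" using assms by auto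
  have "left_nbr E x \<in> E \<inter> {..x}" unfolding left_nbr_def
    by (rule closed_contains_Sup[OF ne bd]) (use assms in auto)
  then show "left_nbr E x \<in> E" "left_nbr E x \<le> x" by auto
  show "e \<le> left_nbr E x" if "e \<in> E" "e \<le> x" for e
    unfolding left_nbr_def by (rule cSup_upper[OF _ bd]) (use that in auto)
qed

lemma right_nbr_props:
  assumes "closed E" "b \<in> E" "x \<le> b"
  shows "right_nbr E x \<in> E" "x \<le> right_nbr E x" "\<And>e. e \<in> E \<Longrightarrow> x \<le> e \<Longrightarrow> right_nbr E x \<le> e"
proof -
  have ne: "E \<inter> {x..} \<noteq> {}" and bd: "bdd_below (E \<inter> {x..})" using assms by auto
  have "right_nbr E x \<in> E \<inter> {x..}" unfolding right_nbr_def
    by (rule closed_contains_Inf[OF ne bd]) (use assms in auto)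
  then show "right_nbr E x \<in> E" "x \<le> right_nbr E x" by auto
  show "right_nbr E x \<le> e" if "e \<in> E" "x \<le> e" for e
    unfolding right_nbr_def by (rule cInf_lower[OF _ bd]) (use that in auto)
qed

lemma nbr_eq:
  assumes "closed_segment x y \<inter> E = {}"
  shows "left_nbr E x = left_nbr E y" "right_nbr E x = right_nbr E y"
proof -
  have "(z \<le> x \<longleftrightarrow> z \<le> y) \<and> (x \<le> z \<longleftrightarrow> y \<le> z)" if "z \<in> E" for z
  proof -
    have "z \<notin> closed_segment x y" using assms that by blast
    then show ?thesis by (auto simp: closed_segment_eq_real_ivl split: if_splits)
  qed
  then have "E \<inter> {..x} = E \<inter> {..y}" "E \<inter> {x..} = E \<inter> {y..}" by auto
  then show "left_nbr E x = left_nbr E y" "right_nbr E x = right_nbr E y" by (simp_all add: left_nbr_def right_nbr_def)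
qed

text \<open>Beyond \<open>l\<close> and \<open>r\<close> there is no second neighbour; the constants
  chosen there match the jets at \<open>l\<close> and \<open>r\<close> because the higher jets at
  these points will vanish.\<close>

definition gap_poly :: "real set \<Rightarrow> real \<Rightarrow> real \<Rightarrow> (nat \<Rightarrow> real \<Rightarrow> real) \<Rightarrow>
    (real \<Rightarrow> real \<Rightarrow> real poly) \<Rightarrow> real \<Rightarrow> real poly" where
  "gap_poly E l r F pp x =
     (if x < l then [:F 0 l:] else if r < x then [:F 0 r:] else pp (left_nbr E x) (right_nbr E x))"

lemma gap_poly_jet_extension:
  assumes E: "closed E" "l \<in> E" "r \<in> E" "E \<subseteq> {l..r}"
    and mod: "modulus_of_continuity \<rho>" and C: "C > 0" and wh: "whitney m \<rho> E F C"
    and flat: "\<And>k. 0 < k \<Longrightarrow> F k l = 0 \<and> F k r = 0"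
    and pp: "\<And>c d k. c \<in> E \<Longrightarrow> d \<in> E \<Longrightarrow> c < d \<Longrightarrow> k \<le> m \<Longrightarrow>
        poly ((pderiv ^^ k) (pp c d)) c = F k c \<and> poly ((pderiv ^^ k) (pp c d)) d = F k d"
    and top: "\<And>c d y. c \<in> E \<Longrightarrow> d \<in> E \<Longrightarrow> c < d \<Longrightarrow> y \<in> {c..d} \<Longrightarrow>
        \<bar>poly ((pderiv ^^ Suc m) (pp c d)) y\<bar> * (d - c) \<le> C * \<rho> (d - c)"
  shows "jet_extension m E F (gap_poly E l r F pp) \<rho> C"
proof
  show "closed E" "modulus_of_continuity \<rho>" "C > 0" "whitney m \<rho> E F C" by fact+
  note bl = left_nbr_props[OF E(1,2)] and ab = right_nbr_props[OF E(1,3)]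
  have const: "(pderiv ^^ Suc k) [:a:] = 0" for k and a :: real by (rule higher_pderiv_eq_0) simp
  have const_jet: "poly ((pderiv ^^ k) [:f 0 a:]) a = f k a" if "\<And>k. 0 < k \<Longrightarrow> f k a = 0"
    for k a and f :: "nat \<Rightarrow> real \<Rightarrow> real"
    using const[of _ "f 0 a"] that by (cases k) (auto simp del: funpow.simps(2))
  show "gap_poly E l r F pp x = gap_poly E l r F pp y" if xy: "closed_segment x y \<inter> E = {}" for x y
  proof -
    have "l \<notin> closed_segment x y" "r \<notin> closed_segment x y" using xy E by auto
    then show ?thesis using nbr_eq[OF xy]
      by (auto simp: gap_poly_def closed_segment_eq_real_ivl split: if_splits)
  qed
  show "poly ((pderiv ^^ k) (gap_poly E l r F pp x)) a = F k a"
    if a: "a \<in> E" and x: "x \<notin> E" and seg: "open_segment a x \<inter> E = {}" and k: "k \<le> m" for a x k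
  proof -
    have alr: "l \<le> a" "a \<le> r" using a E by auto
    have nlr: "l \<notin> open_segment a x" "r \<notin> open_segment a x" using seg E by auto
    consider "x < l" | "r < x" | "l < x" "x < r" using x E by (metis linorder_cases)
    then show ?thesis
    proof cases
      case 1
      then have "a = l" using alr nlr by (auto simp: open_segment_eq_real_ivl split: if_splits)
      then show ?thesis using 1 const_jet[of F l] flat by (simp add: gap_poly_def)
    next
      case 2
      then have "a = r" using alr nlr by (auto simp: open_segment_eq_real_ivl split: if_splits)
      moreover have "\<not> x < l" using 2 alr by linarith
      ultimately show ?thesis using 2 const_jet[of F r] flat by (simp add: gap_poly_def)
    next
      case 3
      let ?c = "left_nbr E x" and ?d = "right_nbr E x"
      have c: "?c \<in> E" "?c < x" using bl(1,2)[of x] 3 x by (auto simp: less_le)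
      have d: "?d \<in> E" "x < ?d" using ab(1,2)[of x] 3 x by (auto simp: less_le)
      have "a = ?c \<or> a = ?d"
      proof (cases "a < x")
        case True
        then have "a \<le> ?c" using bl(3)[of x a] a 3 by simp
        moreover have "\<not> a < ?c" using seg c by (auto simp: open_segment_eq_real_ivl split: if_splits)
        ultimately show ?thesis by simp
      next
        case False
        then have "x < a" using a x by (metis linorder_cases)
        then have "?d \<le> a" using ab(3)[of x a] a 3 by simp
        moreover have "\<not> ?d < a" using seg d \<open>x < a\<close> by (auto simp: open_segment_eq_real_ivl split: if_splits)
        ultimately show ?thesis by simp
      qed
      then show ?thesis using pp[OF c(1) d(1) _ k] c d 3 by (auto simp: gap_poly_def)
    qed
  qed
  show "\<bar>poly ((pderiv ^^ Suc m) (gap_poly E l r F pp x)) y\<bar> * \<bar>x - c\<bar> \<le> C * \<rho> \<bar>x - c\<bar>"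
    if x: "x \<notin> E" and seg: "open_segment c x \<inter> E = {}" and y: "y \<in> closed_segment c x" for c x y
  proof -
    have rhs: "0 \<le> C * \<rho> \<bar>x - c\<bar>" using C modulus_nonneg[OF mod] by simp
    consider "x < l \<or> r < x" | "x = c" | "l < x" "x < r" "x \<noteq> c" using x E by (metis linorder_cases)
    then show ?thesis
    proof cases
      case 1
      then have "(pderiv ^^ Suc m) (gap_poly E l r F pp x) = 0"
        unfolding gap_poly_def using const by auto
      then show ?thesis using rhs by simp
    next
      case 2
      then show ?thesis using rhs by simp
    next
      case 3
      let ?a = "left_nbr E x" and ?b = "right_nbr E x"
      have a: "?a \<in> E" "?a < x" using bl(1,2)[of x] 3 x by (auto simp: less_le)
      have b: "?b \<in> E" "x < ?b" using ab(1,2)[of x] 3 x by (auto simp: less_le)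
      have "?a \<notin> open_segment c x" "?b \<notin> open_segment c x" using a b seg by auto
      then have c: "?a \<le> c" "c \<le> ?b" using a b by (auto simp: open_segment_eq_real_ivl split: if_splits)
      then have y': "y \<in> {?a..?b}" using y a b by (auto simp: closed_segment_eq_real_ivl split: if_splits)
      define t where "t = \<bar>x - c\<bar>"
      define D where "D = ?b - ?a"
      have t: "0 < t" "t \<le> D" using 3 c a b by (auto simp: t_def D_def)
      let ?v = "\<bar>poly ((pderiv ^^ Suc m) (pp ?a ?b)) y\<bar>"
      \<comment> \<open>The bound is available for the full length \<open>D\<close> of the gap;
        since \<open>\<rho> t / t\<close> is nonincreasing, it implies the bound for the shorter
        length \<open>t\<close>.\<close>
      have "?v * D \<le> C * \<rho> D" using top[OF a(1) b(1) _ y'] a b by (simp add: D_def)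
      then have "?v * D * t \<le> C * \<rho> D * t" using t by (intro mult_right_mono) auto
      also have "\<dots> \<le> C * (\<rho> t * D)" using modulus_star[OF mod t] C by (simp add: mult.assoc)
      finally have "(?v * t) * D \<le> (C * \<rho> t) * D" by (simp add: mult_ac)
      then have "?v * t \<le> C * \<rho> t" using t by simp
      then show ?thesis using 3 by (simp add: gap_poly_def t_def del: funpow.simps)
    qed
  qed
qed

lemma bounded_of_constant_ends:
  fixes u :: "real \<Rightarrow> real"
  assumes "continuous_on UNIV u" "\<And>x. x \<le> l \<Longrightarrow> u x = u l" "\<And>x. r \<le> x \<Longrightarrow> u x = u r" "l \<le> r"
  shows "\<exists>B. \<forall>x. \<bar>u x\<bar> \<le> B"
proof -
  have "compact (u ` {l..r})"
    by (intro compact_continuous_image continuous_on_subset[OF assms(1)]) auto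
  then obtain B where "\<forall>y\<in>u ` {l..r}. norm y \<le> B"
    using compact_imp_bounded[of "u ` {l..r}"] unfolding bounded_iff by blast
  then have B: "\<bar>u x\<bar> \<le> B" if "x \<in> {l..r}" for x using that by auto
  have "\<bar>u x\<bar> \<le> B" for x
  proof -
    consider "x \<le> l" | "r \<le> x" | "x \<in> {l..r}" by fastforce
    then show ?thesis
    proof cases
      case 1
      then show ?thesis using assms(2)[of x] B[of l] assms(4) by (metis atLeastAtMost_iff order_refl)
    next
      case 2
      then show ?thesis using assms(3)[of x] B[of r] assms(4) by (metis atLeastAtMost_iff order_refl)
    qed (rule B)
  qed
  then show ?thesis by blast
qed

lemma lipschitz_of_bounded_derivative:
  fixes u :: "real \<Rightarrow> real"
  assumes "\<And>x. (u has_real_derivative u' x) (at x)" "\<And>x. \<bar>u' x\<bar> \<le> L"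
  shows "\<bar>u x - u y\<bar> \<le> L * \<bar>x - y\<bar>"
  using field_differentiable_bound[of UNIV u u' L x y] assms by simp

context jet_extension
begin

text \<open>The top derivative is Hoelder by \<open>ext_top_holder\<close>; a lower one is Lipschitz
  because the next one is bounded. Constancy at both ends makes continuous functions bounded on the
  whole line.\<close>

lemma ext_Ck_holder:
  assumes ends: "l \<le> r" "\<And>k x. k \<le> m \<Longrightarrow> x \<le> l \<Longrightarrow> ext k x = ext k l" "\<And>k x. k \<le> m \<Longrightarrow> r \<le> x \<Longrightarrow> ext k x = ext k r"
    and k: "k \<le> m"
  shows "Ck_holder \<rho> (m - k) (ext k)"
proof -
  have bd: "\<exists>B. \<forall>x. \<bar>ext k x\<bar> \<le> B" if "k \<le> m" for k
    by (rule bounded_of_constant_ends[OF ext_continuous[OF that] ends(2)[OF that] ends(3)[OF that] ends(1)])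
  show ?thesis
    using k
  proof (induction k rule: inc_induct)
    case base
    obtain B where B: "\<And>x. \<bar>ext m x\<bar> \<le> B" using bd by blast
    then show ?case by simp (rule holder_boundedI[OF modulus B ext_top_holder])
  next
    case (step k)
    obtain B where B: "\<And>x. \<bar>ext k x\<bar> \<le> B" using bd[of k] step.hyps by auto
    obtain L where L: "\<And>x. \<bar>ext (Suc k) x\<bar> \<le> L" using bd[of "Suc k"] step.hyps by auto
    have d: "\<And>x. (ext k has_real_derivative ext (Suc k) x) (at x)" using step.hyps by (intro ext_has_derivative)
    have "holder_bounded \<rho> (ext k)"
      by (rule holder_bounded_lipschitz[OF modulus B lipschitz_of_bounded_derivative[OF d L]])
    moreover have "m - k = Suc (m - Suc k)" using step.hyps by simp
    ultimately show ?case using step.IH d by auto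
  qed
qed

end

lemma gap_poly_ext_ends:
  assumes "jet_extension m E F (gap_poly E l r F pp) \<rho> C" "l \<in> E" "r \<in> E" "E \<subseteq> {l..r}"
    and flat: "\<And>k. 0 < k \<Longrightarrow> F k l = 0 \<and> F k r = 0"
  shows "x \<le> l \<Longrightarrow> jet_extension.ext E F (gap_poly E l r F pp) k x = F k l"
    and "r \<le> x \<Longrightarrow> jet_extension.ext E F (gap_poly E l r F pp) k x = F k r"
proof -
  interpret jet_extension m E F "gap_poly E l r F pp" \<rho> C by fact
  have const: "(pderiv ^^ Suc k) [:a:] = 0" for k and a :: real by (rule higher_pderiv_eq_0) simp
  have lr: "l \<le> r" using assms by auto
  show "ext k x = F k l" if "x \<le> l"
  proof (cases "x = l")
    case False
    then have "x < l" "x \<notin> E" using that assms by auto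
    then show ?thesis using const[of _ "F 0 l"] flat
      by (cases k) (auto simp: ext_def gap_poly_def simp del: funpow.simps(2))
  qed (use assms in \<open>simp add: ext_def\<close>)
  show "ext k x = F k r" if "r \<le> x"
  proof (cases "x = r")
    case False
    then have "r < x" "x \<notin> E" "\<not> x < l" using that assms lr by auto
    then show ?thesis using const[of _ "F 0 r"] flat
      by (cases k) (auto simp: ext_def gap_poly_def simp del: funpow.simps(2))
  qed (use assms in \<open>simp add: ext_def\<close>)
qed

lemma abs_cont_of_lipschitz:
  assumes L: "\<And>x y. \<bar>u x - u y\<bar> \<le> L * \<bar>x - y\<bar>"
  shows "abs_cont u"
  unfolding abs_cont_def
proof (intro allI impI)
  fix c d \<epsilon> :: real assume e: "\<epsilon> > 0"
  have L0: "L \<ge> 0" using L[of 0 1] by simp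
  show "\<exists>\<delta>>0. \<forall>n::nat. \<forall>s v. (\<forall>i<n. c \<le> s i \<and> s i \<le> v i \<and> v i \<le> d) \<and>
      (\<forall>i<n. \<forall>j<n. i \<noteq> j \<longrightarrow> v i \<le> s j \<or> v j \<le> s i) \<and>
      (\<Sum>i<n. v i - s i) < \<delta> \<longrightarrow> (\<Sum>i<n. \<bar>u (v i) - u (s i)\<bar>) < \<epsilon>"
  proof (intro exI[of _ "\<epsilon> / (L + 1)"] conjI allI impI)
    show "\<epsilon> / (L + 1) > 0" using e L0 by simp
    fix n :: nat and s v :: "nat \<Rightarrow> real"
    assume *: "(\<forall>i<n. c \<le> s i \<and> s i \<le> v i \<and> v i \<le> d) \<and>
      (\<forall>i<n. \<forall>j<n. i \<noteq> j \<longrightarrow> v i \<le> s j \<or> v j \<le> s i) \<and> (\<Sum>i<n. v i - s i) < \<epsilon> / (L + 1)"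
    have "(\<Sum>i<n. \<bar>u (v i) - u (s i)\<bar>) \<le> (\<Sum>i<n. (L + 1) * (v i - s i))"
    proof (rule sum_mono)
      fix i assume "i \<in> {..<n}"
      then have i: "s i \<le> v i" using * by auto
      then have "\<bar>u (v i) - u (s i)\<bar> \<le> L * (v i - s i)" using L[of "v i" "s i"] by simp
      also have "\<dots> \<le> (L + 1) * (v i - s i)" using i by (intro mult_right_mono) auto
      finally show "\<bar>u (v i) - u (s i)\<bar> \<le> (L + 1) * (v i - s i)" .
    qed
    also have "\<dots> = (L + 1) * (\<Sum>i<n. v i - s i)" by (simp add: sum_distrib_left)
    also have "\<dots> < (L + 1) * (\<epsilon> / (L + 1))" using * L0 by (intro mult_strict_left_mono) auto
    also have "\<dots> = \<epsilon>" using L0 by simp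
    finally show "(\<Sum>i<n. \<bar>u (v i) - u (s i)\<bar>) < \<epsilon>" .
  qed
qed

text \<open>Extended to be constant on gaps, \<open>u\<close> becomes a function on the interval
  [l,r] whose increments are o(y - x). Its derivative is zero everywhere, so it is constant.\<close>

lemma constant_on_closed_set:
  fixes u :: "real \<Rightarrow> real"
  assumes E: "closed E" "l \<in> E" "r \<in> E" "E \<subseteq> {l..r}"
    and mod: "modulus_of_continuity \<rho>" and K: "K > 0"
    and small: "\<And>a b. a \<in> E \<Longrightarrow> b \<in> E \<Longrightarrow> a < b \<Longrightarrow> b - a \<le> 1 \<Longrightarrow> \<bar>u b - u a\<bar> \<le> K * \<rho> (b - a) * (b - a)"
    and gap: "\<And>c d. c \<in> E \<Longrightarrow> d \<in> E \<Longrightarrow> c < d \<Longrightarrow> {c<..<d} \<inter> E = {} \<Longrightarrow> u c = u d"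
    and x: "x \<in> E"
  shows "u x = u l"
proof -
  note bl = left_nbr_props[OF E(1,2)] and ab = right_nbr_props[OF E(1,3)]
  \<comment> \<open>On a gap \<open>v\<close> takes the value at the left end, equal to that at the
    right end by \<open>gap\<close>.\<close>
  define v where "v = (\<lambda>x. u (left_nbr E x))"
  have left_nbr_E: "left_nbr E e = e" if "e \<in> E" for e
    using bl[of e] that E by (metis antisym atLeastAtMost_iff order_refl subset_iff)
  have est: "\<bar>v y - v x\<bar> \<le> K * \<rho> (y - x) * (y - x)" if xy: "l \<le> x" "x < y" "y \<le> r" "y - x \<le> 1" for x y
  proof -
    have rhs: "0 \<le> K * \<rho> (y - x) * (y - x)" using K modulus_nonneg[OF mod] xy by simp
    let ?c = "left_nbr E x" and ?e = "left_nbr E y" and ?d = "right_nbr E x"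
    have c: "?c \<in> E" "?c \<le> x" and e: "?e \<in> E" "?e \<le> y" and d: "?d \<in> E" "x \<le> ?d"
      using bl(1,2)[of x] bl(1,2)[of y] ab(1,2)[of x] xy by auto
    show ?thesis
    proof (cases "?e \<le> x")
      case True
      then have "?e \<le> ?c" using bl(3)[of x ?e] e xy by auto
      moreover have "?c \<le> ?e" using bl(3)[of y ?c] c xy by auto
      ultimately show ?thesis using rhs by (simp add: v_def)
    next
      case False
      then have de: "?d \<le> ?e" using ab(3)[of x ?e] e xy by auto
      \<comment> \<open>The left neighbour of x may be far away from x, whereas the right neighbour
        lies between x and y; the replacement puts both points of comparison into [x,y].\<close>
      have cd: "u ?c = u ?d"
      proof (cases "x \<in> E")
        case True
        then have "?c = x" "?d = x" using bl(3)[of x x] ab(3)[of x x] c d xy by auto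
        then show ?thesis by simp
      next
        case False
        have "?c < ?d" using False c d by (metis order.strict_trans1 order.not_eq_order_implies_strict order_trans)
        moreover have "{?c<..<?d} \<inter> E = {}"
        proof (rule ccontr)
          assume "{?c<..<?d} \<inter> E \<noteq> {}"
          then obtain w where "w \<in> E" "?c < w" "w < ?d" by auto
          then show False using bl(3)[of x w] ab(3)[of x w] xy by (cases "w \<le> x") auto
        qed
        ultimately show ?thesis using gap c d by blast
      qed
      show ?thesis
      proof (cases "?d = ?e")
        case True
        then show ?thesis using cd rhs by (simp add: v_def)
      next
        case False
        then have "\<bar>u ?e - u ?d\<bar> \<le> K * \<rho> (?e - ?d) * (?e - ?d)" using small d e de xy by auto
        also have "\<dots> \<le> K * \<rho> (y - x) * (y - x)"
          using K d e de xy modulus_nonneg[OF mod]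
          by (intro mult_mono mult_left_mono modulus_mono[OF mod] mult_nonneg_nonneg) auto
        finally show ?thesis using cd by (simp add: v_def)
      qed
    qed
  qed
  have "\<exists>c. \<forall>x\<in>{l..r}. v x = c"
  proof (rule has_field_derivative_zero_constant)
    fix x assume x: "x \<in> {l..r}"
    show "(v has_field_derivative 0) (at x within {l..r})"
      unfolding has_field_derivative_def has_derivative_within_alt
    proof (intro conjI allI impI)
      show "bounded_linear ((*) (0::real))" by (rule bounded_linear_mult_right)
      fix e :: real assume e: "e > 0"
      obtain d where d: "d > 0" "\<And>t. 0 \<le> t \<Longrightarrow> t < d \<Longrightarrow> \<rho> t < e / K"
        using modulus_small[OF mod, of "e / K"] e K by auto
      have "\<bar>v y - v x\<bar> \<le> e * \<bar>y - x\<bar>" if y: "y \<in> {l..r}" "\<bar>y - x\<bar> < min d 1" for y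
      proof (cases "y = x")
        case False
        have "\<bar>v y - v x\<bar> \<le> K * \<rho> \<bar>y - x\<bar> * \<bar>y - x\<bar>"
          using est[of x y] est[of y x] False x y by (cases "x < y") (auto simp: abs_minus_commute)
        also have "\<dots> \<le> K * (e / K) * \<bar>y - x\<bar>"
          using d(2)[of "\<bar>y - x\<bar>"] y K by (intro mult_right_mono mult_left_mono) auto
        finally show ?thesis using K by simp
      qed simp
      then show "\<exists>d>0. \<forall>y\<in>{l..r}. norm (y - x) < d \<longrightarrow> norm (v y - v x - 0 * (y - x)) \<le> e * norm (y - x)"
        using d(1) by (intro exI[of _ "min d 1"]) auto
    qed
  qed simp
  then obtain c where "\<And>x. x \<in> {l..r} \<Longrightarrow> v x = c" by blast
  then have "v x = v l" using x E by auto
  then show ?thesis using left_nbr_E x E by (simp add: v_def)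
qed

section \<open>The horizontal lift\<close>

lemma whitney_sqrt:
  assumes mod: "modulus_of_continuity \<omega>" and w: "whitney m \<omega> E F C" and C: "C > 0"
    and E: "E \<subseteq> {-R..R}" and R: "R \<ge> 1"
  shows "whitney m (\<lambda>t. sqrt (\<omega> t)) E F (C * sqrt (\<omega> (2 * R)))"
  unfolding whitney_def
proof (intro ballI allI impI)
  fix a b k assume *: "a \<in> E" "b \<in> E" "k \<le> m"
  have "a \<in> {-R..R}" "b \<in> {-R..R}" using * E by auto
  then have d: "\<bar>b - a\<bar> \<le> 2 * R" by (simp add: abs_le_iff)
  have "\<bar>F k b - tjet m F a k b\<bar> \<le> C * \<omega> \<bar>b - a\<bar> * \<bar>b - a\<bar> ^ (m - k)"
    using w * by (auto simp: whitney_def)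
  also have "\<dots> \<le> C * (sqrt (\<omega> (2 * R)) * sqrt (\<omega> \<bar>b - a\<bar>)) * \<bar>b - a\<bar> ^ (m - k)"
    using modulus_le_sqrt[OF mod _ d] C by (intro mult_right_mono mult_left_mono) auto
  finally show "\<bar>F k b - tjet m F a k b\<bar>
      \<le> C * sqrt (\<omega> (2 * R)) * sqrt (\<omega> \<bar>b - a\<bar>) * \<bar>b - a\<bar> ^ (m - k)" by (simp add: mult.assoc)
qed

lemma product_difference_bound:
  fixes a b c d a' b' c' d' :: real
  assumes "\<bar>a - a'\<bar> \<le> e" "\<bar>b - b'\<bar> \<le> e" "\<bar>c - c'\<bar> \<le> e" "\<bar>d - d'\<bar> \<le> e"
    and "\<bar>a'\<bar> \<le> L" "\<bar>b'\<bar> \<le> L" "\<bar>c'\<bar> \<le> L" "\<bar>d'\<bar> \<le> L" "\<bar>b\<bar> \<le> L" "\<bar>d\<bar> \<le> L"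
  shows "\<bar>(a * b - c * d) - (a' * b' - c' * d')\<bar> \<le> 4 * L * e"
proof -
  have *: "\<bar>x * y - x' * y'\<bar> \<le> 2 * L * e"
    if "\<bar>x - x'\<bar> \<le> e" "\<bar>y - y'\<bar> \<le> e" "\<bar>x'\<bar> \<le> L" "\<bar>y\<bar> \<le> L" for x y x' y' :: real
  proof -
    have "x * y - x' * y' = (x - x') * y + x' * (y - y')" by (simp add: algebra_simps)
    then have "\<bar>x * y - x' * y'\<bar> \<le> \<bar>x - x'\<bar> * \<bar>y\<bar> + \<bar>x'\<bar> * \<bar>y - y'\<bar>"
      by (metis abs_mult abs_triangle_ineq)
    also have "\<dots> \<le> e * L + L * e" using that by (intro add_mono mult_mono) auto
    finally show ?thesis by simp
  qed
  have "\<bar>a * b - a' * b'\<bar> \<le> 2 * L * e" "\<bar>c * d - c' * d'\<bar> \<le> 2 * L * e"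
    using assms by (auto intro: *)
  then show ?thesis by linarith
qed

lemma continuous_antiderivative:
  fixes W :: "real \<Rightarrow> real"
  assumes "continuous_on UNIV W"
  shows "\<exists>H. \<forall>x. (H has_real_derivative W x) (at x)"
proof -
  have "\<exists>F. \<forall>x::real. (-\<infinity> :: ereal) < x \<longrightarrow> x < \<infinity> \<longrightarrow> (F has_vector_derivative W x) (at x)"
    by (rule einterval_antiderivative) (use assms in \<open>auto simp: continuous_on_eq_continuous_at\<close>)
  then show ?thesis by (simp add: has_real_derivative_iff_has_vector_derivative)
qed

text \<open>The increments of z over short intervals of E agree with those of the horizontal lift of the
  extension up to o(b - a); with agreement across the gaps this forces the two to coincide on E.\<close>

lemma lift_increment:
  assumes m: "m > 0" and mod: "modulus_of_continuity \<omega>" and fd: "field_data m \<omega> E F G z C"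
    and sub: "E \<subseteq> {-R..R}" and R: "R \<ge> 1"
    and f: "jet_extension m E F gf (\<lambda>t. sqrt (\<omega> t)) Cf" and g: "jet_extension m E G gg (\<lambda>t. sqrt (\<omega> t)) Cg"
    and H: "\<And>x. (H has_real_derivative 2 * (jet_extension.ext E F gf 1 x * jet_extension.ext E G gg 0 x
        - jet_extension.ext E F gf 0 x * jet_extension.ext E G gg 1 x)) (at x)"
  shows "\<exists>K>0. \<forall>a\<in>E. \<forall>b\<in>E. a < b \<longrightarrow> b - a \<le> 1 \<longrightarrow>
    \<bar>(H b - H a) - (z b - z a)\<bar> \<le> K * sqrt (\<omega> (b - a)) * (b - a)"
proof -
  interpret f: jet_extension m E F gf "\<lambda>t. sqrt (\<omega> t)" Cf by fact
  interpret g: jet_extension m E G gg "\<lambda>t. sqrt (\<omega> t)" Cg by fact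
  define \<rho> where "\<rho> = (\<lambda>t. sqrt (\<omega> t))"
  have \<rho>: "modulus_of_continuity \<rho>" unfolding \<rho>_def by (rule modulus_sqrt[OF mod])
  have C: "C > 0" "whitney m \<omega> E F C" "whitney m \<omega> E G C" "area_cond m \<omega> E F G z C"
    using fd by (auto simp: field_data_def)
  obtain B1 where B1: "B1 > 0" "jet_bounded m E F B1" using whitney_imp_bounded[OF mod C(2,1) sub R] by blast
  obtain B2 where B2: "B2 > 0" "jet_bounded m E G B2" using whitney_imp_bounded[OF mod C(3,1) sub R] by blast
  define B where "B = B1 + B2"
  have B: "B > 0" "\<And>a k. a \<in> E \<Longrightarrow> k \<le> m \<Longrightarrow> \<bar>F k a\<bar> \<le> B" "\<And>a k. a \<in> E \<Longrightarrow> k \<le> m \<Longrightarrow> \<bar>G k a\<bar> \<le> B"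
    using B1 B2 unfolding B_def jet_bounded_def by force+
  define c0 where "c0 = f.C1 + g.C1"
  have c0: "c0 > 0" using f.C1_pos g.C1_pos by (simp add: c0_def)
  \<comment> \<open>\<open>L\<close> bounds the Taylor polynomials in question and also the
    extension, which differs from them by at most \<open>c0 * \<rho> 1\<close> at distances up to
    1.\<close>
  define L where "L = (real m + 1)\<^sup>2 * B + c0 * \<rho> 1"
  have \<rho>1: "\<rho> 1 > 0" using modulus_pos[OF \<rho>] by simp
  have BL: "(real m + 1)\<^sup>2 * B \<le> L" "B \<le> (real m + 1)\<^sup>2 * B" "real (m + 1) * B \<le> (real m + 1)\<^sup>2 * B"
  proof -
    show "(real m + 1)\<^sup>2 * B \<le> L" using c0 \<rho>1 by (simp add: L_def)
    have "1 * B \<le> (real m + 1)\<^sup>2 * B" using B by (intro mult_right_mono one_le_power) auto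
    then show "B \<le> (real m + 1)\<^sup>2 * B" by simp
    show "real (m + 1) * B \<le> (real m + 1)\<^sup>2 * B"
      using B by (intro mult_right_mono) (auto simp: power2_eq_square algebra_simps)
  qed
  have L: "L > 0" using BL B by linarith
  define s where "s = sqrt (\<omega> (2 * R))"
  have s: "s > 0" unfolding s_def using modulus_pos[OF mod, of "2 * R"] R by simp
  \<comment> \<open>The summands stem from the \<open>defect\<close>, from its two correction terms,
    and from replacing the extension by Taylor polynomials in the area.\<close>
  define K where "K = C * s * (1 + 2 * L) + 4 * L * (C * s) + 8 * L * c0"
  have K: "K > 0" unfolding K_def using C s L c0 by (intro add_pos_pos mult_pos_pos) auto
  have main: "\<bar>(H b - H a) - (z b - z a)\<bar> \<le> K * \<rho> (b - a) * (b - a)"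
    if ab: "a \<in> E" "b \<in> E" "a < b" "b - a \<le> 1" for a b
  proof -
    define \<delta> where "\<delta> = b - a"
    have \<delta>: "0 < \<delta>" "\<delta> \<le> 1" using ab by (auto simp: \<delta>_def)
    have \<rho>\<delta>: "\<rho> \<delta> \<ge> 0" "\<rho> \<delta> \<le> \<rho> 1" using \<delta> modulus_nonneg[OF \<rho>] modulus_mono[OF \<rho>] by auto
    have \<omega>\<rho>: "\<omega> \<delta> \<le> s * \<rho> \<delta>" unfolding s_def \<rho>_def
      by (rule modulus_le_sqrt[OF mod]) (use \<delta> R in auto)
    \<comment> \<open>From \<open>m > 0\<close> and \<open>\<delta> \<le> 1\<close>: it makes both V
      and the power in the Taylor remainder at most a constant times \<open>\<delta>\<close>, so
      that the factor rho gives o(delta).\<close>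
    have \<delta>m: "\<delta> ^ m \<le> \<delta>" "0 \<le> \<delta> ^ m"
    proof -
      have "\<delta> ^ m \<le> \<delta> ^ 1" using m \<delta> by (intro power_decreasing) auto
      then show "\<delta> ^ m \<le> \<delta>" "0 \<le> \<delta> ^ m" using \<delta> by auto
    qed
    let ?P = "jetpoly m F a \<delta>" and ?Q = "jetpoly m G a \<delta>"
    let ?d = "defect ?P ?Q (z b - z a) (F 0 b) (G 0 b)"
    have sp: "speed ?P ?Q \<le> 2 * ((real m + 1)\<^sup>2 * B * 1 ^ m)"
      by (rule defect_jetpoly_bound(2)[where B = B and D = 1]) (use B ab \<delta> in auto)
    have "\<bar>?d\<bar> \<le> C * \<omega> \<delta> * ((\<delta> ^ m)\<^sup>2 + \<delta> ^ m * speed ?P ?Q)"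
      using C(4) ab by (simp add: area_cond_def \<delta>_def)
    also have "\<dots> \<le> C * (s * \<rho> \<delta>) * (\<delta> * (1 + 2 * L))"
    proof (rule mult_mono)
      show "C * \<omega> \<delta> \<le> C * (s * \<rho> \<delta>)" using \<omega>\<rho> C by simp
      have "(\<delta> ^ m)\<^sup>2 \<le> \<delta> * 1" unfolding power2_eq_square using \<delta>m \<delta> by (intro mult_mono) auto
      moreover have "\<delta> ^ m * speed ?P ?Q \<le> \<delta> * (2 * L)"
        using \<delta>m \<delta> sp BL speed_nonneg by (intro mult_mono) auto
      ultimately show "(\<delta> ^ m)\<^sup>2 + \<delta> ^ m * speed ?P ?Q \<le> \<delta> * (1 + 2 * L)" by (simp add: distrib_left)
    qed (use C s \<rho>\<delta> \<delta> speed_nonneg in auto)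
    finally have 1: "\<bar>?d\<bar> \<le> C * s * (1 + 2 * L) * \<rho> \<delta> * \<delta>" by (simp add: mult_ac)
    have end1: "\<bar>X 0 a * (Y 0 b - poly (jetpoly m Y a \<delta>) 1)\<bar> \<le> L * (C * s) * \<rho> \<delta> * \<delta>"
      if Y: "whitney m \<omega> E Y C" and X: "\<bar>X 0 a\<bar> \<le> B" for X Y :: "nat \<Rightarrow> real \<Rightarrow> real"
    proof -
      have "poly (jetpoly m Y a \<delta>) 1 = tjet m Y a 0 b"
        using poly_higher_pderiv_jetpoly[of 0 m Y a \<delta> 1] by (simp add: \<delta>_def)
      then have "\<bar>Y 0 b - poly (jetpoly m Y a \<delta>) 1\<bar> \<le> C * \<omega> \<bar>b - a\<bar> * \<bar>b - a\<bar> ^ (m - 0)"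
        using Y ab by (simp only: whitney_def)
      also have "\<dots> = C * \<omega> \<delta> * \<delta> ^ m" using ab by (simp add: \<delta>_def)
      also have "\<dots> \<le> C * (s * \<rho> \<delta>) * \<delta>"
        using \<omega>\<rho> \<delta>m C s \<rho>\<delta> modulus_nonneg[OF mod, of \<delta>] \<delta> by (intro mult_mono) auto
      finally have "\<bar>X 0 a\<bar> * \<bar>Y 0 b - poly (jetpoly m Y a \<delta>) 1\<bar> \<le> L * (C * (s * \<rho> \<delta>) * \<delta>)"
        using X BL L by (intro mult_mono) auto
      then show ?thesis by (simp add: abs_mult mult_ac)
    qed
    have 2: "\<bar>F 0 a * (G 0 b - poly ?Q 1)\<bar> \<le> L * (C * s) * \<rho> \<delta> * \<delta>"
      "\<bar>G 0 a * (F 0 b - poly ?P 1)\<bar> \<le> L * (C * s) * \<rho> \<delta> * \<delta>"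
      using end1[OF C(3), of F] end1[OF C(2), of G] B ab by auto
    define W where "W = (\<lambda>x. 2 * (f.ext 1 x * g.ext 0 x - f.ext 0 x * g.ext 1 x))"
    have contW: "continuous_on S W" for S
    proof (rule continuous_on_subset[OF _ subset_UNIV])
      show "continuous_on UNIV W"
        unfolding W_def using f.ext_continuous g.ext_continuous m by (intro continuous_intros) auto
    qed
    have "(W has_integral H b - H a) {a..b}"
      by (rule fundamental_theorem_of_calculus)
        (use ab H in \<open>auto simp: W_def has_real_derivative_iff_has_vector_derivative[symmetric] intro: DERIV_subset\<close>)
    then have HW: "H b - H a = integral {a..b} W" by (simp add: integral_unique)
    have I: "integral {a..b} (\<lambda>x. (\<lambda>t. \<delta> * W (a + \<delta> * t)) ((x - a) / (b - a)) / (b - a)) = integral {0..1} (\<lambda>t. \<delta> * W (a + \<delta> * t))"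
      by (rule integral_unit_interval[OF ab(3)])
        (intro continuous_intros continuous_on_compose2[OF contW[of UNIV]] subset_UNIV)
    have Weq: "(\<lambda>x. (\<lambda>t. \<delta> * W (a + \<delta> * t)) ((x - a) / (b - a)) / (b - a)) = W"
      using \<delta> by (auto simp: \<delta>_def)
    have Hu: "H b - H a = integral {0..1} (\<lambda>t. \<delta> * W (a + \<delta> * t))"
      unfolding HW by (fact I[unfolded Weq])
    let ?r = "pderiv ?P * ?Q - ?P * pderiv ?Q"
    have ar: "2 * area ?P ?Q = integral {0..1} (\<lambda>t. 2 * poly ?r t)"
      by (simp add: area_def pint_def del: poly_diff poly_mult)
    have e1: "H b - H a - 2 * area ?P ?Q = integral {0..1} (\<lambda>t. \<delta> * W (a + \<delta> * t) - 2 * poly ?r t)"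
      unfolding Hu ar
      by (rule integral_diff[symmetric];
          intro integrable_continuous_interval continuous_intros continuous_on_compose2[OF contW[of UNIV]] subset_UNIV)
    have e2: "norm (integral {0..1} (\<lambda>t. \<delta> * W (a + \<delta> * t) - 2 * poly ?r t)) \<le> integral {0..1::real} (\<lambda>t. 8 * L * c0 * \<rho> \<delta> * \<delta>)"
    proof (rule integral_norm_bound_integral)
      show "(\<lambda>t. \<delta> * W (a + \<delta> * t) - 2 * poly ?r t) integrable_on {0..1}"
        by (intro integrable_continuous_interval continuous_intros continuous_on_compose2[OF contW[of UNIV]] subset_UNIV)
      fix t :: real assume t: "t \<in> {0..1}"
      define x where "x = a + \<delta> * t"
      have xa: "\<bar>x - a\<bar> \<le> \<delta>" "\<bar>x - a\<bar> \<le> 1" using t \<delta> by (auto simp: x_def abs_mult mult_le_one intro: mult_left_le)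
      have p: "poly (pderiv ?P) t = \<delta> * tjet m F a 1 x" "poly ?P t = tjet m F a 0 x"
        "poly (pderiv ?Q) t = \<delta> * tjet m G a 1 x" "poly ?Q t = tjet m G a 0 x"
        using m poly_higher_pderiv_jetpoly[of 1 m F a \<delta> t] poly_higher_pderiv_jetpoly[of 0 m F a \<delta> t]
          poly_higher_pderiv_jetpoly[of 1 m G a \<delta> t] poly_higher_pderiv_jetpoly[of 0 m G a \<delta> t]
        by (auto simp: x_def)
      have tb: "\<bar>tjet m F a k x\<bar> \<le> (real m + 1)\<^sup>2 * B" "\<bar>tjet m G a k x\<bar> \<le> (real m + 1)\<^sup>2 * B" if "k \<le> m" for k
        using tjet_crude_bound[where F = F and a = a and B = B, OF _ xa(2) order_refl that]
          tjet_crude_bound[where F = G and a = a and B = B, OF _ xa(2) order_refl that] B(2,3)[OF ab(1)] BL(3)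
        by force+
      have err: "C' * \<rho> \<bar>x - a\<bar> * \<bar>x - a\<bar> ^ (m - k) \<le> c0 * \<rho> \<delta>" if "C' \<le> c0" "C' > 0" for C' k
      proof -
        have "C' * \<rho> \<bar>x - a\<bar> * \<bar>x - a\<bar> ^ (m - k) \<le> c0 * \<rho> \<delta> * 1"
          using that c0 xa modulus_nonneg[OF \<rho>] \<rho>\<delta>
          by (intro mult_mono power_le_one modulus_mono[OF \<rho>]) auto
        then show ?thesis by simp
      qed
      have ef: "\<bar>f.ext k x - tjet m F a k x\<bar> \<le> c0 * \<rho> \<delta>" if "k \<le> m" for k
        using f.ext_taylor[OF ab(1) that, of x] err[of f.C1 k] f.C1_pos g.C1_pos by (simp add: \<rho>_def c0_def)
      have eg: "\<bar>g.ext k x - tjet m G a k x\<bar> \<le> c0 * \<rho> \<delta>" if "k \<le> m" for k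
        using g.ext_taylor[OF ab(1) that, of x] err[of g.C1 k] f.C1_pos g.C1_pos by (simp add: \<rho>_def c0_def)
      have c\<rho>: "c0 * \<rho> \<delta> \<le> c0 * \<rho> 1" using \<rho>\<delta> c0 by simp
      have "\<bar>(f.ext 1 x * g.ext 0 x - f.ext 0 x * g.ext 1 x)
          - (tjet m F a 1 x * tjet m G a 0 x - tjet m F a 0 x * tjet m G a 1 x)\<bar> \<le> 4 * L * (c0 * \<rho> \<delta>)"
      proof (rule product_difference_bound)
        show "\<bar>tjet m F a 1 x\<bar> \<le> L" "\<bar>tjet m G a 0 x\<bar> \<le> L" "\<bar>tjet m F a 0 x\<bar> \<le> L" "\<bar>tjet m G a 1 x\<bar> \<le> L"
          using tb[of 0] tb[of 1] BL m by auto
        show "\<bar>g.ext 0 x\<bar> \<le> L" "\<bar>g.ext 1 x\<bar> \<le> L"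
          using tb(2)[of 0] tb(2)[of 1] eg[of 0] eg[of 1] c\<rho> m unfolding L_def by (auto simp: abs_le_iff)
      qed (use ef eg m in auto)
      then have "\<bar>2 * \<delta> * ((f.ext 1 x * g.ext 0 x - f.ext 0 x * g.ext 1 x)
          - (tjet m F a 1 x * tjet m G a 0 x - tjet m F a 0 x * tjet m G a 1 x))\<bar> \<le> 2 * \<delta> * (4 * L * (c0 * \<rho> \<delta>))"
        unfolding abs_mult using \<delta> by (intro mult_mono) auto
      moreover have "\<delta> * W (a + \<delta> * t) - 2 * poly ?r t = 2 * \<delta> * ((f.ext 1 x * g.ext 0 x - f.ext 0 x * g.ext 1 x)
          - (tjet m F a 1 x * tjet m G a 0 x - tjet m F a 0 x * tjet m G a 1 x))"
        by (simp add: p W_def x_def[symmetric] algebra_simps)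
      ultimately show "norm (\<delta> * W (a + \<delta> * t) - 2 * poly ?r t) \<le> 8 * L * c0 * \<rho> \<delta> * \<delta>"
        by (simp add: mult_ac)
    qed (rule integrable_const_ivl)
    have "integral {0..1::real} (\<lambda>t. 8 * L * c0 * \<rho> \<delta> * \<delta>) = 8 * L * c0 * \<rho> \<delta> * \<delta>" by simp
    then have 3: "\<bar>H b - H a - 2 * area ?P ?Q\<bar> \<le> 8 * L * c0 * \<rho> \<delta> * \<delta>"
      using e2 by (simp only: e1 real_norm_def)
    have "z b - z a - 2 * area ?P ?Q = ?d - 2 * (F 0 a * (G 0 b - poly ?Q 1)) + 2 * (G 0 a * (F 0 b - poly ?P 1))"
      by (simp add: defect_def poly_jetpoly_0 mult.assoc)
    then have "\<bar>(H b - H a) - (z b - z a)\<bar> \<le> 8 * L * c0 * \<rho> \<delta> * \<delta> + C * s * (1 + 2 * L) * \<rho> \<delta> * \<delta>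
        + 4 * (L * (C * s) * \<rho> \<delta> * \<delta>)"
      using 1 2 3 by linarith
    also have "\<dots> = K * \<rho> \<delta> * \<delta>" by (simp add: K_def algebra_simps)
    finally show ?thesis by (simp add: \<delta>_def)
  qed
  then show ?thesis using K unfolding \<rho>_def by blast
qed

text \<open>The third component is an antiderivative dictated by the first two, which makes the
  curve horizontal; the work is to show that it agrees with \<open>z\<close> on E.\<close>

lemma horizontal_extension:
  assumes m: "m > 0" and mod: "modulus_of_continuity \<omega>" and fd: "field_data m \<omega> E F G z C"
    and E: "closed E" "l \<in> E" "r \<in> E" "E \<subseteq> {l..r}" and sub: "E \<subseteq> {-R..R}" and R: "R \<ge> 1"
    and flat: "\<And>k. 0 < k \<Longrightarrow> F k l = 0 \<and> F k r = 0" "\<And>k. 0 < k \<Longrightarrow> G k l = 0 \<and> G k r = 0"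
  shows "\<exists>\<Gamma>. horizontal \<Gamma> \<and> Cmw_curve m (\<lambda>t. sqrt (\<omega> t)) \<Gamma> \<and> (\<forall>x\<in>E. \<Gamma> x = (F 0 x, G 0 x, z x))"
proof -
  define \<rho> where "\<rho> = (\<lambda>t. sqrt (\<omega> t))"
  have \<rho>: "modulus_of_continuity \<rho>" unfolding \<rho>_def by (rule modulus_sqrt[OF mod])
  have C: "C > 0" "whitney m \<omega> E F C" "whitney m \<omega> E G C" "area_cond m \<omega> E F G z C"
    using fd by (auto simp: field_data_def)
  have lr: "l \<le> r" using E by auto
  obtain C0 where C0: "C0 > 0" and fill: "\<forall>c\<in>E. \<forall>d\<in>E. c < d \<longrightarrow> (\<exists>p q.
     (\<forall>k\<le>m. poly ((pderiv ^^ k) p) c = F k c \<and> poly ((pderiv ^^ k) p) d = F k d \<and>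
            poly ((pderiv ^^ k) q) c = G k c \<and> poly ((pderiv ^^ k) q) d = G k d) \<and>
     (\<forall>y\<in>{c..d}. \<bar>poly ((pderiv ^^ Suc m) p) y\<bar> * (d - c) \<le> C0 * sqrt (\<omega> (d - c)) \<and>
                 \<bar>poly ((pderiv ^^ Suc m) q) y\<bar> * (d - c) \<le> C0 * sqrt (\<omega> (d - c))) \<and>
     z d - z c = 2 * integral {c..d} (poly (pderiv p * q - p * pderiv q)))"
    using gap_fill[OF mod fd sub R] by (elim exE conjE) (rule that)
  then obtain pp qq where pq: "\<And>c d. c \<in> E \<Longrightarrow> d \<in> E \<Longrightarrow> c < d \<Longrightarrow>
     (\<forall>k\<le>m. poly ((pderiv ^^ k) (pp c d)) c = F k c \<and> poly ((pderiv ^^ k) (pp c d)) d = F k d \<and>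
            poly ((pderiv ^^ k) (qq c d)) c = G k c \<and> poly ((pderiv ^^ k) (qq c d)) d = G k d) \<and>
     (\<forall>y\<in>{c..d}. \<bar>poly ((pderiv ^^ Suc m) (pp c d)) y\<bar> * (d - c) \<le> C0 * sqrt (\<omega> (d - c)) \<and>
                 \<bar>poly ((pderiv ^^ Suc m) (qq c d)) y\<bar> * (d - c) \<le> C0 * sqrt (\<omega> (d - c))) \<and>
     z d - z c = 2 * integral {c..d} (poly (pderiv (pp c d) * qq c d - pp c d * pderiv (qq c d)))"
    by metis
  \<comment> \<open>\<open>C0\<close> serves the gap polynomials, the other summand Whitney's
    condition with respect to the square root of the modulus.\<close>
  define C1 where "C1 = C0 + C * sqrt (\<omega> (2 * R))"
  have s0: "C * sqrt (\<omega> (2 * R)) \<ge> 0" using C R modulus_nonneg[OF mod] by simp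
  have C1: "C1 > 0" "C * sqrt (\<omega> (2 * R)) \<le> C1" "C0 \<le> C1" using C0 s0 by (auto simp: C1_def)
  have wh: "whitney m \<rho> E F C1" "whitney m \<rho> E G C1"
    using whitney_mono[OF \<rho> _ C1(2)] whitney_sqrt[OF mod C(2,1) sub R] whitney_sqrt[OF mod C(3,1) sub R]
    by (auto simp: \<rho>_def)
  have up: "v \<le> C1 * \<rho> t" if "v \<le> C0 * sqrt (\<omega> t)" "t \<ge> 0" for v t
  proof -
    have "C0 * \<rho> t \<le> C1 * \<rho> t" using C1 modulus_nonneg[OF \<rho> that(2)] by (intro mult_right_mono) auto
    then show ?thesis using that by (simp add: \<rho>_def)
  qed
  let ?gf = "gap_poly E l r F pp" and ?gg = "gap_poly E l r G qq"
  have jf: "jet_extension m E F ?gf \<rho> C1"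
    by (rule gap_poly_jet_extension[OF E \<rho> C1(1) wh(1) flat(1)]) (use pq up in \<open>auto simp del: funpow.simps\<close>)
  have jg: "jet_extension m E G ?gg \<rho> C1"
    by (rule gap_poly_jet_extension[OF E \<rho> C1(1) wh(2) flat(2)]) (use pq up in \<open>auto simp del: funpow.simps\<close>)
  interpret f: jet_extension m E F ?gf \<rho> C1 by (fact jf)
  interpret g: jet_extension m E G ?gg \<rho> C1 by (fact jg)
  have chf: "Ck_holder \<rho> (m - k) (f.ext k)" if "k \<le> m" for k
    by (rule f.ext_Ck_holder[OF lr _ _ that])
      (simp_all add: gap_poly_ext_ends[OF jf E(2,3,4) flat(1)])
  have chg: "Ck_holder \<rho> (m - k) (g.ext k)" if "k \<le> m" for k
    by (rule g.ext_Ck_holder[OF lr _ _ that])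
      (simp_all add: gap_poly_ext_ends[OF jg E(2,3,4) flat(2)])
  obtain n where n: "m = Suc n" using m by (cases m) auto
  define W where "W = (\<lambda>x. 2 * (f.ext 1 x * g.ext 0 x - f.ext 0 x * g.ext 1 x))"
  \<comment> \<open>The integrand \<open>W\<close> contains first derivatives and so has only m - 1
    derivatives under control; integration returns the lost order to the lift.\<close>
  have ch: "Ck_holder \<rho> n (f.ext 0)" "Ck_holder \<rho> n (f.ext 1)" "Ck_holder \<rho> n (g.ext 0)" "Ck_holder \<rho> n (g.ext 1)"
    using chf[of 0] chf[of 1] chg[of 0] chg[of 1] n by (auto intro: Ck_holder_Suc_imp simp del: Ck_holder.simps)
  have chW: "Ck_holder \<rho> n W"
  proof -
    have "Ck_holder \<rho> n (\<lambda>x. 2 * (f.ext 1 x * g.ext 0 x + (-1) * (f.ext 0 x * g.ext 1 x)))"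
      by (intro Ck_holder_mult[OF \<rho>] Ck_holder_add[OF \<rho>] Ck_holder_const[OF \<rho>] ch)
    then show ?thesis by (simp add: W_def)
  qed
  have contW: "continuous_on UNIV W"
    unfolding W_def using f.ext_continuous g.ext_continuous m by (intro continuous_intros) auto
  obtain H0 where H0: "\<And>x. (H0 has_real_derivative W x) (at x)" using continuous_antiderivative[OF contW] by blast
  \<comment> \<open>The constant of integration makes the lift agree with \<open>z\<close> at
    \<open>l\<close>; agreement then propagates to all of E.\<close>
  define H where "H = (\<lambda>x. H0 x + (z l - H0 l))"
  have H: "(H has_real_derivative W x) (at x)" for x
    unfolding H_def using DERIV_add[OF H0[of x] DERIV_const[of "z l - H0 l"]] by simp
  obtain K where K: "K > 0" "\<forall>a\<in>E. \<forall>b\<in>E. a < b \<longrightarrow> b - a \<le> 1 \<longrightarrow>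
    \<bar>(H b - H a) - (z b - z a)\<bar> \<le> K * sqrt (\<omega> (b - a)) * (b - a)"
    using lift_increment[OF m mod fd sub R jf[unfolded \<rho>_def] jg[unfolded \<rho>_def] H[unfolded W_def]] by blast
  have Hz: "H x = z x" if x: "x \<in> E" for x
  proof -
    have "H x - z x = H l - z l"
    proof (rule constant_on_closed_set[OF E \<rho> K(1) _ _ x, where u = "\<lambda>x. H x - z x"])
      show "\<bar>(H b - z b) - (H a - z a)\<bar> \<le> K * \<rho> (b - a) * (b - a)"
        if "a \<in> E" "b \<in> E" "a < b" "b - a \<le> 1" for a b
      proof -
        have "(H b - z b) - (H a - z a) = (H b - H a) - (z b - z a)" by simp
        then show ?thesis using K(2) that by (simp only: \<rho>_def)
      qed
      show "H c - z c = H d - z d" if cd: "c \<in> E" "d \<in> E" "c < d" "{c<..<d} \<inter> E = {}" for c d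
      proof -
        let ?p = "pp c d" and ?q = "qq c d"
        \<comment> \<open>On a gap the extension and its first derivatives are those of the chosen
          polynomials, also at the two end points, where the jets match. Hence the lift increases by
          the area prescribed in \<open>gap_fill\<close>.\<close>
        have W_poly: "W x = 2 * poly (pderiv ?p * ?q - ?p * pderiv ?q) x" if x: "x \<in> {c..d}" for x
        proof -
          have "f.ext k x = poly ((pderiv ^^ k) ?p) x \<and> g.ext k x = poly ((pderiv ^^ k) ?q) x" if k: "k \<le> m" for k
          proof (cases "x \<in> E")
            case True
            then have "x = c \<or> x = d" using x cd by (auto simp: less_le)
            then show ?thesis using pq[OF cd(1-3)] k True by (auto simp: f.ext_def g.ext_def)
          next
            case False
            have lcd: "l \<le> c" "d \<le> r" using E cd by auto
            have cxd: "c < x" "x < d" using x False cd by (auto simp: less_le)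
            have "left_nbr E x = c"
            proof (rule antisym)
              show "c \<le> left_nbr E x" using left_nbr_props(3)[OF E(1), of c x c] cd cxd by auto
              show "left_nbr E x \<le> c"
              proof (rule ccontr)
                assume "\<not> left_nbr E x \<le> c"
                then have "left_nbr E x \<in> {c<..<d} \<inter> E"
                  using left_nbr_props(1,2)[OF E(1) cd(1), of x] cxd by auto
                then show False using cd by blast
              qed
            qed
            moreover have "right_nbr E x = d"
            proof (rule antisym)
              show "right_nbr E x \<le> d" using right_nbr_props(3)[OF E(1), of d x d] cd cxd by auto
              show "d \<le> right_nbr E x"
              proof (rule ccontr)
                assume "\<not> d \<le> right_nbr E x"
                then have "right_nbr E x \<in> {c<..<d} \<inter> E"
                  using right_nbr_props(1,2)[OF E(1) cd(2), of x] cxd by auto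
                then show False using cd by blast
              qed
            qed
            ultimately show ?thesis using False cxd lcd by (auto simp: f.ext_def g.ext_def gap_poly_def)
          qed
          from this[of 0] this[of 1] show ?thesis using m by (simp add: W_def)
        qed
        have "(W has_integral H d - H c) {c..d}"
          by (rule fundamental_theorem_of_calculus)
            (use cd H in \<open>auto simp: has_real_derivative_iff_has_vector_derivative[symmetric] intro: DERIV_subset\<close>)
        then have "H d - H c = integral {c..d} W" by (simp add: integral_unique)
        also have "\<dots> = integral {c..d} (\<lambda>x. 2 * poly (pderiv ?p * ?q - ?p * pderiv ?q) x)"
          using W_poly by (intro integral_cong) auto
        also have "\<dots> = z d - z c" using pq[OF cd(1-3)] by (simp del: poly_diff poly_mult)
        finally show ?thesis by simp
      qed
    qed
    then show ?thesis by (simp add: H_def)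
  qed
  define \<Gamma> where "\<Gamma> = (\<lambda>x. (f.ext 0 x, g.ext 0 x, H x))"
  have c: "cx \<Gamma> = f.ext 0" "cy \<Gamma> = g.ext 0" "cz \<Gamma> = H" by (auto simp: \<Gamma>_def cx_def cy_def cz_def)
  have df: "(f.ext 0 has_real_derivative f.ext 1 x) (at x)" and dg: "(g.ext 0 has_real_derivative g.ext 1 x) (at x)" for x
    using f.ext_has_derivative[OF m] g.ext_has_derivative[OF m] by auto
  have ac: "abs_cont u" if d: "\<And>x. (u has_real_derivative u' x) (at x)" and ch': "Ck_holder \<rho> n u'" for u u'
  proof -
    obtain B where "\<And>x. \<bar>u' x\<bar> \<le> B" using Ck_holder_imp_holder[OF ch'] by (auto simp: holder_bounded_def)
    then show ?thesis using abs_cont_of_lipschitz[OF lipschitz_of_bounded_derivative[OF d]] by blast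
  qed
  have "horizontal \<Gamma>"
    unfolding horizontal_def c
  proof (intro conjI ac[OF df ch(2)] ac[OF dg ch(4)] ac[OF H chW] AE_I2)
    fix t
    show "\<exists>df dg dh. (f.ext 0 has_real_derivative df) (at t) \<and> (g.ext 0 has_real_derivative dg) (at t) \<and>
        (H has_real_derivative dh) (at t) \<and> dh = 2 * (df * g.ext 0 t - f.ext 0 t * dg)"
      using df dg H[of t] unfolding W_def by blast
  qed
  moreover have "Cmw_curve m (\<lambda>t. sqrt (\<omega> t)) \<Gamma>"
    unfolding Cmw_curve_def c n \<rho>_def[symmetric]
    using Cmw_of_Ck_holder_deriv[OF \<rho>] df ch(2) dg ch(4) H chW by blast
  moreover have "\<forall>x\<in>E. \<Gamma> x = (F 0 x, G 0 x, z x)"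
    using Hz by (simp add: \<Gamma>_def f.ext_def g.ext_def)
  ultimately show ?thesis by blast
qed

section \<open>The finiteness theorem\<close>

lemma seminorm_bound:
  assumes "Cmw m \<omega> \<phi>" "modulus_of_continuity \<omega>"
  shows "seminorm m \<omega> \<phi> \<ge> 0"
    and "\<bar>(deriv ^^ m) \<phi> b - (deriv ^^ m) \<phi> a\<bar> \<le> seminorm m \<omega> \<phi> * \<omega> \<bar>b - a\<bar>"
proof -
  let ?S = "{\<bar>(deriv ^^ m) \<phi> b - (deriv ^^ m) \<phi> a\<bar> / \<omega> \<bar>b - a\<bar> | a b. a \<noteq> b}"
  have bdd: "bdd_above ?S" using assms by (simp add: Cmw_def)
  have le: "\<bar>(deriv ^^ m) \<phi> b - (deriv ^^ m) \<phi> a\<bar> / \<omega> \<bar>b - a\<bar> \<le> seminorm m \<omega> \<phi>" if "a \<noteq> b" for a b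
    unfolding seminorm_def by (rule cSup_upper[OF _ bdd]) (use that in blast)
  have "0 \<le> \<bar>(deriv ^^ m) \<phi> 1 - (deriv ^^ m) \<phi> 0\<bar> / \<omega> \<bar>1 - 0\<bar>"
    using modulus_nonneg[OF assms(2)] by simp
  also have "\<dots> \<le> seminorm m \<omega> \<phi>" by (rule le) simp
  finally show "seminorm m \<omega> \<phi> \<ge> 0" .
  show "\<bar>(deriv ^^ m) \<phi> b - (deriv ^^ m) \<phi> a\<bar> \<le> seminorm m \<omega> \<phi> * \<omega> \<bar>b - a\<bar>"
  proof (cases "a = b")
    case True
    then show ?thesis using assms by (simp add: modulus_of_continuity_def)
  next
    case False
    then have "\<omega> \<bar>b - a\<bar> > 0" by (intro modulus_pos[OF assms(2)]) simp
    then show ?thesis using le[OF False] by (simp add: pos_divide_le_eq)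
  qed
qed

lemma A_fun_bound:
  assumes "\<bar>A_fun m \<Gamma> a b / V_fun m \<Gamma> a b\<bar> \<le> c" "a < b"
  shows "\<bar>A_fun m \<Gamma> a b\<bar> \<le> c * V_fun m \<Gamma> a b"
proof -
  have "(b - a) ^ (2 * m) > 0" using assms by simp
  moreover have "0 \<le> (b - a) ^ m * speed (jetpoly m (\<lambda>k. (deriv ^^ k) (cx \<Gamma>)) a (b - a))
      (jetpoly m (\<lambda>k. (deriv ^^ k) (cy \<Gamma>)) a (b - a))" using assms speed_nonneg by simp
  ultimately have "V_fun m \<Gamma> a b > 0" unfolding V_fun_eq_speed[OF assms(2)] by linarith
  then show ?thesis using assms(1) by (simp add: abs_divide pos_divide_le_eq)
qed

theorem theorem1p8:
  fixes m :: nat and K :: "real set" and \<gamma> :: curve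
    and \<omega> :: "real \<Rightarrow> real" and M :: real
  assumes "m > 0"
    and "compact K"
    and "finite {x \<in> K. \<not> x islimpt K}"
    and "modulus_of_continuity \<omega>"
    and "M > 0"
    and "\<exists>\<Gamma>X :: real set \<Rightarrow> curve.
           (\<forall>X. X \<subseteq> K \<and> finite X \<and> card X = m + 2 \<longrightarrow>
               Cmw_curve m \<omega> (\<Gamma>X X) \<and> (\<forall>x\<in>X. \<Gamma>X X x = \<gamma> x) \<and>
               (\<forall>a\<in>K. \<forall>b\<in>K. a < b \<longrightarrow>
                  \<bar>A_fun m (\<Gamma>X X) a b / V_fun m (\<Gamma>X X) a b\<bar> \<le> M * \<omega> (b - a))) \<and>
           (\<exists>C. \<forall>X. X \<subseteq> K \<and> finite X \<and> card X = m + 2 \<longrightarrow>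
               curve_seminorm m \<omega> (\<Gamma>X X) \<le> C)"
  shows "\<exists>\<Gamma>. horizontal \<Gamma> \<and> Cmw_curve m (\<lambda>t. sqrt (\<omega> t)) \<Gamma> \<and> (\<forall>x\<in>K. \<Gamma> x = \<gamma> x)"
proof -
  note mod = assms(4)
  obtain \<Gamma>X :: "real set \<Rightarrow> curve" and C0 where fam: "\<forall>X. X \<subseteq> K \<and> finite X \<and> card X = m + 2 \<longrightarrow>
               Cmw_curve m \<omega> (\<Gamma>X X) \<and> (\<forall>x\<in>X. \<Gamma>X X x = \<gamma> x) \<and>
               (\<forall>a\<in>K. \<forall>b\<in>K. a < b \<longrightarrow>
                  \<bar>A_fun m (\<Gamma>X X) a b / V_fun m (\<Gamma>X X) a b\<bar> \<le> M * \<omega> (b - a))"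
    and sn: "\<forall>X. X \<subseteq> K \<and> finite X \<and> card X = m + 2 \<longrightarrow> curve_seminorm m \<omega> (\<Gamma>X X) \<le> C0"
    using assms(6) by (elim exE conjE) (rule that)
  have curve: "Cmw_curve m \<omega> (\<Gamma>X X)"
    and interp: "\<And>x. x \<in> X \<Longrightarrow> \<Gamma>X X x = \<gamma> x"
    and AV: "\<And>a b. a \<in> K \<Longrightarrow> b \<in> K \<Longrightarrow> a < b \<Longrightarrow>
        \<bar>A_fun m (\<Gamma>X X) a b / V_fun m (\<Gamma>X X) a b\<bar> \<le> M * \<omega> (b - a)"
    and sn: "curve_seminorm m \<omega> (\<Gamma>X X) \<le> C0"
    if "X \<subseteq> K" "finite X" "card X = m + 2" for X
    using fam[rule_format, of X] sn[rule_format, of X] that by simp_all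
  \<comment> \<open>The seminorms of the components are nonnegative, so a bound on their sum bounds
    each; adding 1 makes the constant positive.\<close>
  define C where "C = \<bar>C0\<bar> + 1"
  have hol: "\<bar>(deriv ^^ m) \<phi> b - (deriv ^^ m) \<phi> a\<bar> \<le> C * \<omega> \<bar>b - a\<bar>"
    if X: "X \<subseteq> K" "finite X" "card X = m + 2" and \<phi>: "\<phi> = cx (\<Gamma>X X) \<or> \<phi> = cy (\<Gamma>X X)" for X \<phi> a b
  proof -
    have c: "Cmw m \<omega> (cx (\<Gamma>X X))" "Cmw m \<omega> (cy (\<Gamma>X X))" "Cmw m \<omega> (cz (\<Gamma>X X))"
      using curve[OF X] by (auto simp: Cmw_curve_def)
    have "seminorm m \<omega> \<phi> \<le> C"
      using sn[OF X] \<phi> seminorm_bound(1)[OF c(1) mod] seminorm_bound(1)[OF c(2) mod] seminorm_bound(1)[OF c(3) mod]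
      unfolding curve_seminorm_def C_def by auto
    then have "seminorm m \<omega> \<phi> * \<omega> \<bar>b - a\<bar> \<le> C * \<omega> \<bar>b - a\<bar>"
      using modulus_nonneg[OF mod] by (intro mult_right_mono) auto
    moreover have "\<bar>(deriv ^^ m) \<phi> b - (deriv ^^ m) \<phi> a\<bar> \<le> seminorm m \<omega> \<phi> * \<omega> \<bar>b - a\<bar>"
      using \<phi> c by (intro seminorm_bound(2)[OF _ mod]) auto
    ultimately show ?thesis by linarith
  qed
  have If: "interpolant_family m \<omega> K (\<lambda>X. cx (\<Gamma>X X)) (cx \<gamma>) C"
    by unfold_locales
      (use mod curve interp hol in \<open>auto simp: C_def Cmw_curve_def Cmw_def cx_def[abs_def]\<close>)
  have Ig: "interpolant_family m \<omega> K (\<lambda>X. cy (\<Gamma>X X)) (cy \<gamma>) C"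
    by unfold_locales
      (use mod curve interp hol in \<open>auto simp: C_def Cmw_curve_def Cmw_def cy_def[abs_def]\<close>)
  obtain R0 where R0: "R0 > 0" "\<And>x. x \<in> K \<Longrightarrow> \<bar>x\<bar> \<le> R0"
    using compact_imp_bounded[OF assms(2)] unfolding bounded_pos by auto
  define R where "R = R0 + 1"
  have R: "R \<ge> 1" "K \<subseteq> {-R..R}" using R0 by (force simp: R_def)+
  define K' where "K' = {a \<in> K. a islimpt K}"
  obtain F G C1 where FG: "C1 > 0" "whitney m \<omega> K' F C1" "whitney m \<omega> K' G C1"
     "area_cond m \<omega> K' F G (cz \<gamma>) C1" "\<And>a. a \<in> K' \<Longrightarrow> F 0 a = cx \<gamma> a \<and> G 0 a = cy \<gamma> a"
  proof -
    have "\<exists>F G C. C > 0 \<and> whitney m \<omega> {a \<in> K. a islimpt K} F C \<and> whitney m \<omega> {a \<in> K. a islimpt K} G C \<and>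
     area_cond m \<omega> {a \<in> K. a islimpt K} F G (cz \<gamma>) C \<and>
     (\<forall>a\<in>K. a islimpt K \<longrightarrow> F 0 a = cx \<gamma> a \<and> G 0 a = cy \<gamma> a)"
    proof (rule limit_point_data[OF If Ig _ R(2)])
      show "0 \<le> M" using assms(5) by simp
      fix X a b assume X: "X \<subseteq> K" "finite X" "card X = m + 2" and ab: "a \<in> X" "b \<in> X" "a < b"
      have v: "\<Gamma>X X a = \<gamma> a" "\<Gamma>X X b = \<gamma> b" using interp[OF X] ab by auto
      have "\<bar>A_fun m (\<Gamma>X X) a b\<bar> \<le> M * \<omega> (b - a) * V_fun m (\<Gamma>X X) a b"
        by (rule A_fun_bound[OF AV[OF X]]) (use ab X in auto)
      then show "\<bar>defect (jetpoly m (\<lambda>k. (deriv ^^ k) (cx (\<Gamma>X X))) a (b - a)) (jetpoly m (\<lambda>k. (deriv ^^ k) (cy (\<Gamma>X X))) a (b - a))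
         (cz \<gamma> b - cz \<gamma> a) (cx \<gamma> b) (cy \<gamma> b)\<bar>
      \<le> M * \<omega> (b - a) * (((b - a) ^ m)\<^sup>2 + (b - a) ^ m *
         speed (jetpoly m (\<lambda>k. (deriv ^^ k) (cx (\<Gamma>X X))) a (b - a)) (jetpoly m (\<lambda>k. (deriv ^^ k) (cy (\<Gamma>X X))) a (b - a)))"
        unfolding A_fun_eq_defect[OF ab(3)] V_fun_eq_speed[OF ab(3)]
        by (simp add: v cx_def cy_def cz_def power_mult mult.commute[of 2 m])
    qed
    then show ?thesis using that unfolding K'_def by blast
  qed
  have fd: "field_data m \<omega> K' F G (cz \<gamma>) C1" using FG by (simp add: field_data_def)
  have cl: "closed K'"
  proof -
    have "K' = {a. a islimpt K}"
      using compact_imp_closed[OF assms(2)] by (auto simp: K'_def closed_limpt)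
    then show ?thesis by (simp add: closed_limpts)
  qed
  \<comment> \<open>Since \<open>R = R0 + 1\<close>, the two added points lie outside K. Like the
    isolated points they receive vanishing higher jets, and their values are those that the total
    function \<open>\<gamma>\<close> happens to take there.\<close>
  define S where "S = {x \<in> K. \<not> x islimpt K} \<union> {-R, R}"
  have notK: "- R \<notin> K" "R \<notin> K" using R0 by (force simp: R_def)+
  have S: "finite S" "K' \<inter> S = {}" "K' \<union> S \<subseteq> {-R..R}" "K \<subseteq> K' \<union> S"
    using assms(3) notK R R0 by (auto simp: S_def K'_def)
  obtain F' G' C2 where FG': "field_data m \<omega> (K' \<union> S) F' G' (cz \<gamma>) C2"
     "\<forall>a\<in>K' \<union> S. F' 0 a = cx \<gamma> a \<and> G' 0 a = cy \<gamma> a" "\<forall>a\<in>S. \<forall>k>0. F' k a = 0 \<and> G' k a = 0"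
    using field_data_add_finite[OF mod fd cl S(2,1,3) R(1) FG(5)] by blast
  have "\<exists>\<Gamma>. horizontal \<Gamma> \<and> Cmw_curve m (\<lambda>t. sqrt (\<omega> t)) \<Gamma> \<and>
      (\<forall>x\<in>K' \<union> S. \<Gamma> x = (F' 0 x, G' 0 x, cz \<gamma> x))"
  proof (rule horizontal_extension[OF assms(1) mod FG'(1) _ _ _ S(3) S(3) R(1)])
    show "closed (K' \<union> S)" using cl S(1) by (auto intro: finite_imp_closed)
    show "- R \<in> K' \<union> S" "R \<in> K' \<union> S" by (auto simp: S_def)
    show "\<And>k. 0 < k \<Longrightarrow> F' k (- R) = 0 \<and> F' k R = 0" "\<And>k. 0 < k \<Longrightarrow> G' k (- R) = 0 \<and> G' k R = 0"
      using FG'(3) by (auto simp: S_def)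
  qed
  then obtain \<Gamma> where \<Gamma>: "horizontal \<Gamma>" "Cmw_curve m (\<lambda>t. sqrt (\<omega> t)) \<Gamma>"
      "\<And>x. x \<in> K' \<union> S \<Longrightarrow> \<Gamma> x = (F' 0 x, G' 0 x, cz \<gamma> x)" by blast
  have "\<Gamma> x = \<gamma> x" if "x \<in> K" for x
    using \<Gamma>(3)[of x] FG'(2) S(4) that by (auto simp: cx_def cy_def cz_def)
  then show ?thesis using \<Gamma> by blast
qed

end
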